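(* The class of groups with solvable word problem is not dense in the space of finitely generated groups. In particular, the class of isolated groups is not dense in the space of finitely generated groups.
   Context: $F_m$ is the free group of rank $m$, and $\mathcal{G}_m$ is the set of normal subgroups of $F_m$ with the topology induced by the product topology on $\{0,1\}^{F_m}$; a point $N$ represents the marked group $F_m/N$. An isomorphism-closed class $\mathcal{C}$ of finitely generated groups is dense in the space of finitely generated groups if for every $m\ge 1$ the set $\{N\in\mathcal{G}_m : F_m/N\in\mathcal{C}\}$ is dense in $\mathcal{G}_m$. A group $G$ is isolated if it is finitely generated and, for some $m$ and some normal subgroup $N$ of $F_m$ with $F_m/N\cong G$, the point $N$ is isolated in $\mathcal{G}_m$ (this does not depend on the choice of $m$ and $N$). A finitely generated group $G=F/N$, with $F$ free of finite rank, has solvable word problem if $N$ is a recursive subset of $F$. *)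

theory Defs
  imports
    "HOL-Analysis.Analysis"
    "HOL-Algebra.Generated_Groups"
    "HOL-Library.Nat_Bijection"
begin

section \<open>Free groups of finite rank\<close>

text \<open>The letter \<open>(i, True)\<close> stands for the \<open>i\<close>-th basis element and \<open>(i, False)\<close> for its
  inverse. Words of every rank live in one type, so the quotients of all the groups
  \<open>F\<^sub>m\<close> have the same HOL type.\<close>

type_synonym letter = "nat \<times> bool"
type_synonym fword = "letter list"

definition inv_letter :: "letter \<Rightarrow> letter" where
  "inv_letter x = (fst x, \<not> snd x)"

fun reduced_word :: "fword \<Rightarrow> bool" where
  "reduced_word [] \<longleftrightarrow> True"
| "reduced_word [x] \<longleftrightarrow> True"
| "reduced_word (x # y # w) \<longleftrightarrow> y \<noteq> inv_letter x \<and> reduced_word (y # w)"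

fun cancel_Cons :: "letter \<Rightarrow> fword \<Rightarrow> fword" where
  "cancel_Cons x [] = [x]"
| "cancel_Cons x (y # w) = (if y = inv_letter x then w else x # y # w)"

text \<open>For reduced \<open>v\<close>, the value \<open>foldr cancel_Cons u v\<close> is the reduced form of
  the concatenation \<open>u @ v\<close>.\<close>

definition free_group :: "nat \<Rightarrow> fword monoid" where
  "free_group m =
     \<lparr>carrier = {w. reduced_word w \<and> fst ` set w \<subseteq> {..<m}}, mult = foldr cancel_Cons, one = []\<rparr>"

lemma inv_letter_inv_letter [simp]: "inv_letter (inv_letter x) = x"
  by (simp add: inv_letter_def)

lemma fst_inv_letter [simp]: "fst (inv_letter x) = fst x"
  by (simp add: inv_letter_def)

lemma reduced_ConsD: "reduced_word (x # w) \<Longrightarrow> reduced_word w"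
  by (cases w) auto

lemma reduced_cancel_Cons: "reduced_word w \<Longrightarrow> reduced_word (cancel_Cons x w)"
  by (cases w) (auto dest: reduced_ConsD)

lemma reduced_foldr: "reduced_word w \<Longrightarrow> reduced_word (foldr cancel_Cons u w)"
  by (induction u) (auto intro: reduced_cancel_Cons)

lemma set_cancel_Cons: "set (cancel_Cons x w) \<subseteq> insert x (set w)"
  by (cases w) auto

lemma set_foldr_cancel_Cons: "set (foldr cancel_Cons u w) \<subseteq> set u \<union> set w"
  by (induction u) (use set_cancel_Cons in fastforce)+

lemma cancel_Cons_cancel:
  assumes "reduced_word w"
  shows "cancel_Cons x (cancel_Cons (inv_letter x) w) = w"
proof (cases w)
  case (Cons y v)
  then show ?thesis using assms by (cases v) auto
qed simp

lemma cancel_Cons_reduced: "reduced_word (x # w) \<Longrightarrow> cancel_Cons x w = x # w"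
  by (cases w) auto

lemma foldr_cancel_Cons_assoc:
  assumes "reduced_word v" "reduced_word w"
  shows "foldr cancel_Cons (foldr cancel_Cons u v) w = foldr cancel_Cons u (foldr cancel_Cons v w)"
proof (induction u)
  case (Cons x u)
  have *: "foldr cancel_Cons (cancel_Cons x z) w = cancel_Cons x (foldr cancel_Cons z w)" for z
  proof (cases z)
    case (Cons y t)
    then show ?thesis
      using cancel_Cons_cancel[OF reduced_foldr[OF assms(2)]] by auto
  qed simp
  show ?case using * Cons by simp
qed simp

lemma foldr_cancel_Cons_Nil: "reduced_word w \<Longrightarrow> foldr cancel_Cons w [] = w"
proof (induction w)
  case (Cons x w)
  then show ?case using reduced_ConsD[of x w] by (simp add: cancel_Cons_reduced)
qed simp

lemma foldr_cancel_inverse: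
  "reduced_word w \<Longrightarrow> foldr cancel_Cons (rev (map inv_letter u)) (foldr cancel_Cons u w) = w"
proof (induction u arbitrary: w)
  case (Cons x u)
  have "cancel_Cons (inv_letter x) (cancel_Cons x (foldr cancel_Cons u w)) = foldr cancel_Cons u w"
    using cancel_Cons_cancel[OF reduced_foldr[OF Cons.prems], of "inv_letter x"] by simp
  then show ?case using Cons by simp
qed simp

lemma group_free_group: "group (free_group m)"
proof (rule groupI)
  fix x y assume "x \<in> carrier (free_group m)" "y \<in> carrier (free_group m)"
  then show "x \<otimes>\<^bsub>free_group m\<^esub> y \<in> carrier (free_group m)"
    using set_foldr_cancel_Cons[of x y] by (fastforce simp: free_group_def reduced_foldr)
next
  fix x assume x: "x \<in> carrier (free_group m)"
  define y where "y = foldr cancel_Cons (rev (map inv_letter x)) []"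
  have "set y \<subseteq> inv_letter ` set x"
    using set_foldr_cancel_Cons[of "rev (map inv_letter x)" "[]"] by (simp add: y_def)
  then have y: "y \<in> carrier (free_group m)"
    using x by (fastforce simp: free_group_def y_def reduced_foldr)
  have "foldr cancel_Cons y x = foldr cancel_Cons (rev (map inv_letter x)) (foldr cancel_Cons [] x)"
    unfolding y_def by (rule foldr_cancel_Cons_assoc) (use x in \<open>auto simp: free_group_def\<close>)
  also have "\<dots> = []"
    using foldr_cancel_inverse[of "[]" x] x by (simp add: free_group_def foldr_cancel_Cons_Nil)
  finally show "\<exists>y\<in>carrier (free_group m). y \<otimes>\<^bsub>free_group m\<^esub> x = \<one>\<^bsub>free_group m\<^esub>"
    using y by (auto simp: free_group_def)
qed (auto simp: free_group_def foldr_cancel_Cons_assoc)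

text \<open>The universal property of \<open>free_group m\<close> on the basis \<open>[(i, True)]\<close>, \<open>i < m\<close>.\<close>

lemma free_group_universal:
  assumes "group G" "\<And>i. i < m \<Longrightarrow> a i \<in> carrier G"
  shows "\<exists>h \<in> hom (free_group m) G. (\<forall>i<m. h [(i, True)] = a i) \<and>
    (\<forall>h' \<in> hom (free_group m) G. (\<forall>i<m. h' [(i, True)] = a i) \<longrightarrow>
       (\<forall>w \<in> carrier (free_group m). h' w = h w))"
proof -
  interpret G: group G by fact
  define l where "l x = (if snd x then a (fst x) else inv\<^bsub>G\<^esub> a (fst x))" for x :: letter
  define h where "h w = foldr (\<lambda>x g. l x \<otimes>\<^bsub>G\<^esub> g) w \<one>\<^bsub>G\<^esub>" for w
  have l [simp]: "l x \<in> carrier G" if "fst x < m" for x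
    using that assms(2) by (simp add: l_def)
  have hc [simp]: "h w \<in> carrier G" if "fst ` set w \<subseteq> {..<m}" for w
    using that by (induction w) (auto simp: h_def)
  have l_inv: "l x \<otimes>\<^bsub>G\<^esub> l (inv_letter x) = \<one>\<^bsub>G\<^esub>" if "fst x < m" for x
    using that assms(2) by (simp add: l_def inv_letter_def)
  have h_cancel: "h (cancel_Cons x w) = l x \<otimes>\<^bsub>G\<^esub> h w" if "fst x < m" "fst ` set w \<subseteq> {..<m}" for x w
  proof (cases w)
    case (Cons y v)
    have "l x \<otimes>\<^bsub>G\<^esub> (l (inv_letter x) \<otimes>\<^bsub>G\<^esub> h v) = h v"
      using that Cons l_inv[of x] by (simp flip: G.m_assoc)
    then show ?thesis using Cons by (auto simp: h_def)
  qed (simp add: h_def)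
  have h_mult: "h (foldr cancel_Cons u v) = h u \<otimes>\<^bsub>G\<^esub> h v"
    if "fst ` set u \<subseteq> {..<m}" "fst ` set v \<subseteq> {..<m}" for u v
    using that
  proof (induction u)
    case Nil
    then show ?case by (simp add: h_def[of "[]"])
  next
    case (Cons x u)
    have "fst ` set (foldr cancel_Cons u v) \<subseteq> {..<m}"
      using Cons.prems set_foldr_cancel_Cons[of u v] by fastforce
    then have "h (foldr cancel_Cons (x # u) v) = l x \<otimes>\<^bsub>G\<^esub> (h u \<otimes>\<^bsub>G\<^esub> h v)"
      using Cons by (simp add: h_cancel)
    moreover have "h (x # u) = l x \<otimes>\<^bsub>G\<^esub> h u" by (simp add: h_def)
    ultimately show ?case using Cons.prems by (simp add: G.m_assoc)
  qed
  have h: "h \<in> hom (free_group m) G"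
    by (auto simp: hom_def free_group_def h_mult)
  moreover have "\<forall>i<m. h [(i, True)] = a i"
    using assms(2) by (simp add: h_def l_def)
  moreover have "h' w = h w"
    if h': "h' \<in> hom (free_group m) G" and eq: "\<forall>i<m. h' [(i, True)] = a i"
      and w: "w \<in> carrier (free_group m)" for h' w
  proof -
    interpret h': group_hom "free_group m" G h'
      by (intro group_hom.intro group_hom_axioms.intro group_free_group assms h')
    have hl: "h' [x] = l x" if "fst x < m" for x
    proof (cases "snd x")
      case True
      then show ?thesis using that eq by (cases x) (simp add: l_def)
    next
      case False
      then obtain i where x: "x = (i, False)" by (cases x) auto
      have im: "i < m" using that x by simp
      have c: "[(i, b)] \<in> carrier (free_group m)" for b
        using im by (simp add: free_group_def)
      have "[(i, False)] \<otimes>\<^bsub>free_group m\<^esub> [(i, True)] = \<one>\<^bsub>free_group m\<^esub>"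
        by (simp add: free_group_def inv_letter_def)
      then have "h' [(i, False)] \<otimes>\<^bsub>G\<^esub> h' [(i, True)] = \<one>\<^bsub>G\<^esub>"
        using h'.hom_mult[OF c c, of False True] h'.hom_one by simp
      then have "inv\<^bsub>G\<^esub> h' [(i, True)] = h' [(i, False)]"
        by (intro G.inv_equality h'.hom_closed c)
      then show ?thesis using x eq im by (simp add: l_def)
    qed
    show ?thesis using w
    proof (induction w)
      case Nil
      then show ?case using h'.hom_one by (simp add: free_group_def h_def)
    next
      case (Cons x w)
      have c: "[x] \<in> carrier (free_group m)" "w \<in> carrier (free_group m)"
        using Cons.prems by (auto simp: free_group_def dest: reduced_ConsD)
      have "x # w = [x] \<otimes>\<^bsub>free_group m\<^esub> w"
        using Cons.prems by (simp add: free_group_def cancel_Cons_reduced)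
      then have "h' (x # w) = h' [x] \<otimes>\<^bsub>G\<^esub> h' w"
        using h'.hom_mult[OF c] by simp
      then show ?case
        using Cons c hl[of x] by (simp add: h_def free_group_def)
    qed
  qed
  ultimately show ?thesis by blast
qed

section \<open>The space of marked groups\<close>

definition marked_groups :: "nat \<Rightarrow> fword set topology" where
  "marked_groups m =
     pullback_topology {N. N \<lhd> free_group m}
       (\<lambda>N. \<lambda>w\<in>carrier (free_group m). w \<in> N)
       (product_topology (\<lambda>w. discrete_topology (UNIV :: bool set)) (carrier (free_group m)))"

lemma topspace_marked_groups [simp]: "topspace (marked_groups m) = {N. N \<lhd> free_group m}"
  by (auto simp: marked_groups_def topspace_pullback_topology)

definition dense_class :: "(fword set monoid \<Rightarrow> bool) \<Rightarrow> bool" where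
  "dense_class C \<longleftrightarrow>
     (\<forall>m\<ge>1. marked_groups m closure_of {N. N \<lhd> free_group m \<and> C (free_group m Mod N)}
              = topspace (marked_groups m))"

definition finitely_generated_group :: "('a, 'b) monoid_scheme \<Rightarrow> bool" where
  "finitely_generated_group G \<longleftrightarrow>
     group G \<and> (\<exists>S. finite S \<and> S \<subseteq> carrier G \<and> generate G S = carrier G)"

definition isolated_group :: "('a, 'b) monoid_scheme \<Rightarrow> bool" where
  "isolated_group G \<longleftrightarrow> finitely_generated_group G \<and>
     (\<exists>m N. N \<lhd> free_group m \<and> free_group m Mod N \<cong> G \<and> openin (marked_groups m) {N})"

section \<open>Recursive sets and the word problem\<close>

text \<open>Partial recursive functions. In \<open>Prec\<close> the recursion argument comes first and the step
  function receives the counter, the previous value and the parameters; \<open>Mn f\<close> searches for the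
  least zero of \<open>f\<close> in its first argument.\<close>

datatype recf = Zero | Succ | Proj nat | Comp recf "recf list" | Prec recf recf | Mn recf

inductive computes :: "recf \<Rightarrow> nat list \<Rightarrow> nat \<Rightarrow> bool" where
  Zero: "computes Zero xs 0"
| Succ: "computes Succ [x] (Suc x)"
| Proj: "i < length xs \<Longrightarrow> computes (Proj i) xs (xs ! i)"
| Comp: "list_all2 (\<lambda>g y. computes g xs y) gs ys \<Longrightarrow> computes f ys z \<Longrightarrow> computes (Comp f gs) xs z"
| Prec_0: "computes f xs y \<Longrightarrow> computes (Prec f g) (0 # xs) y"
| Prec_Suc: "computes (Prec f g) (n # xs) y \<Longrightarrow> computes g (n # y # xs) z \<Longrightarrow>
    computes (Prec f g) (Suc n # xs) z"
| Mn: "computes f (n # xs) 0 \<Longrightarrow> (\<And>i. i < n \<Longrightarrow> \<exists>y. computes f (i # xs) (Suc y)) \<Longrightarrow>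
    computes (Mn f) xs n"

definition recursive_set :: "nat set \<Rightarrow> bool" where
  "recursive_set A \<longleftrightarrow> (\<exists>f. \<forall>n. computes f [n] (if n \<in> A then 1 else 0))"

inductive_cases computes_ZeroE: "computes Zero xs y"
inductive_cases computes_SuccE: "computes Succ xs y"
inductive_cases computes_ProjE: "computes (Proj i) xs y"
inductive_cases computes_CompE: "computes (Comp f gs) xs y"
inductive_cases computes_Prec_0E: "computes (Prec f g) (0 # xs) y"
inductive_cases computes_Prec_SucE: "computes (Prec f g) (Suc n # xs) y"
inductive_cases computes_MnE: "computes (Mn f) xs y"

lemma computes_functional: "computes f xs y \<Longrightarrow> computes f xs z \<Longrightarrow> y = z"
proof (induction arbitrary: z rule: computes.induct)
  case (Comp xs gs ys f z z')
  from Comp.prems obtain ys' where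
    ys': "list_all2 (\<lambda>g y. computes g xs y) gs ys'" "computes f ys' z'"
    by (rule computes_CompE)
  have "ys = ys'"
    by (rule nth_equalityI) (use Comp.IH(1) ys'(1) in \<open>auto simp: list_all2_conv_all_nth\<close>)
  then show ?case using Comp.IH ys' by blast
next
  case (Mn f n xs)
  from Mn.prems have z: "computes f (z # xs) 0" "\<And>i. i < z \<Longrightarrow> \<exists>y. computes f (i # xs) (Suc y)"
    by (blast elim: computes_MnE)+
  have "\<not> n < z" using z(2)[of n] Mn.IH(1) by fastforce
  moreover have "\<not> z < n" using z(1) Mn.IH(2)[of z] by fastforce
  ultimately show ?case by simp
next
  case (Prec_Suc f g n xs y z z')
  from Prec_Suc.prems obtain y' where "computes (Prec f g) (n # xs) y'" "computes g (n # y' # xs) z'"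
    by (rule computes_Prec_SucE)
  then show ?case using Prec_Suc.IH by blast
qed (blast elim: computes_ZeroE computes_SuccE computes_ProjE computes_Prec_0E)+

definition encode_letter :: "letter \<Rightarrow> nat" where
  "encode_letter x = 2 * fst x + of_bool (snd x)"

definition encode_fword :: "fword \<Rightarrow> nat" where
  "encode_fword w = list_encode (map encode_letter w)"

lemma inj_encode_fword: "inj encode_fword"
proof -
  have "inj encode_letter"
  proof (rule injI)
    fix x y assume "encode_letter x = encode_letter y"
    then show "x = y"
      unfolding encode_letter_def by (cases x; cases y; cases "snd x"; cases "snd y"; simp; presburger)
  qed
  then have "inj (list_encode \<circ> map encode_letter)"
    by (intro inj_compose inj_list_encode inj_mapI)
  then show ?thesis by (simp add: encode_fword_def[abs_def] comp_def)
qed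

definition solvable_word_problem :: "('a, 'b) monoid_scheme \<Rightarrow> bool" where
  "solvable_word_problem G \<longleftrightarrow> finitely_generated_group G \<and>
     (\<exists>m N. N \<lhd> free_group m \<and> free_group m Mod N \<cong> G \<and> recursive_set (encode_fword ` N))"

end

theory Submission
  imports Defs "HOL-Library.Equipollence"
begin

text \<open>Finitely many equations and one inequation in finitely many unknowns define an open set of
  marked groups. We write down such a system that has a solution in some group, but none in a group
  in which a certain sequence of words can be decided.

  Binary trees are encoded as elements of a group \<open>\<Gamma>\<close> that contains \<open>\<Gamma> \<times> \<Gamma>\<close>, like Thompson's
  groups: a node is \<open>\<iota>\<^sub>0 x * \<iota>\<^sub>1 y * A\<close>. Hence the instances of a pattern fill a coset of a
  subgroup that is the image of a power of \<open>\<Gamma>\<close>. Given unknowns \<open>t\<close> and \<open>k\<close>, let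
  \<open>token c = c * t * inv c\<close>. For each rule \<open>l \<rightarrow> r\<close> of a universal rewriting system there is an
  unknown that commutes with \<open>k\<close> and conjugates \<open>token (l\<sigma>)\<close> to \<open>token (r\<sigma>)\<close> for all \<open>\<sigma>\<close> at once;
  as \<open>\<Gamma>\<close> is finitely generated, this takes finitely many equations. So whether \<open>k\<close> commutes with
  \<open>token c\<close> does not change along a run. We demand that it does for the accepting and does not for
  the rejecting configuration. A program deciding this question for all initial configurations is
  refuted by the run on its own index, which ends in the configuration opposite to its answer.

  A solution of the system consists of permutations: \<open>k\<close> moves only points over configurations that do
  not lead to acceptance, and the rules, which are isomorphisms between partial actions of \<open>\<Gamma>\<close>, extend
  to permutations as in the embedding of a group into an HNN extension.

  If \<open>N\<close> is isolated by finitely many relators and nonrelators, then \<open>u \<in> N\<close> is witnessed by a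
  derivation of \<open>u\<close> from the relators, and \<open>u \<notin> N\<close> by a derivation of a nonrelator from the
  relators and \<open>u\<close>. A search for both kinds of witnesses decides membership.\<close>

section \<open>Systems of equations and open sets of marked groups\<close>

text \<open>The obstacle is that finitely many words cannot prescribe which tokens of nonhalting
  runs commute with \<open>k\<close>; the answer may differ from one solution to another, so
  undecidability of halting alone would prove nothing. But in every solution the commuting indices
  contain those of accepting runs and avoid those of rejecting runs, and these two sets are
  recursively inseparable. Hence one equation for \<open>accept\<close> and one inequation for
  \<open>reject\<close>. In an arbitrary solution distinct trees may have equal values. There only
  invariance along runs is used; faithfulness of the coding and determinism of the rules serve the
  existence of a solution. The embeddings of the two factors are realized as conjugations by further
  unknowns \<open>X\<close> and \<open>Y\<close>: then they are multiplicative in every solution,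
  and finitely many relations between generators control them. One system serves both classes of
  groups because the diagonal argument asks for decisions only along sequences of words that a
  program can follow, in any one presentation of the quotient.\<close>

datatype gexp = Gen nat | One | Mul gexp gexp | Inv gexp

primrec gens :: "gexp \<Rightarrow> nat set" where
  "gens (Gen i) = {i}"
| "gens One = {}"
| "gens (Mul u v) = gens u \<union> gens v"
| "gens (Inv u) = gens u"

primrec geval :: "('a, 'b) monoid_scheme \<Rightarrow> (nat \<Rightarrow> 'a) \<Rightarrow> gexp \<Rightarrow> 'a" where
  "geval G a (Gen i) = a i"
| "geval G a One = \<one>\<^bsub>G\<^esub>"
| "geval G a (Mul u v) = geval G a u \<otimes>\<^bsub>G\<^esub> geval G a v"
| "geval G a (Inv u) = inv\<^bsub>G\<^esub> geval G a u"

lemma (in group) geval_closed: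
  "(\<And>i. i \<in> gens e \<Longrightarrow> a i \<in> carrier G) \<Longrightarrow> geval G a e \<in> carrier G"
  by (induction e) auto

lemma (in group_hom) geval_hom:
  "(\<And>i. i \<in> gens e \<Longrightarrow> a i \<in> carrier G) \<Longrightarrow> h (geval G a e) = geval H (\<lambda>i. h (a i)) e"
  by (induction e) (auto simp: G.geval_closed)

lemma (in group) eq_iff_mult_inv:
  "x \<in> carrier G \<Longrightarrow> y \<in> carrier G \<Longrightarrow> x \<otimes> inv y = \<one> \<longleftrightarrow> x = y"
  using inv_equality by fastforce

definition fgen :: "nat \<Rightarrow> fword" where "fgen i = [(i, True)]"

lemma fgen_closed [simp]: "i < m \<Longrightarrow> fgen i \<in> carrier (free_group m)"
  by (simp add: fgen_def free_group_def)

lemma rcos_eq_iff: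
  assumes "N \<lhd> G" "x \<in> carrier G" "y \<in> carrier G"
  shows "N #>\<^bsub>G\<^esub> x = N #>\<^bsub>G\<^esub> y \<longleftrightarrow> x \<otimes>\<^bsub>G\<^esub> inv\<^bsub>G\<^esub> y \<in> N"
proof -
  interpret normal N G by fact
  show ?thesis
    by (metis assms(2,3) is_group is_subgroup rcos_module rcos_self repr_independence)
qed

lemma normal_group_hom: "N \<lhd> G \<Longrightarrow> group_hom G (G Mod N) (\<lambda>x. N #>\<^bsub>G\<^esub> x)"
  by (simp add: group_hom_def group_hom_axioms_def normal.factorgroup_is_group normal.r_coset_hom_Mod
      normal_def)

lemma openin_marked_groups_mem:
  assumes "w \<in> carrier (free_group m)"
  shows "openin (marked_groups m) {N. N \<lhd> free_group m \<and> (w \<in> N \<longleftrightarrow> b)}"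
proof -
  let ?P = "product_topology (\<lambda>w. discrete_topology (UNIV :: bool set)) (carrier (free_group m))"
  have "openin ?P {f \<in> topspace ?P. f w \<in> {b}}"
    by (rule openin_continuous_map_preimage[OF continuous_map_product_projection])
      (use assms in auto)
  moreover have "{N. N \<lhd> free_group m \<and> (w \<in> N \<longleftrightarrow> b)}
      = (\<lambda>N. \<lambda>w\<in>carrier (free_group m). w \<in> N) -` {f \<in> topspace ?P. f w \<in> {b}} \<inter> {N. N \<lhd> free_group m}"
    using assms by auto
  ultimately show ?thesis
    unfolding marked_groups_def openin_pullback_topology by blast
qed

text \<open>A basic open set of the product restricts finitely many coordinates; \<open>Z\<close>
  collects these.\<close>

lemma openin_marked_groupsD:
  assumes "openin (marked_groups m) U" "N \<in> U"
  shows "\<exists>Z. finite Z \<and> Z \<subseteq> carrier (free_group m) \<and>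
    (\<forall>N'. N' \<lhd> free_group m \<longrightarrow> N' \<inter> Z = N \<inter> Z \<longrightarrow> N' \<in> U)"
proof -
  let ?F = "carrier (free_group m)"
  let ?P = "product_topology (\<lambda>w. discrete_topology (UNIV :: bool set)) ?F"
  let ?f = "\<lambda>N. \<lambda>w\<in>?F. w \<in> N"
  obtain W where W: "openin ?P W" "U = ?f -` W \<inter> {N. N \<lhd> free_group m}"
    using assms(1) by (auto simp: marked_groups_def openin_pullback_topology)
  then obtain X where X: "finite {i \<in> ?F. X i \<noteq> (UNIV :: bool set)}" "?f N \<in> Pi\<^sub>E ?F X" "Pi\<^sub>E ?F X \<subseteq> W"
    using assms(2) unfolding openin_product_topology_alt by auto
  let ?Z = "{i \<in> ?F. X i \<noteq> UNIV}"
  have "N' \<in> U" if "N' \<lhd> free_group m" "N' \<inter> ?Z = N \<inter> ?Z" for N'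
  proof -
    have "?f N' w \<in> X w" if w: "w \<in> ?F" for w
    proof (cases "w \<in> ?Z")
      case True
      then have "w \<in> N' \<longleftrightarrow> w \<in> N" using \<open>N' \<inter> ?Z = N \<inter> ?Z\<close> by blast
      then show ?thesis using X(2) w by (auto simp: PiE_iff)
    qed (use w in auto)
    then have "?f N' \<in> Pi\<^sub>E ?F X" by (auto simp: PiE_iff)
    then have "?f N' \<in> W" using X(3) by blast
    then show ?thesis using W(2) that(1) by simp
  qed
  then show ?thesis using X(1) by (intro exI[of _ ?Z]) auto
qed

definition holds :: "('a, 'b) monoid_scheme \<Rightarrow> (nat \<Rightarrow> 'a) \<Rightarrow> gexp \<times> gexp \<Rightarrow> bool" where
  "holds G a e \<longleftrightarrow> geval G a (fst e) = geval G a (snd e)"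

text \<open>The solution in \<open>G\<close> enters only through the kernel of the evaluation map, a
  point of the open set cut out by the system. Hence \<open>G\<close> may be as large and as
  undecidable as convenient. Density would put a member of \<open>C\<close> into that open set, and
  there the cosets of the basis solve the system.\<close>

lemma not_dense_class_if_system:
  fixes G :: "('a, 'b) monoid_scheme"
  assumes fin: "finite E" and E: "\<And>e. e \<in> insert d E \<Longrightarrow> gens (fst e) \<union> gens (snd e) \<subseteq> {..<m}"
    and m: "1 \<le> m"
    and G: "group G" "\<And>i. i < m \<Longrightarrow> a i \<in> carrier G" "\<And>e. e \<in> E \<Longrightarrow> holds G a e" "\<not> holds G a d"
    and C: "\<And>N. N \<lhd> free_group m \<Longrightarrow>
       (\<And>e. e \<in> E \<Longrightarrow> holds (free_group m Mod N) (\<lambda>i. N #>\<^bsub>free_group m\<^esub> fgen i) e) \<Longrightarrow>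
       \<not> holds (free_group m Mod N) (\<lambda>i. N #>\<^bsub>free_group m\<^esub> fgen i) d \<Longrightarrow> \<not> C (free_group m Mod N)"
  shows "\<not> dense_class C"
proof
  assume dense: "dense_class C"
  let ?F = "free_group m"
  define w where "w e = geval ?F fgen (fst e) \<otimes>\<^bsub>?F\<^esub> inv\<^bsub>?F\<^esub> geval ?F fgen (snd e)" for e
  interpret F: group ?F by (rule group_free_group)
  have ev: "geval ?F fgen (fst e) \<in> carrier ?F" "geval ?F fgen (snd e) \<in> carrier ?F"
    if "e \<in> insert d E" for e
    using E[OF that] by (auto intro!: F.geval_closed)
  have w: "w e \<in> carrier ?F" if "e \<in> insert d E" for e
    using ev[OF that] by (simp add: w_def)
  obtain h where h: "h \<in> hom ?F G" "\<And>i. i < m \<Longrightarrow> h [(i, True)] = a i"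
    using free_group_universal[of G m a] G by blast
  interpret h: group_hom ?F G h
    by (intro group_hom.intro group_hom_axioms.intro F.is_group G h)
  have gh: "h (geval ?F fgen e) = geval G a e" if "gens e \<subseteq> {..<m}" for e
  proof -
    have "h (geval ?F fgen e) = geval G (\<lambda>i. h (fgen i)) e"
      using that by (intro h.geval_hom) auto
    also have "\<dots> = geval G a e"
      using that by (induction e) (auto simp: fgen_def h)
    finally show ?thesis .
  qed
  have hw: "h (w e) = \<one>\<^bsub>G\<^esub> \<longleftrightarrow> holds G a e" if "e \<in> insert d E" for e
  proof -
    have "h (w e) = geval G a (fst e) \<otimes>\<^bsub>G\<^esub> inv\<^bsub>G\<^esub> geval G a (snd e)"
      using ev[OF that] E[OF that] by (simp add: w_def gh)
    moreover have "geval G a (fst e) \<in> carrier G" "geval G a (snd e) \<in> carrier G"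
      using E[OF that] G by (auto intro!: h.H.geval_closed)
    ultimately show ?thesis by (simp add: h.H.eq_iff_mult_inv holds_def)
  qed
  define N0 where "N0 = kernel ?F G h"
  have N0: "N0 \<lhd> ?F" unfolding N0_def by (rule h.normal_kernel)
  have N0w: "w e \<in> N0 \<longleftrightarrow> holds G a e" if "e \<in> insert d E" for e
    using hw[OF that] w[OF that] by (auto simp: N0_def kernel_def)
  define U where "U = {N. N \<lhd> ?F \<and> (\<forall>e\<in>E. w e \<in> N) \<and> w d \<notin> N}"
  have "U = topspace (marked_groups m) \<inter> (\<Inter>e\<in>E. {N. N \<lhd> ?F \<and> (w e \<in> N \<longleftrightarrow> True)})
      \<inter> {N. N \<lhd> ?F \<and> (w d \<in> N \<longleftrightarrow> False)}"
    by (auto simp: U_def)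
  also have "openin (marked_groups m) \<dots>"
  proof (rule openin_Int)
    show "openin (marked_groups m) (topspace (marked_groups m) \<inter> (\<Inter>e\<in>E. {N. N \<lhd> ?F \<and> (w e \<in> N \<longleftrightarrow> True)}))"
    proof (cases "E = {}")
      case False
      have "openin (marked_groups m) {N. N \<lhd> ?F \<and> (w e \<in> N \<longleftrightarrow> True)}" if "e \<in> E" for e
        using w that by (intro openin_marked_groups_mem) auto
      then show ?thesis
        using fin False by (intro openin_Int openin_topspace openin_Inter) auto
    qed (use openin_topspace[of "marked_groups m"] in simp)
  qed (intro openin_marked_groups_mem w insertI1)
  finally have U: "openin (marked_groups m) U" .
  have "N0 \<in> U" using N0 N0w G by (auto simp: U_def)
  moreover have "N0 \<in> marked_groups m closure_of {N. N \<lhd> ?F \<and> C (?F Mod N)}"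
    using dense m N0 by (auto simp: dense_class_def)
  ultimately obtain N where N: "N \<in> U" "C (?F Mod N)"
    using U by (auto simp: in_closure_of)
  then have Nn: "N \<lhd> ?F" by (simp add: U_def)
  interpret q: group_hom ?F "?F Mod N" "\<lambda>x. N #>\<^bsub>?F\<^esub> x" by (rule normal_group_hom[OF Nn])
  have "holds (?F Mod N) (\<lambda>i. N #>\<^bsub>?F\<^esub> fgen i) e \<longleftrightarrow> w e \<in> N" if e: "e \<in> insert d E" for e
  proof -
    have "geval (?F Mod N) (\<lambda>i. N #>\<^bsub>?F\<^esub> fgen i) u = N #>\<^bsub>?F\<^esub> geval ?F fgen u" if "gens u \<subseteq> {..<m}" for u
      using that by (subst q.geval_hom) auto
    then show ?thesis
      using E[OF e] ev[OF e] by (simp add: holds_def w_def rcos_eq_iff[OF Nn])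
  qed
  then show False using C[OF Nn] N by (auto simp: U_def)
qed

section \<open>A rewriting system that evaluates recursive functions\<close>

datatype tm = V nat | Lf | Nd tm tm

primrec subst :: "(nat \<Rightarrow> tm) \<Rightarrow> tm \<Rightarrow> tm" where
  "subst s (V i) = s i"
| "subst s Lf = Lf"
| "subst s (Nd a b) = Nd (subst s a) (subst s b)"

primrec vars :: "tm \<Rightarrow> nat set" where
  "vars (V i) = {i}"
| "vars Lf = {}"
| "vars (Nd a b) = vars a \<union> vars b"

text \<open>A leaf opposite a node at a common position. This excludes a common instance, and by
  \<open>tree_val_clash\<close> also one in which the variables are arbitrary group elements instead
  of trees.\<close>

fun clash :: "tm \<Rightarrow> tm \<Rightarrow> bool" where
  "clash Lf (Nd a b) = True"
| "clash (Nd a b) Lf = True"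
| "clash (Nd a b) (Nd c d) = (clash a c \<or> clash b d)"
| "clash _ _ = False"

primrec num :: "nat \<Rightarrow> tm" where
  "num 0 = Lf"
| "num (Suc n) = Nd (num n) Lf"

primrec lst :: "tm list \<Rightarrow> tm" where
  "lst [] = Lf"
| "lst (x # xs) = Nd x (lst xs)"

primrec code :: "recf \<Rightarrow> tm" where
  "code Zero = Nd (num 0) Lf"
| "code Succ = Nd (num 1) Lf"
| "code (Proj i) = Nd (num 2) (num i)"
| "code (Comp f gs) = Nd (num 3) (Nd (code f) (lst (map code gs)))"
| "code (Prec f g) = Nd (num 4) (Nd (code f) (code g))"
| "code (Mn f) = Nd (num 5) (code f)"

text \<open>Machine states, distinguished by the numeral at the root: evaluate a program, evaluate a list of
  programs, return a value to the continuation \<open>k\<close>, erase the tree \<open>u\<close> and those on the stack \<open>st\<close>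
  before passing to the state \<open>c\<close>, and build a program from the binary digits of \<open>n\<close>, where \<open>q\<close>
  accumulates the quotient of \<open>n\<close> by \<open>2\<close>. No rule drops a variable, which is why trees must be erased
  step by step.\<close>

abbreviation "ev f xs k \<equiv> Nd (num 0) (Nd f (Nd xs k))"
abbreviation "evl gs xs k \<equiv> Nd (num 1) (Nd gs (Nd xs k))"
abbreviation "ret y k \<equiv> Nd (num 2) (Nd y k)"
abbreviation "er u st c \<equiv> Nd (num 3) (Nd u (Nd st c))"
abbreviation "bd n q st i \<equiv> Nd (num 4) (Nd n (Nd q (Nd st i)))"

text \<open>Continuations: apply \<open>f\<close> to the list of values returned, evaluate the remaining programs \<open>gs\<close>, put
  \<open>y\<close> in front of the list returned, make a step of a primitive recursion, test a candidate \<open>n\<close> of a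
  minimization.\<close>

abbreviation "kc f k \<equiv> Nd (num 0) (Nd f k)"
abbreviation "kl gs xs k \<equiv> Nd (num 1) (Nd gs (Nd xs k))"
abbreviation "kr y k \<equiv> Nd (num 2) (Nd y k)"
abbreviation "kp g n xs k \<equiv> Nd (num 3) (Nd g (Nd n (Nd xs k)))"
abbreviation "km f n xs k \<equiv> Nd (num 4) (Nd f (Nd n (Nd xs k)))"

definition rules :: "(tm \<times> tm) list" where
  "rules =
   [(ev (Nd (num 0) Lf) (V 0) (V 1), er (V 0) Lf (ret Lf (V 1))),
    (ev (Nd (num 1) Lf) (Nd (V 0) Lf) (V 1), ret (Nd (V 0) Lf) (V 1)),
    (ev (Nd (num 2) Lf) (Nd (V 0) (V 1)) (V 2), er (V 1) Lf (ret (V 0) (V 2))),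
    (ev (Nd (num 2) (Nd (V 0) Lf)) (Nd (V 1) (V 2)) (V 3),
       er (V 1) Lf (ev (Nd (num 2) (V 0)) (V 2) (V 3))),
    (ev (Nd (num 3) (Nd (V 0) (V 1))) (V 2) (V 3), evl (V 1) (V 2) (kc (V 0) (V 3))),
    (evl Lf (V 0) (V 1), er (V 0) Lf (ret Lf (V 1))),
    (evl (Nd (V 0) (V 1)) (V 2) (V 3), ev (V 0) (V 2) (kl (V 1) (V 2) (V 3))),
    (ret (V 0) (kl (V 1) (V 2) (V 3)), evl (V 1) (V 2) (kr (V 0) (V 3))),
    (ret (V 0) (kr (V 1) (V 2)), ret (Nd (V 1) (V 0)) (V 2)),
    (ret (V 0) (kc (V 1) (V 2)), ev (V 1) (V 0) (V 2)),
    (ev (Nd (num 4) (Nd (V 0) (V 1))) (Nd Lf (V 2)) (V 3), er (V 1) Lf (ev (V 0) (V 2) (V 3))),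
    (ev (Nd (num 4) (Nd (V 0) (V 1))) (Nd (Nd (V 2) Lf) (V 3)) (V 4),
       ev (Nd (num 4) (Nd (V 0) (V 1))) (Nd (V 2) (V 3)) (kp (V 1) (V 2) (V 3) (V 4))),
    (ret (V 0) (kp (V 1) (V 2) (V 3) (V 4)), ev (V 1) (Nd (V 2) (Nd (V 0) (V 3))) (V 4)),
    (ev (Nd (num 5) (V 0)) (V 1) (V 2), ev (V 0) (Nd Lf (V 1)) (km (V 0) Lf (V 1) (V 2))),
    (ret Lf (km (V 0) (V 1) (V 2) (V 3)), er (Nd (V 0) (V 2)) Lf (ret (V 1) (V 3))),
    (ret (Nd (V 0) Lf) (km (V 1) (V 2) (V 3) (V 4)),
       er (V 0) Lf (ev (V 1) (Nd (Nd (V 2) Lf) (V 3)) (km (V 1) (Nd (V 2) Lf) (V 3) (V 4)))),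
    (er (Nd (V 0) (V 1)) (V 2) (V 3), er (V 0) (Nd (V 1) (V 2)) (V 3)),
    (er Lf (Nd (V 0) (V 1)) (V 2), er (V 0) (V 1) (V 2)),
    (er Lf Lf (V 0), V 0),
    (bd (Nd (Nd (V 0) Lf) Lf) (V 1) (V 2) (V 3), bd (V 0) (Nd (V 1) Lf) (V 2) (V 3)),
    (bd Lf (V 0) (V 1) (V 2), bd (V 0) Lf (Nd Lf (V 1)) (V 2)),
    (bd (Nd Lf Lf) (Nd (V 0) Lf) (Nd (V 1) (Nd (V 2) (V 3))) (V 4),
       bd (Nd (V 0) Lf) Lf (Nd (Nd (V 2) (V 1)) (V 3)) (V 4)),
    (bd (Nd Lf Lf) Lf (Nd (V 0) Lf) (V 1), ev (V 0) (Nd (V 1) Lf) Lf)]"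

text \<open>The answer 0, which claims that the token does not commute, leads to the configuration
  whose token does: the reversal on which the diagonal argument rests. No rule applies to a value
  returned to the empty continuation \<open>Lf\<close>.\<close>

definition accept :: tm where "accept = ret (num 0) Lf"
definition reject :: tm where "reject = ret (num 1) Lf"

text \<open>Thanks to this the substitutions supported on \<open>vars l\<close> embed faithfully
  through either side of a rule. Repeating a variable on the right does no harm, losing one
  would.\<close>

lemma rules_vars: "(l, r) \<in> set rules \<Longrightarrow> vars r = vars l"
  unfolding rules_def by (auto simp: numeral_eq_Suc)

lemma rules_clash:
  "i < length rules \<Longrightarrow> j < length rules \<Longrightarrow> i \<noteq> j \<Longrightarrow> clash (fst (rules ! i)) (fst (rules ! j))"
proof -
  have "\<forall>i \<in> {..<length rules}. \<forall>j \<in> {..<length rules}. i \<noteq> j \<longrightarrow> clash (fst (rules ! i)) (fst (rules ! j))"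
    unfolding rules_def by code_simp
  then show "i < length rules \<Longrightarrow> j < length rules \<Longrightarrow> i \<noteq> j \<Longrightarrow> clash (fst (rules ! i)) (fst (rules ! j))"
    by blast
qed

lemma rules_clash_halt:
  assumes "(l, r) \<in> set rules"
  shows "clash l accept" "clash l reject"
  using assms unfolding rules_def accept_def reject_def by (auto simp: numeral_eq_Suc)

lemma clash_accept_reject: "clash reject accept"
  by (simp add: accept_def reject_def)

text \<open>Rewriting takes place at the root only, since a step has to be a conjugation of the
  token of the whole configuration.\<close>

inductive rew :: "tm \<Rightarrow> tm \<Rightarrow> bool" where
  rew: "(l, r) \<in> set rules \<Longrightarrow> rew (subst s l) (subst s r)"

abbreviation rews :: "tm \<Rightarrow> tm \<Rightarrow> bool" where "rews \<equiv> rew\<^sup>*\<^sup>*"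

lemma subst_num [simp]: "subst s (num n) = num n"
  by (induction n) auto

lemma rewI:
  assumes "subst ((!) xs) (fst (rules ! i)) = a" "subst ((!) xs) (snd (rules ! i)) = b" "i < length rules"
  shows "rews a b"
  using assms rew[of "fst (rules ! i)" "snd (rules ! i)" "(!) xs"] nth_mem[of i rules] by auto

section \<open>Simulation of recursive functions by the rules\<close>

lemma er_step:
  "rews (er (Nd a b) st c) (er a (Nd b st) c)"
  "rews (er Lf (Nd b st) c) (er b st c)"
  "rews (er Lf Lf c) c"
    apply (rule rewI[of "[a, b, st, c]" 16]; simp add: rules_def)
   apply (rule rewI[of "[b, st, c]" 17]; simp add: rules_def)
  apply (rule rewI[of "[c]" 18]; simp add: rules_def)
  done

text \<open>Right subtrees wait on the stack while left ones are consumed. A variable would block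
  the process, hence closed trees.\<close>

lemma erase_one: "vars u = {} \<Longrightarrow> rews (er u st c) (er Lf st c)"
proof (induction u arbitrary: st)
  case (Nd a b)
  have "rews (er (Nd a b) st c) (er a (Nd b st) c)" by (rule er_step)
  also have "rews \<dots> (er Lf (Nd b st) c)" using Nd by simp
  also have "rews \<dots> (er b st c)" by (rule er_step)
  also have "rews \<dots> (er Lf st c)" using Nd by simp
  finally show ?case .
qed auto

lemma erase: "vars u = {} \<Longrightarrow> rews (er u Lf c) c"
  using erase_one[of u Lf c] er_step(3)[of c] by simp

lemma erase_after: "rews a (er u Lf c) \<Longrightarrow> vars u = {} \<Longrightarrow> rews a c"
  using erase by (meson rtranclp_trans)

lemma eval_step:
  "rews (ev (Nd (num 1) Lf) (Nd x Lf) k) (ret (Nd x Lf) k)"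
  "rews (ev (Nd (num 3) (Nd f gs)) xs k) (evl gs xs (kc f k))"
  "rews (evl (Nd g gs) xs k) (ev g xs (kl gs xs k))"
  "rews (ret y (kl gs xs k)) (evl gs xs (kr y k))"
  "rews (ret ys (kr y k)) (ret (Nd y ys) k)"
  "rews (ret ys (kc f k)) (ev f ys k)"
  "rews (ev (Nd (num 4) (Nd f g)) (Nd (Nd n Lf) xs) k) (ev (Nd (num 4) (Nd f g)) (Nd n xs) (kp g n xs k))"
  "rews (ret y (kp g n xs k)) (ev g (Nd n (Nd y xs)) k)"
  "rews (ev (Nd (num 5) f) xs k) (ev f (Nd Lf xs) (km f Lf xs k))"
          apply (rule rewI[of "[x, k]" 1]; simp add: rules_def)
         apply (rule rewI[of "[f, gs, xs, k]" 4]; simp add: rules_def)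
        apply (rule rewI[of "[g, gs, xs, k]" 6]; simp add: rules_def)
       apply (rule rewI[of "[y, gs, xs, k]" 7]; simp add: rules_def)
      apply (rule rewI[of "[ys, y, k]" 8]; simp add: rules_def)
     apply (rule rewI[of "[ys, f, k]" 9]; simp add: rules_def)
    apply (rule rewI[of "[f, g, n, xs, k]" 11]; simp add: rules_def)
   apply (rule rewI[of "[y, g, n, xs, k]" 12]; simp add: rules_def)
  apply (rule rewI[of "[f, xs, k]" 13]; simp add: rules_def)
  done

lemma eval_erase_step:
  "vars xs = {} \<Longrightarrow> rews (ev (Nd (num 0) Lf) xs k) (ret Lf k)"
  "vars xs = {} \<Longrightarrow> rews (ev (Nd (num 2) Lf) (Nd x xs) k) (ret x k)"
  "vars x = {} \<Longrightarrow> rews (ev (Nd (num 2) (Nd i Lf)) (Nd x xs) k) (ev (Nd (num 2) i) xs k)"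
  "vars xs = {} \<Longrightarrow> rews (evl Lf xs k) (ret Lf k)"
  "vars g = {} \<Longrightarrow> rews (ev (Nd (num 4) (Nd f g)) (Nd Lf xs) k) (ev f xs k)"
  "vars (Nd f xs) = {} \<Longrightarrow> rews (ret Lf (km f n xs k)) (ret n k)"
  "vars y = {} \<Longrightarrow> rews (ret (Nd y Lf) (km f n xs k)) (ev f (Nd (Nd n Lf) xs) (km f (Nd n Lf) xs k))"
        apply (erule erase_after[rotated], rule rewI[of "[xs, k]" 0]; simp add: rules_def)
       apply (erule erase_after[rotated], rule rewI[of "[x, xs, k]" 2]; simp add: rules_def)
      apply (erule erase_after[rotated], rule rewI[of "[i, x, xs, k]" 3]; simp add: rules_def)
     apply (erule erase_after[rotated], rule rewI[of "[xs, k]" 5]; simp add: rules_def)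
    apply (erule erase_after[rotated], rule rewI[of "[f, g, xs, k]" 10]; simp add: rules_def)
   apply (erule erase_after[rotated], rule rewI[of "[f, n, xs, k]" 14]; simp add: rules_def)
  apply (erule erase_after[rotated], rule rewI[of "[y, f, n, xs, k]" 15]; simp add: rules_def)
  done

lemma build_step:
  "rews (bd (Nd (Nd n Lf) Lf) q st i) (bd n (Nd q Lf) st i)"
  "rews (bd Lf q st i) (bd q Lf (Nd Lf st) i)"
  "rews (bd (Nd Lf Lf) (Nd q Lf) (Nd a (Nd b st)) i) (bd (Nd q Lf) Lf (Nd (Nd b a) st) i)"
  "rews (bd (Nd Lf Lf) Lf (Nd p Lf) i) (ev p (Nd i Lf) Lf)"
     apply (rule rewI[of "[n, q, st, i]" 19]; simp add: rules_def)
    apply (rule rewI[of "[q, st, i]" 20]; simp add: rules_def)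
   apply (rule rewI[of "[q, a, b, st, i]" 21]; simp add: rules_def)
  apply (rule rewI[of "[p, i]" 22]; simp add: rules_def)
  done

lemma vars_num [simp]: "vars (num n) = {}"
  by (induction n) auto

lemma vars_lst_num [simp]: "vars (lst (map num xs)) = {}"
  by (induction xs) auto

lemma vars_code [simp]: "vars (code f) = {}"
proof (induction f)
  case (Comp f gs)
  then have "vars (lst (map code gs)) = {}" by (induction gs) auto
  with Comp show ?case by simp
qed auto

abbreviation nums :: "nat list \<Rightarrow> tm" where "nums xs \<equiv> lst (map num xs)"

lemma eval_list:
  assumes "list_all2 (\<lambda>g y. \<forall>k. rews (ev (code g) (nums xs) k) (ret (num y) k)) gs ys"
  shows "rews (evl (lst (map code gs)) (nums xs) k) (ret (nums ys) k)"
  using assms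
proof (induction gs ys arbitrary: k rule: list_all2_induct)
  case Nil
  show ?case using eval_erase_step(4)[of "nums xs" k] by simp
next
  case (Cons g gs y ys)
  let ?gs = "lst (map code gs)"
  have "rews (evl (Nd (code g) ?gs) (nums xs) k) (ev (code g) (nums xs) (kl ?gs (nums xs) k))"
    by (rule eval_step)
  also have "rews \<dots> (ret (num y) (kl ?gs (nums xs) k))" using Cons by blast
  also have "rews \<dots> (evl ?gs (nums xs) (kr (num y) k))" by (rule eval_step)
  also have "rews \<dots> (ret (nums ys) (kr (num y) k))" by (rule Cons.IH)
  also have "rews \<dots> (ret (Nd (num y) (nums ys)) k)" by (rule eval_step)
  finally show ?case by simp
qed

lemma eval_proj:
  "i < length xs \<Longrightarrow> rews (ev (Nd (num 2) (num i)) (nums xs) k) (ret (num (xs ! i)) k)"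
proof (induction i arbitrary: xs)
  case 0
  then obtain x ys where xs: "xs = x # ys" by (cases xs) auto
  show ?case using eval_erase_step(2)[of "nums ys" "num x" k] by (simp add: xs)
next
  case (Suc i)
  then obtain x ys where xs: "xs = x # ys" by (cases xs) auto
  have "rews (ev (Nd (num 2) (Nd (num i) Lf)) (Nd (num x) (nums ys)) k) (ev (Nd (num 2) (num i)) (nums ys) k)"
    by (rule eval_erase_step) simp
  also have "rews \<dots> (ret (num (ys ! i)) k)" using Suc xs by simp
  finally show ?case by (simp add: xs)
qed

theorem eval_computes: "computes f xs y \<Longrightarrow> rews (ev (code f) (nums xs) k) (ret (num y) k)"
proof (induction arbitrary: k rule: computes.induct)
  case (Zero xs)
  show ?case using eval_erase_step(1)[of "nums xs" k] by simp
next
  case (Succ x)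
  then show ?case using eval_step(1) by simp
next
  case (Proj i xs)
  then show ?case using eval_proj by simp
next
  case (Comp xs gs ys f z)
  have "rews (ev (code (Comp f gs)) (nums xs) k) (evl (lst (map code gs)) (nums xs) (kc (code f) k))"
    using eval_step(2) by simp
  also have "rews \<dots> (ret (nums ys) (kc (code f) k))"
    by (rule eval_list) (use Comp in \<open>auto elim: list_all2_mono\<close>)
  also have "rews \<dots> (ev (code f) (nums ys) k)" by (rule eval_step)
  also have "rews \<dots> (ret (num z) k)" by (rule Comp.IH)
  finally show ?case .
next
  case (Prec_0 f xs y g)
  have "rews (ev (code (Prec f g)) (nums (0 # xs)) k) (ev (code f) (nums xs) k)"
    using eval_erase_step(5) by simp
  also have "rews \<dots> (ret (num y) k)" by (rule Prec_0.IH)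
  finally show ?case .
next
  case (Prec_Suc f g n xs y z)
  have "rews (ev (code (Prec f g)) (nums (Suc n # xs)) k)
     (ev (code (Prec f g)) (nums (n # xs)) (kp (code g) (num n) (nums xs) k))"
    using eval_step(7) by simp
  also have "rews \<dots> (ret (num y) (kp (code g) (num n) (nums xs) k))" by (rule Prec_Suc.IH)
  also have "rews \<dots> (ev (code g) (nums (n # y # xs)) k)" using eval_step(8) by simp
  also have "rews \<dots> (ret (num z) k)" by (rule Prec_Suc.IH)
  finally show ?case .
next
  case (Mn f n xs)
  let ?s = "\<lambda>i. ev (code f) (nums (i # xs)) (km (code f) (num i) (nums xs) k)"
  \<comment> \<open>\<open>?s i\<close> is the state that tests candidate \<open>i\<close>. Below
    the least zero each test returns a successor, which leads on to the next candidate.\<close>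
  have "rews (ev (code (Mn f)) (nums xs) k) (?s i)" if "i \<le> n" for i
    using that
  proof (induction i)
    case 0
    then show ?case using eval_step(9) by simp
  next
    case (Suc i)
    then obtain y where y: "\<And>k. rews (ev (code f) (nums (i # xs)) k) (ret (num (Suc y)) k)"
      using Mn.IH(2)[of i] by auto
    have "rews (ev (code (Mn f)) (nums xs) k) (?s i)" using Suc by simp
    also have "rews \<dots> (ret (num (Suc y)) (km (code f) (num i) (nums xs) k))" by (rule y)
    also have "rews \<dots> (?s (Suc i))" using eval_erase_step(7)[of "num y"] by simp
    finally show ?case .
  qed
  from this[of n] have "rews (ev (code (Mn f)) (nums xs) k) (?s n)" by simp
  also have "rews \<dots> (ret (num 0) (km (code f) (num n) (nums xs) k))" by (rule Mn.IH(1))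
  also have "rews \<dots> (ret (num n) k)" using eval_erase_step(6) by simp
  finally show ?case .
qed

text \<open>The program number lists, starting from the least significant bit, the instructions of a stack
  machine that builds the tree: \<open>0\<close> pushes a leaf, \<open>1\<close> joins the two topmost trees. The leading
  bit marks the end.\<close>

fun rpn :: "tm \<Rightarrow> bool list" where
  "rpn (Nd a b) = rpn a @ rpn b @ [True]"
| "rpn _ = [False]"

fun bits_num :: "bool list \<Rightarrow> nat" where
  "bits_num [] = 1"
| "bits_num (b # bs) = of_bool b + 2 * bits_num bs"

lemma bits_num_pos: "bits_num bs > 0"
  by (induction bs) auto

lemma halve: "rews (bd (num (m + 2 * n)) (num q) st i) (bd (num m) (num (n + q)) st i)"
proof (induction n arbitrary: q)
  case (Suc n)
  have "rews (bd (num (m + 2 * Suc n)) (num q) st i) (bd (num (m + 2 * n)) (num (Suc q)) st i)"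
    using build_step(1) by simp
  also have "rews \<dots> (bd (num m) (num (n + Suc q)) st i)" by (rule Suc)
  finally show ?case by simp
qed simp

lemma build_rpn:
  "vars t = {} \<Longrightarrow> rews (bd (num (bits_num (rpn t @ bs))) Lf st i) (bd (num (bits_num bs)) Lf (Nd t st) i)"
proof (induction t arbitrary: bs st)
  case Lf
  have "rews (bd (num (bits_num (rpn Lf @ bs))) Lf st i) (bd Lf (num (bits_num bs)) st i)"
    using halve[of 0 "bits_num bs" 0] by simp
  also have "rews \<dots> (bd (num (bits_num bs)) Lf (Nd Lf st) i)" by (rule build_step)
  finally show ?case .
next
  case (Nd a b)
  \<comment> \<open>The quotient left after this instruction is a successor because of the leading
    bit. This distinguishes a join from the end marker, where remainder 1 comes with quotient
    0.\<close>
  obtain q where q: "bits_num bs = Suc q" using bits_num_pos[of bs] gr0_implies_Suc by blast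
  have "rews (bd (num (bits_num (rpn (Nd a b) @ bs))) Lf st i)
     (bd (num (bits_num (rpn b @ True # bs))) Lf (Nd a st) i)"
    using Nd by simp
  also have "rews \<dots> (bd (num (bits_num (True # bs))) Lf (Nd b (Nd a st)) i)"
    using Nd.prems by (intro Nd.IH(2)) simp
  also have "rews \<dots> (bd (num 1) (num (bits_num bs)) (Nd b (Nd a st)) i)"
    using halve[of 1 "bits_num bs" 0] by simp
  also have "rews \<dots> (bd (num (bits_num bs)) Lf (Nd (Nd a b) st) i)"
    using build_step(3)[of "num q"] q by simp
  finally show ?case .
qed simp

text \<open>The index occurs once as the program still to be decoded and once as that program's
  input.\<close>

definition start :: "nat \<Rightarrow> tm" where "start n = bd (num n) Lf Lf (num n)"

theorem universal: "\<exists>n. \<forall>y. computes f [n] y \<longrightarrow> rews (start n) (ret (num y) Lf)"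
proof (intro exI allI impI)
  fix y
  let ?n = "bits_num (rpn (code f))"
  assume y: "computes f [?n] y"
  have "rews (start ?n) (bd (num 1) Lf (Nd (code f) Lf) (num ?n))"
    using build_rpn[of "code f" "[]"] by (simp add: start_def)
  also have "rews \<dots> (ev (code f) (nums [?n]) Lf)" using build_step(4) by simp
  also have "rews \<dots> (ret (num y) Lf)" by (rule eval_computes[OF y])
  finally show "rews (start ?n) (ret (num y) Lf)" .
qed

section \<open>Extending partial isomorphisms\<close>

definition act :: "('g, 'b) monoid_scheme \<Rightarrow> 'g \<Rightarrow> 'g \<times> 'e \<Rightarrow> 'g \<times> 'e" where
  "act G g x = (g \<otimes>\<^bsub>G\<^esub> fst x, snd x)"

text \<open>Bounds the number of orbits of any one colouring from above; that a power set absorbs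
  its square is where infinity of the group enters.\<close>

lemma set_times_set_eqpoll:
  assumes "infinite (UNIV :: 'g set)"
  shows "(UNIV :: ('g \<times> ('g set \<times> 'g set)) set) \<lesssim> (UNIV :: 'g set set)"
proof -
  have sq: "(UNIV :: 'g set set) \<times> (UNIV :: 'g set set) \<approx> (UNIV :: 'g set set)"
    using assms card_of_Times_same_infinite[of "UNIV :: 'g set set"]
    by (simp add: eqpoll_iff_card_of_ordIso Finite_Set.finite_set)
  have "(UNIV :: 'g set) \<lesssim> (UNIV :: 'g set set)"
    using lepoll_Pow_self[of "UNIV :: 'g set"] by simp
  then have "(UNIV :: 'g set) \<times> ((UNIV :: 'g set set) \<times> (UNIV :: 'g set set))
      \<lesssim> (UNIV :: 'g set set) \<times> (UNIV :: 'g set set)"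
    by (rule times_lepoll_mono[OF _ eqpoll_imp_lepoll[OF sq]])
  then have "(UNIV :: 'g set) \<times> ((UNIV :: 'g set set) \<times> (UNIV :: 'g set set)) \<lesssim> (UNIV :: 'g set set)"
    using sq by (rule lepoll_trans2)
  then show ?thesis by simp
qed

text \<open>The group acts on the first component of \<open>'g \<times> 'g set \<times> 'g set\<close>, and \<open>(g, T, n)\<close> is coloured by
  whether \<open>g \<in> T\<close>. Every colouring \<open>U\<close> occurs on equally many orbits, whatever the embedding \<open>\<alpha>\<close>: the
  choice of \<open>T\<close> realizes \<open>U\<close>, and the index \<open>n\<close> supplies enough copies.\<close>

lemma orbit_section:
  fixes G :: "'g monoid" and K :: "'k monoid" and e0 :: "'g set \<times> 'g set"
  assumes G: "group G" "carrier G = UNIV" and inf: "infinite (UNIV :: 'g set)"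
    and K: "group K" and hom: "\<alpha> \<in> hom K G" and inj: "inj_on \<alpha> (carrier K)"
  shows "\<exists>I. (a, e0) \<in> I \<and> bij_betw (\<lambda>(k, x). act G (\<alpha> k) x) (carrier K \<times> I) UNIV \<and>
     (\<forall>U \<subseteq> carrier K. {x \<in> I. {k \<in> carrier K. \<alpha> k \<otimes>\<^bsub>G\<^esub> fst x \<in> fst (snd x)} = U} \<approx> (UNIV :: 'g set set))"
proof -
  interpret group_hom K G \<alpha> by (intro group_hom.intro group_hom_axioms.intro assms)
  define orb where "orb g = (\<lambda>k. \<alpha> k \<otimes>\<^bsub>G\<^esub> g) ` carrier K" for g
  \<comment> \<open>The orbit of \<open>a\<close> is represented by \<open>a\<close> itself, so that
    the prescribed point lies in the section.\<close>
  define rep where "rep g = (if a \<in> orb g then a else SOME y. y \<in> orb g)" for g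
  \<comment> \<open>Only the first component is restricted, so all choices of set and index occur
    over each representative.\<close>
  define I where "I = {x :: 'g \<times> ('g set \<times> 'g set). rep (fst x) = fst x}"
  have [simp]: "x \<in> carrier G" for x using G by simp
  have orb_self: "g \<in> orb g" for g
    unfolding orb_def by (rule image_eqI[of _ _ "\<one>\<^bsub>K\<^esub>"]) auto
  have rep_orb: "rep g \<in> orb g" for g
    using orb_self[of g] unfolding rep_def by (auto intro: someI)
  have orb_sub: "orb (\<alpha> k \<otimes>\<^bsub>G\<^esub> g) \<subseteq> orb g" if "k \<in> carrier K" for k g
  proof
    fix y assume "y \<in> orb (\<alpha> k \<otimes>\<^bsub>G\<^esub> g)"
    then obtain l where l: "l \<in> carrier K" "y = \<alpha> l \<otimes>\<^bsub>G\<^esub> (\<alpha> k \<otimes>\<^bsub>G\<^esub> g)" by (auto simp: orb_def)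
    then have "y = \<alpha> (l \<otimes>\<^bsub>K\<^esub> k) \<otimes>\<^bsub>G\<^esub> g" using that by (simp add: H.m_assoc)
    then show "y \<in> orb g" unfolding orb_def using that l(1) by (intro image_eqI[of _ _ "l \<otimes>\<^bsub>K\<^esub> k"]) auto
  qed
  have orb_eq: "orb (\<alpha> k \<otimes>\<^bsub>G\<^esub> g) = orb g" if k: "k \<in> carrier K" for k g
  proof
    have "\<alpha> (inv\<^bsub>K\<^esub> k) \<otimes>\<^bsub>G\<^esub> (\<alpha> k \<otimes>\<^bsub>G\<^esub> g) = g"
      using k by (simp flip: H.m_assoc)
    then show "orb g \<subseteq> orb (\<alpha> k \<otimes>\<^bsub>G\<^esub> g)"
      using orb_sub[of "inv\<^bsub>K\<^esub> k" "\<alpha> k \<otimes>\<^bsub>G\<^esub> g"] k by simp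
  qed (rule orb_sub[OF k])
  have rep_eq: "rep (\<alpha> k \<otimes>\<^bsub>G\<^esub> g) = rep g" if "k \<in> carrier K" for k g
    unfolding rep_def orb_eq[OF that] by simp
  obtain c where c: "\<And>g. c g \<in> carrier K" "\<And>g. rep g = \<alpha> (c g) \<otimes>\<^bsub>G\<^esub> g"
    using rep_orb unfolding orb_def image_iff by metis
  have rep_rep: "rep (rep g) = rep g" for g
    using rep_eq[OF c(1)[of g], of g] c(2)[of g] by simp
  have "rep a = a" using orb_self[of a] by (simp add: rep_def)
  then have "(a, e0) \<in> I" by (simp add: I_def)
  moreover have "bij_betw (\<lambda>(k, x). act G (\<alpha> k) x) (carrier K \<times> I) UNIV"
  proof (rule bij_betwI')
    fix p q assume pq: "p \<in> carrier K \<times> I" "q \<in> carrier K \<times> I"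
    obtain k x l y where kl: "p = (k, x)" "q = (l, y)" by (metis surj_pair)
    have "k = l \<and> x = y" if eq: "act G (\<alpha> k) x = act G (\<alpha> l) y"
    proof -
      have e: "\<alpha> k \<otimes>\<^bsub>G\<^esub> fst x = \<alpha> l \<otimes>\<^bsub>G\<^esub> fst y" "snd x = snd y" using eq by (auto simp: act_def)
      have "fst x = rep (fst x)" using pq kl by (simp add: I_def)
      also have "\<dots> = rep (fst y)" using rep_eq[of k "fst x"] rep_eq[of l "fst y"] e pq kl by simp
      also have "\<dots> = fst y" using pq kl by (simp add: I_def)
      finally have "fst x = fst y" .
      with e have "\<alpha> k = \<alpha> l" by simp
      then show ?thesis using inj pq kl \<open>fst x = fst y\<close> e by (auto simp: inj_on_def prod_eq_iff)
    qed
    then show "((case p of (k, x) \<Rightarrow> act G (\<alpha> k) x) = (case q of (k, x) \<Rightarrow> act G (\<alpha> k) x)) = (p = q)"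
      using kl by auto
  next
    fix z :: "'g \<times> ('g set \<times> 'g set)"
    let ?k = "inv\<^bsub>K\<^esub> c (fst z)"
    have "\<alpha> ?k \<otimes>\<^bsub>G\<^esub> rep (fst z) = fst z" using c by (simp flip: H.m_assoc)
    then have "act G (\<alpha> ?k) (rep (fst z), snd z) = z" by (simp add: act_def)
    moreover have "(?k, (rep (fst z), snd z)) \<in> carrier K \<times> I" using c(1) by (simp add: I_def rep_rep)
    ultimately show "\<exists>p\<in>carrier K \<times> I. z = (case p of (k, x) \<Rightarrow> act G (\<alpha> k) x)" by force
  qed simp
  moreover have "{x \<in> I. {k \<in> carrier K. \<alpha> k \<otimes>\<^bsub>G\<^esub> fst x \<in> fst (snd x)} = U} \<approx> (UNIV :: 'g set set)"
    (is "?X \<approx> _") if U: "U \<subseteq> carrier K" for U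
  proof (rule lepoll_antisym)
    have "?X \<lesssim> (UNIV :: ('g \<times> ('g set \<times> 'g set)) set)" by (simp add: subset_imp_lepoll)
    then show "?X \<lesssim> (UNIV :: 'g set set)"
      using set_times_set_eqpoll[OF inf] by (rule lepoll_trans)
    define f where "f n = (a, ((\<lambda>k. \<alpha> k \<otimes>\<^bsub>G\<^esub> a) ` U, n))" for n :: "'g set"
    have "k \<in> U" if "k \<in> carrier K" "\<alpha> k \<in> \<alpha> ` U" for k
      using that U inj by (meson inj_on_image_mem_iff)
    then have "{k \<in> carrier K. \<alpha> k \<otimes>\<^bsub>G\<^esub> a \<in> (\<lambda>k. \<alpha> k \<otimes>\<^bsub>G\<^esub> a) ` U} = U"
      using U by (auto simp: image_iff)
    then have "f n \<in> ?X" for n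
      using \<open>rep a = a\<close> by (simp add: f_def I_def)
    moreover have "inj f" by (simp add: f_def inj_on_def)
    ultimately have "inj f \<and> range f \<subseteq> ?X" by blast
    then show "(UNIV :: 'g set set) \<lesssim> ?X" unfolding lepoll_def by (intro exI[of _ f])
  qed
  ultimately show ?thesis by (intro exI[of _ I] conjI allI impI)
qed

text \<open>A partial isomorphism between the actions of \<open>K\<close> through \<open>\<alpha>\<close> and through \<open>\<beta>\<close>, given on one orbit,
  extends to a permutation that preserves colours: match the remaining orbits of equal colouring
  arbitrarily.\<close>

theorem extend_partial_isomorphism:
  fixes G :: "'g monoid" and K :: "'k monoid"
  assumes G: "group G" "carrier G = UNIV" and inf: "infinite (UNIV :: 'g set)"
    and K: "group K"
    and hom: "\<alpha> \<in> hom K G" "\<beta> \<in> hom K G" and inj: "inj_on \<alpha> (carrier K)" "inj_on \<beta> (carrier K)"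
    and T: "\<And>k. k \<in> carrier K \<Longrightarrow> \<alpha> k \<otimes>\<^bsub>G\<^esub> a \<in> T \<longleftrightarrow> \<beta> k \<otimes>\<^bsub>G\<^esub> b \<in> T"
  shows "\<exists>r :: 'g \<times> ('g set \<times> 'g set) \<Rightarrow> 'g \<times> ('g set \<times> 'g set). bij r \<and>
     (\<forall>k\<in>carrier K. \<forall>x. r (act G (\<alpha> k) x) = act G (\<beta> k) (r x)) \<and>
     r (a, (T, {})) = (b, (T, {})) \<and> (\<forall>x. fst (r x) \<in> fst (snd (r x)) \<longleftrightarrow> fst x \<in> fst (snd x))"
proof -
  interpret A: group_hom K G \<alpha> by (intro group_hom.intro group_hom_axioms.intro assms)
  interpret B: group_hom K G \<beta> by (intro group_hom.intro group_hom_axioms.intro assms)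
  have [simp]: "x \<in> carrier G" for x using G by simp
  define ty where "ty \<gamma> x = {k \<in> carrier K. \<gamma> k \<otimes>\<^bsub>G\<^esub> fst x \<in> fst (snd x)}"
    for \<gamma> and x :: "'g \<times> ('g set \<times> 'g set)"
  define m where "m \<gamma> = (\<lambda>(k, x :: 'g \<times> ('g set \<times> 'g set)). act G (\<gamma> k) x)" for \<gamma> :: "'k \<Rightarrow> 'g"
  let ?p = "(a, (T, {})) :: 'g \<times> ('g set \<times> 'g set)" and ?q = "(b, (T, {})) :: 'g \<times> ('g set \<times> 'g set)"
  obtain I where "?p \<in> I \<and> bij_betw (m \<alpha>) (carrier K \<times> I) UNIV \<and>
      (\<forall>U \<subseteq> carrier K. {x \<in> I. ty \<alpha> x = U} \<approx> (UNIV :: 'g set set))"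
    using orbit_section[OF G inf K hom(1) inj(1), of a "(T, {})"] unfolding m_def ty_def by (elim exE)
  then have I: "?p \<in> I" "bij_betw (m \<alpha>) (carrier K \<times> I) UNIV"
    "\<And>U. U \<subseteq> carrier K \<Longrightarrow> {x \<in> I. ty \<alpha> x = U} \<approx> (UNIV :: 'g set set)"
    by simp_all
  obtain J where "?q \<in> J \<and> bij_betw (m \<beta>) (carrier K \<times> J) UNIV \<and>
      (\<forall>U \<subseteq> carrier K. {x \<in> J. ty \<beta> x = U} \<approx> (UNIV :: 'g set set))"
    using orbit_section[OF G inf K hom(2) inj(2), of b "(T, {})"] unfolding m_def ty_def by (elim exE)
  then have J: "?q \<in> J" "bij_betw (m \<beta>) (carrier K \<times> J) UNIV"
    "\<And>U. U \<subseteq> carrier K \<Longrightarrow> {x \<in> J. ty \<beta> x = U} \<approx> (UNIV :: 'g set set)"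
    by simp_all
  have ty_sub: "ty \<gamma> x \<subseteq> carrier K" for \<gamma> x by (auto simp: ty_def)
  have ty_pq: "ty \<alpha> ?p = ty \<beta> ?q" using T by (auto simp: ty_def)
  define f where "f U = (SOME f. bij_betw f {x \<in> I. ty \<alpha> x = U} {x \<in> J. ty \<beta> x = U})" for U
  have f: "bij_betw (f (ty \<gamma> y)) {x \<in> I. ty \<alpha> x = ty \<gamma> y} {x \<in> J. ty \<beta> x = ty \<gamma> y}" for \<gamma> y
  proof -
    have "{x \<in> I. ty \<alpha> x = ty \<gamma> y} \<approx> {x \<in> J. ty \<beta> x = ty \<gamma> y}"
      by (rule eqpoll_trans[OF I(3) eqpoll_sym[OF J(3)]]) (rule ty_sub)+
    then show ?thesis unfolding eqpoll_def f_def by (rule someI_ex)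
  qed
  define h0 where "h0 x = f (ty \<alpha> x) x" for x
  have h0: "h0 x \<in> J" "ty \<beta> (h0 x) = ty \<alpha> x" if "x \<in> I" for x
    using bij_betw_apply[OF f[of \<alpha> x], of x] that by (simp_all add: h0_def)
  have h0_inj: "inj_on h0 I"
  proof (rule inj_onI)
    fix x y assume xy: "x \<in> I" "y \<in> I" "h0 x = h0 y"
    then have "ty \<alpha> x = ty \<alpha> y" using h0(2)[of x] h0(2)[of y] by simp
    then show "x = y"
      using inj_onD[OF bij_betw_imp_inj_on[OF f[of \<alpha> x]], of x y] xy by (simp add: h0_def)
  qed
  have h0_surj: "y \<in> h0 ` I" if "y \<in> J" for y
  proof -
    have "y \<in> f (ty \<beta> y) ` {x \<in> I. ty \<alpha> x = ty \<beta> y}"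
      using that by (simp add: bij_betw_imp_surj_on[OF f[of \<beta> y]])
    then obtain x where "y = f (ty \<beta> y) x" "x \<in> I" "ty \<alpha> x = ty \<beta> y" by blast
    then have "y = h0 x" "x \<in> I" by (simp_all add: h0_def)
    then show ?thesis by (rule image_eqI)
  qed
  \<comment> \<open>The chosen matching \<open>h0\<close> need not send \<open>?p\<close> to
    \<open>?q\<close>. As \<open>h0 ?p\<close> and \<open>?q\<close> have the same colouring,
    exchanging them repairs this without disturbing colours.\<close>
  define h where "h = Transposition.transpose (h0 ?p) ?q \<circ> h0"
  have h: "bij_betw h I J" "h ?p = ?q" "\<And>x. x \<in> I \<Longrightarrow> ty \<beta> (h x) = ty \<alpha> x"
  proof -
    have "h0 ` I = J" using h0(1) h0_surj by auto
    then have "bij_betw h0 I J" using h0_inj by (simp add: bij_betw_def)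
    moreover have "bij_betw (Transposition.transpose (h0 ?p) ?q) J J"
      using h0(1)[OF I(1)] J(1) by (simp add: bij_betw_transpose_iff)
    ultimately show "bij_betw h I J" unfolding h_def by (rule bij_betw_trans)
    show "h ?p = ?q" by (simp add: h_def)
    show "ty \<beta> (h x) = ty \<alpha> x" if "x \<in> I" for x
      using h0(2)[OF that] h0(2)[OF I(1)] ty_pq
      unfolding h_def Transposition.transpose_def comp_def by presburger
  qed
  define s where "s = inv_into (carrier K \<times> I) (m \<alpha>)"
  have s: "bij_betw s UNIV (carrier K \<times> I)" unfolding s_def by (rule bij_betw_inv_into[OF I(2)])
  have sm: "s (act G (\<alpha> k) x) = (k, x)" if "k \<in> carrier K" "x \<in> I" for k x
    using bij_betw_inv_into_left[OF I(2), of "(k, x)"] that by (simp add: s_def m_def)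
  \<comment> \<open>Both actions are free, so every point has coordinates in
    \<open>carrier K\<close> and the section. Keeping the first coordinate makes \<open>r\<close>
    equivariant, matching the second makes it preserve colours.\<close>
  define r where "r = m \<beta> \<circ> map_prod id h \<circ> s"
  have rm: "r (act G (\<alpha> k) x) = act G (\<beta> k) (h x)" if "k \<in> carrier K" "x \<in> I" for k x
    using sm[OF that] by (simp add: r_def m_def)
  have ex: "\<exists>k\<in>carrier K. \<exists>x\<in>I. y = act G (\<alpha> k) x" for y
  proof -
    have "y \<in> m \<alpha> ` (carrier K \<times> I)" using bij_betw_imp_surj_on[OF I(2)] by simp
    then show ?thesis unfolding m_def by auto
  qed
  have "bij r"
    unfolding r_def comp_assoc
    by (rule bij_betw_trans[OF bij_betw_trans[OF s bij_betw_map_prod[OF bij_betw_id h(1)]] J(2), unfolded comp_assoc])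
  moreover have "r (act G (\<alpha> k) y) = act G (\<beta> k) (r y)" if k: "k \<in> carrier K" for k y
  proof -
    obtain l x where lx: "l \<in> carrier K" "x \<in> I" "y = act G (\<alpha> l) x" using ex by blast
    have "act G (\<alpha> k) y = act G (\<alpha> (k \<otimes>\<^bsub>K\<^esub> l)) x"
      using k lx by (simp add: act_def A.H.m_assoc)
    then have "r (act G (\<alpha> k) y) = act G (\<beta> (k \<otimes>\<^bsub>K\<^esub> l)) (h x)"
      using k lx(1,2) by (simp only: rm A.G.m_closed)
    also have "\<dots> = act G (\<beta> k) (act G (\<beta> l) (h x))"
      using k lx by (simp add: act_def A.H.m_assoc)
    also have "\<dots> = act G (\<beta> k) (r y)"
      using lx by (simp add: rm)
    finally show ?thesis .
  qed
  moreover have "r ?p = ?q"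
    using rm[OF A.G.one_closed I(1)] h(2) by (simp add: act_def)
  moreover have "fst (r y) \<in> fst (snd (r y)) \<longleftrightarrow> fst y \<in> fst (snd y)" for y
  proof -
    obtain l x where lx: "l \<in> carrier K" "x \<in> I" "y = act G (\<alpha> l) x" using ex by blast
    have "fst (r y) \<in> fst (snd (r y)) \<longleftrightarrow> l \<in> ty \<beta> (h x)"
      using lx rm[OF lx(1,2)] by (simp add: ty_def) (simp add: act_def)
    also have "\<dots> \<longleftrightarrow> fst y \<in> fst (snd y)"
      using lx by (simp add: h(3)) (simp add: act_def ty_def)
    finally show ?thesis .
  qed
  ultimately show ?thesis by (intro exI[of _ r] conjI ballI allI)
qed

section \<open>Trees as group elements\<close>

text \<open>What is available in an arbitrary solution of the equations, where different trees may
  have the same value.\<close>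

locale pair_group = group G for G (structure) +
  fixes \<iota>\<^sub>0 \<iota>\<^sub>1 :: "'a \<Rightarrow> 'a" and A :: 'a
  assumes hom0: "\<iota>\<^sub>0 \<in> hom G G" and hom1: "\<iota>\<^sub>1 \<in> hom G G"
    and comm: "x \<in> carrier G \<Longrightarrow> y \<in> carrier G \<Longrightarrow> \<iota>\<^sub>0 x \<otimes> \<iota>\<^sub>1 y = \<iota>\<^sub>1 y \<otimes> \<iota>\<^sub>0 x"
    and A [simp]: "A \<in> carrier G"
begin

sublocale h0: group_hom G G \<iota>\<^sub>0
  by (intro group_hom.intro group_hom_axioms.intro is_group hom0)
sublocale h1: group_hom G G \<iota>\<^sub>1
  by (intro group_hom.intro group_hom_axioms.intro is_group hom1)

primrec tree_val :: "tm \<Rightarrow> (nat \<Rightarrow> 'a) \<Rightarrow> 'a" where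
  "tree_val (V i) s = s i"
| "tree_val Lf s = \<one>"
| "tree_val (Nd p q) s = \<iota>\<^sub>0 (tree_val p s) \<otimes> \<iota>\<^sub>1 (tree_val q s) \<otimes> A"

text \<open>Leaving out every \<open>A\<close> gives an expression that is multiplicative in the
  variables. \<open>tree_val_leaf_val\<close> collects the omitted factors in a constant on the
  right, so the instances of a pattern form a coset.\<close>

primrec leaf_val :: "tm \<Rightarrow> (nat \<Rightarrow> 'a) \<Rightarrow> 'a" where
  "leaf_val (V i) s = s i"
| "leaf_val Lf s = \<one>"
| "leaf_val (Nd p q) s = \<iota>\<^sub>0 (leaf_val p s) \<otimes> \<iota>\<^sub>1 (leaf_val q s)"

lemma tree_val_closed [simp]: "(\<And>i. s i \<in> carrier G) \<Longrightarrow> tree_val p s \<in> carrier G"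
  by (induction p) auto

lemma leaf_val_closed [simp]: "(\<And>i. s i \<in> carrier G) \<Longrightarrow> leaf_val p s \<in> carrier G"
  by (induction p) auto

lemma interchange:
  assumes "x \<in> carrier G" "y \<in> carrier G" "x' \<in> carrier G" "y' \<in> carrier G"
  shows "\<iota>\<^sub>0 (x \<otimes> x') \<otimes> \<iota>\<^sub>1 (y \<otimes> y') = (\<iota>\<^sub>0 x \<otimes> \<iota>\<^sub>1 y) \<otimes> (\<iota>\<^sub>0 x' \<otimes> \<iota>\<^sub>1 y')"
proof -
  have "\<iota>\<^sub>0 (x \<otimes> x') \<otimes> \<iota>\<^sub>1 (y \<otimes> y') = \<iota>\<^sub>0 x \<otimes> (\<iota>\<^sub>0 x' \<otimes> \<iota>\<^sub>1 y) \<otimes> \<iota>\<^sub>1 y'"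
    using assms by (simp add: m_assoc)
  also have "\<dots> = (\<iota>\<^sub>0 x \<otimes> \<iota>\<^sub>1 y) \<otimes> (\<iota>\<^sub>0 x' \<otimes> \<iota>\<^sub>1 y')"
    using assms by (subst comm) (simp_all add: m_assoc)
  finally show ?thesis .
qed

lemma leaf_val_mult:
  assumes "\<And>i. s i \<in> carrier G" "\<And>i. t i \<in> carrier G"
  shows "leaf_val p (\<lambda>i. s i \<otimes> t i) = leaf_val p s \<otimes> leaf_val p t"
  using assms by (induction p) (auto simp: interchange simp del: h0.hom_mult h1.hom_mult)

lemma tree_val_leaf_val:
  assumes "\<And>i. s i \<in> carrier G"
  shows "tree_val p s = leaf_val p s \<otimes> tree_val p (\<lambda>_. \<one>)"
proof (induction p)
  case (Nd p q)
  have "tree_val (Nd p q) s = (\<iota>\<^sub>0 (leaf_val p s \<otimes> tree_val p (\<lambda>_. \<one>)) \<otimes> \<iota>\<^sub>1 (leaf_val q s \<otimes> tree_val q (\<lambda>_. \<one>))) \<otimes> A"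
    using Nd by simp
  also have "\<dots> = leaf_val (Nd p q) s \<otimes> tree_val (Nd p q) (\<lambda>_. \<one>)"
    using assms by (subst interchange) (simp_all add: m_assoc)
  finally show ?case .
qed (use assms in auto)

lemma tree_val_cong: "(\<And>i. i \<in> vars p \<Longrightarrow> s i = t i) \<Longrightarrow> tree_val p s = tree_val p t"
  by (induction p) auto

lemma leaf_val_cong: "(\<And>i. i \<in> vars p \<Longrightarrow> s i = t i) \<Longrightarrow> leaf_val p s = leaf_val p t"
  by (induction p) auto

lemma tree_val_subst: "tree_val (subst u p) s = tree_val p (\<lambda>i. tree_val (u i) s)"
  by (induction p) auto

end

text \<open>Faithfulness of the coding, as it holds in the model. A leaf has value one, so
  \<open>pair_neq_one\<close> tells leaves from nodes.\<close>

locale free_pair_group = pair_group +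
  assumes pair_inj: "\<lbrakk>x \<in> carrier G; y \<in> carrier G; x' \<in> carrier G; y' \<in> carrier G;
      \<iota>\<^sub>0 x \<otimes> \<iota>\<^sub>1 y = \<iota>\<^sub>0 x' \<otimes> \<iota>\<^sub>1 y'\<rbrakk> \<Longrightarrow> x = x' \<and> y = y'"
    and pair_neq_one: "x \<in> carrier G \<Longrightarrow> y \<in> carrier G \<Longrightarrow> \<iota>\<^sub>0 x \<otimes> \<iota>\<^sub>1 y \<otimes> A \<noteq> \<one>"
begin

lemma tree_val_clash:
  assumes "clash p q" "\<And>i. s i \<in> carrier G" "\<And>i. t i \<in> carrier G"
  shows "tree_val p s \<noteq> tree_val q t"
  using assms(1)
proof (induction p q rule: clash.induct)
  case (1 a b)
  then show ?case using pair_neq_one[of "tree_val a t" "tree_val b t"] assms by (simp add: eq_commute[of \<one>])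
next
  case (2 a b)
  then show ?case using pair_neq_one assms by simp
next
  case (3 a b c d)
  then show ?case
    using pair_inj[of "tree_val a s" "tree_val b s" "tree_val c t" "tree_val d t"] assms by auto
qed auto

lemma tree_val_inj:
  assumes "tree_val p s = tree_val p t" "i \<in> vars p" "\<And>i. s i \<in> carrier G" "\<And>i. t i \<in> carrier G"
  shows "s i = t i"
  using assms(1,2)
proof (induction p)
  case (Nd p q)
  then show ?case
    using pair_inj[of "tree_val p s" "tree_val q s" "tree_val p t" "tree_val q t"] assms by auto
qed auto

lemma leaf_val_inj:
  assumes "leaf_val p s = leaf_val p t" "i \<in> vars p" "\<And>i. s i \<in> carrier G" "\<And>i. t i \<in> carrier G"
  shows "s i = t i"
  using assms(1,2)
proof (induction p)
  case (Nd p q)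
  then show ?case
    using pair_inj[of "leaf_val p s" "leaf_val q s" "leaf_val p t" "leaf_val q t"] assms by auto
qed auto

text \<open>The substitution takes arbitrary group elements as values, because a rule moves a whole
  coset and not just the values of closed trees in it.\<close>

inductive acc :: "'a \<Rightarrow> bool" where
  base: "acc (tree_val accept (\<lambda>_. \<one>))"
| rule: "(l, r) \<in> set rules \<Longrightarrow> (\<And>i. s i \<in> carrier G) \<Longrightarrow> acc (tree_val r s) \<Longrightarrow> acc (tree_val l s)"

text \<open>From left to right this is determinism: by clashing, the last step of a derivation of
  acceptance must have used the same rule, and by injectivity the same values of its
  variables.\<close>

lemma acc_rule_iff:
  assumes "(l, r) \<in> set rules" and s: "\<And>i. s i \<in> carrier G"
  shows "acc (tree_val l s) \<longleftrightarrow> acc (tree_val r s)"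
proof
  assume "acc (tree_val l s)"
  then show "acc (tree_val r s)"
  proof cases
    case base
    then show ?thesis
      using tree_val_clash[OF rules_clash_halt(1)[OF assms(1)] s, of "\<lambda>_. \<one>"] by simp
  next
    case (rule l' r' s')
    have "(l', r') = (l, r)"
    proof (rule ccontr)
      assume "(l', r') \<noteq> (l, r)"
      moreover obtain i where "i < length rules" "rules ! i = (l, r)"
        using assms(1) by (auto simp: in_set_conv_nth)
      moreover obtain j where "j < length rules" "rules ! j = (l', r')"
        using rule(2) by (auto simp: in_set_conv_nth)
      ultimately have "clash l l'" using rules_clash[of i j] by (cases "i = j") auto
      then show False using tree_val_clash[OF _ s rule(3)] rule(1) by simp
    qed
    then have "tree_val r s = tree_val r' s'"
      using tree_val_inj[OF _ _ s rule(3)] rule(1) rules_vars[OF assms(1)] by (auto intro!: tree_val_cong)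
    then show ?thesis using rule by simp
  qed
qed (rule acc.rule[OF assms])

lemma acc_accept: "acc (tree_val accept s)"
  using acc.base tree_val_cong[of accept s "\<lambda>_. \<one>"] by (simp add: accept_def)

lemma not_acc_reject:
  assumes "\<And>i. s i \<in> carrier G"
  shows "\<not> acc (tree_val reject s)"
proof
  assume "acc (tree_val reject s)"
  then show False
  proof cases
    case base
    then show False using tree_val_clash[OF clash_accept_reject assms, of "\<lambda>_. \<one>"] by simp
  next
    case (rule l r s')
    then show False using tree_val_clash[OF rules_clash_halt(2)[OF rule(2)], of s' s] rule(3) assms by simp
  qed
qed

end

section \<open>Permutations of the natural numbers\<close>

typedef nat_perm = "{f :: nat \<Rightarrow> nat. bij f}"
  by (rule exI[of _ id]) simp

abbreviation "app \<equiv> Rep_nat_perm"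

lemma nat_perm_eqI: "(\<And>n. app f n = app g n) \<Longrightarrow> f = g"
  by (simp add: Rep_nat_perm_inject[symmetric] fun_eq_iff)

definition perm_group :: "nat_perm monoid" where
  "perm_group = \<lparr>carrier = UNIV, mult = (\<lambda>f g. Abs_nat_perm (app f \<circ> app g)), one = Abs_nat_perm id\<rparr>"

lemma carrier_perm_group [simp]: "carrier perm_group = UNIV"
  by (simp add: perm_group_def)

lemma app_mult [simp]: "app (f \<otimes>\<^bsub>perm_group\<^esub> g) n = app f (app g n)"
  using Rep_nat_perm[of f] Rep_nat_perm[of g] by (simp add: perm_group_def Abs_nat_perm_inverse bij_comp)

lemma app_one [simp]: "app \<one>\<^bsub>perm_group\<^esub> n = n"
  by (simp add: perm_group_def Abs_nat_perm_inverse)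

lemma group_perm_group: "group perm_group"
proof (rule groupI)
  fix f
  have "Abs_nat_perm (inv_into UNIV (app f)) \<otimes>\<^bsub>perm_group\<^esub> f = \<one>\<^bsub>perm_group\<^esub>"
    using Rep_nat_perm[of f] by (intro nat_perm_eqI) (simp add: Abs_nat_perm_inverse bij_imp_bij_inv bij_is_inj)
  then show "\<exists>g\<in>carrier perm_group. g \<otimes>\<^bsub>perm_group\<^esub> f = \<one>\<^bsub>perm_group\<^esub>" by auto
qed (auto intro: nat_perm_eqI)

interpretation Perm: group perm_group by (rule group_perm_group)

lemma perm_inv_eqI: "g \<otimes>\<^bsub>perm_group\<^esub> f = \<one>\<^bsub>perm_group\<^esub> \<Longrightarrow> inv\<^bsub>perm_group\<^esub> f = g"
  by (rule Perm.inv_equality) auto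

lemma infinite_nat_perm: "infinite (UNIV :: nat_perm set)"
proof -
  have "inj (\<lambda>n. Abs_nat_perm (Transposition.transpose 0 n))"
  proof (rule injI)
    fix x y assume "Abs_nat_perm (Transposition.transpose 0 x) = Abs_nat_perm (Transposition.transpose 0 y)"
    then have "Transposition.transpose 0 x = Transposition.transpose 0 y"
      by (simp add: Abs_nat_perm_inject)
    then have "Transposition.transpose 0 x 0 = Transposition.transpose 0 y 0" by simp
    then show "x = y" by simp
  qed
  then show ?thesis by (meson finite_imageD finite_subset infinite_UNIV_nat subset_UNIV)
qed

section \<open>Permutations acting below a binary digit\<close>

definition half :: "bool \<Rightarrow> nat_perm \<Rightarrow> nat_perm" where
  "half b f = Abs_nat_perm (\<lambda>n. if odd n = b then 2 * app f (n div 2) + of_bool b else n)"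

lemma app_half [simp]: "app (half b f) n = (if odd n = b then 2 * app f (n div 2) + of_bool b else n)"
proof -
  let ?h = "\<lambda>f n. if odd n = b then 2 * f (n div 2) + of_bool b else n :: nat"
  have "bij (?h (app f))"
  proof (rule o_bij)
    have e: "?h f \<circ> ?h g = id" if "f \<circ> g = id" for f g
    proof
      fix n
      have "f (g (n div 2)) = n div 2" using that by (metis comp_apply id_apply)
      then show "(?h f \<circ> ?h g) n = id n" by (cases b) auto
    qed
    show "?h (inv_into UNIV (app f)) \<circ> ?h (app f) = id" "?h (app f) \<circ> ?h (inv_into UNIV (app f)) = id"
      using Rep_nat_perm[of f] by (rule_tac [!] e) (simp_all add: bij_is_inj bij_is_surj flip: surj_iff)
  qed
  then show ?thesis by (simp add: half_def Abs_nat_perm_inverse)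
qed

text \<open>The element \<open>rot\<close> of Thompson's group \<open>F\<close>, which maps the digit strings \<open>00x\<close>, \<open>01x\<close>, \<open>1x\<close>
  to \<open>0x\<close>, \<open>10x\<close>, \<open>11x\<close>; the digits of a number are read from the least significant one.\<close>

definition rot :: nat_perm where
  "rot = Abs_nat_perm (\<lambda>n. if odd n then 2 * n + 1 else if even (n div 2) then n div 2 else n - 1)"

definition flip :: nat_perm where
  "flip = Abs_nat_perm (\<lambda>n. if even n then n + 1 else n - 1)"

lemma mod4_cases:
  obtains j :: nat where "n = 2 * (2 * j)" | j where "n = Suc (2 * (2 * j))"
  | j where "n = 2 * Suc (2 * j)" | j where "n = Suc (2 * Suc (2 * j))"
proof -
  have "n = 2 * (2 * (n div 4)) \<or> n = Suc (2 * (2 * (n div 4))) \<or>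
    n = 2 * Suc (2 * (n div 4)) \<or> n = Suc (2 * Suc (2 * (n div 4)))"
    by presburger
  then show ?thesis using that by blast
qed

definition unrot :: "nat \<Rightarrow> nat" where
  "unrot n = (if even n then 2 * n else if even (n div 2) then n + 1 else n div 2)"

lemma app_rot: "app rot n = (if odd n then 2 * n + 1 else if even (n div 2) then n div 2 else n - 1)"
  and app_unrot: "app (inv\<^bsub>perm_group\<^esub> rot) n = unrot n"
proof -
  let ?r = "\<lambda>n :: nat. if odd n then 2 * n + 1 else if even (n div 2) then n div 2 else n - 1"
  have 1: "unrot (?r n) = n" for n
    by (cases n rule: mod4_cases) (simp_all add: unrot_def)
  have 2: "?r (unrot n) = n" for n
    by (cases n rule: mod4_cases) (simp_all add: unrot_def)
  have "unrot \<circ> ?r = id" "?r \<circ> unrot = id" by (rule ext; simp only: comp_def id_def 1 2)+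
  then have b: "bij ?r" "bij unrot" using o_bij by blast+
  then show r: "app rot n = ?r n" for n by (simp add: rot_def Abs_nat_perm_inverse)
  have "Abs_nat_perm unrot \<otimes>\<^bsub>perm_group\<^esub> rot = \<one>\<^bsub>perm_group\<^esub>"
    by (rule nat_perm_eqI) (simp only: app_mult app_one r 1 Abs_nat_perm_inverse mem_Collect_eq b)
  then show "app (inv\<^bsub>perm_group\<^esub> rot) n = unrot n"
    using b by (simp add: perm_inv_eqI Abs_nat_perm_inverse)
qed

lemma app_flip: "app flip n = (if even n then n + 1 else n - 1)"
  and inv_flip: "inv\<^bsub>perm_group\<^esub> flip = flip"
proof -
  let ?r = "\<lambda>n :: nat. if even n then n + 1 else n - 1"
  have 1: "?r \<circ> ?r = id" by (auto simp: fun_eq_iff)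
  then have "bij ?r" using o_bij by blast
  then show r: "app flip n = ?r n" for n by (simp add: flip_def Abs_nat_perm_inverse)
  have "flip \<otimes>\<^bsub>perm_group\<^esub> flip = \<one>\<^bsub>perm_group\<^esub>" by (rule nat_perm_eqI) (simp add: r)
  then show "inv\<^bsub>perm_group\<^esub> flip = flip" by (rule perm_inv_eqI)
qed

interpretation Perm: free_pair_group perm_group "half False" "half True" rot
proof
  have "half b \<in> hom perm_group perm_group" for b
    by (auto simp: hom_def intro!: nat_perm_eqI)
  then show "half False \<in> hom perm_group perm_group" "half True \<in> hom perm_group perm_group" by auto
  show "half False x \<otimes>\<^bsub>perm_group\<^esub> half True y = half True y \<otimes>\<^bsub>perm_group\<^esub> half False x" for x y
    by (rule nat_perm_eqI) auto
  show "x = x' \<and> y = y'" if eq: "half False x \<otimes>\<^bsub>perm_group\<^esub> half True y = half False x' \<otimes>\<^bsub>perm_group\<^esub> half True y'"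
    for x y x' y'
  proof -
    have e: "app (half False x) (app (half True y) n) = app (half False x') (app (half True y') n)" for n
      using eq by (metis app_mult)
    have "app x n = app x' n" "app y n = app y' n" for n
      using e[of "2 * n"] e[of "2 * n + 1"] by auto
    then show ?thesis by (auto intro: nat_perm_eqI)
  qed
  show "half False x \<otimes>\<^bsub>perm_group\<^esub> half True y \<otimes>\<^bsub>perm_group\<^esub> rot \<noteq> \<one>\<^bsub>perm_group\<^esub>" for x y
  proof
    assume "half False x \<otimes>\<^bsub>perm_group\<^esub> half True y \<otimes>\<^bsub>perm_group\<^esub> rot = \<one>\<^bsub>perm_group\<^esub>"
    \<comment> \<open>\<open>rot\<close> sends 2 to 1, and the two other factors keep odd numbers
      odd.\<close>
    then have "app (half False x \<otimes>\<^bsub>perm_group\<^esub> half True y \<otimes>\<^bsub>perm_group\<^esub> rot) 2 = 2" by simp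
    then show False by (simp add: app_rot)
  qed
qed auto

text \<open>Each left side is \<open>f\<close> acting below a prefix of two digits, and conjugation
  moves the prefix: \<open>rot\<close> takes 00 to 0 and 1 to 11, \<open>flip\<close> changes the
  first digit.\<close>

lemma half_half:
  "half False (half False f) = inv\<^bsub>perm_group\<^esub> rot \<otimes>\<^bsub>perm_group\<^esub> half False f \<otimes>\<^bsub>perm_group\<^esub> rot" (is ?A)
  "half True (half True f) = rot \<otimes>\<^bsub>perm_group\<^esub> half True f \<otimes>\<^bsub>perm_group\<^esub> inv\<^bsub>perm_group\<^esub> rot" (is ?B)
  "half True (half False f) = flip \<otimes>\<^bsub>perm_group\<^esub> half False (half False f) \<otimes>\<^bsub>perm_group\<^esub> flip" (is ?C)
  "half False (half True f) = flip \<otimes>\<^bsub>perm_group\<^esub> half True (half True f) \<otimes>\<^bsub>perm_group\<^esub> flip" (is ?D)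
proof -
  have eqI: "x = y" if "\<And>j. app x (2 * (2 * j)) = app y (2 * (2 * j))"
    "\<And>j. app x (Suc (2 * (2 * j))) = app y (Suc (2 * (2 * j)))"
    "\<And>j. app x (2 * Suc (2 * j)) = app y (2 * Suc (2 * j))"
    "\<And>j. app x (Suc (2 * Suc (2 * j))) = app y (Suc (2 * Suc (2 * j)))" for x y
    using that by (metis nat_perm_eqI mod4_cases)
  show ?A ?B ?C ?D
    by (rule eqI; simp add: app_rot app_unrot unrot_def app_flip)+
qed

section \<open>The equations\<close>

text \<open>The unknowns: \<open>A\<close> and \<open>B\<close> are interpreted by \<open>rot\<close> and \<open>flip\<close>, conjugation by \<open>X\<close> and \<open>Y\<close> by
  \<open>half False\<close> and \<open>half True\<close>; \<open>T\<close> is the token, \<open>K\<close> detects acceptance, and \<open>R i\<close> performs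
  the \<open>i\<close>-th rule.\<close>

abbreviation "gA \<equiv> Gen 0"
abbreviation "gB \<equiv> Gen 1"
abbreviation "gX \<equiv> Gen 2"
abbreviation "gY \<equiv> Gen 3"
abbreviation "gT \<equiv> Gen 4"
abbreviation "gK \<equiv> Gen 5"
abbreviation "gR i \<equiv> Gen (6 + i)"

definition cj :: "gexp \<Rightarrow> gexp \<Rightarrow> gexp" where "cj u v = Mul (Mul u v) (Inv u)"

primrec tree_exp :: "tm \<Rightarrow> (nat \<Rightarrow> gexp) \<Rightarrow> gexp" where
  "tree_exp (V i) s = s i"
| "tree_exp Lf s = One"
| "tree_exp (Nd p q) s = Mul (Mul (cj gX (tree_exp p s)) (cj gY (tree_exp q s))) gA"

primrec leaf_exp :: "tm \<Rightarrow> (nat \<Rightarrow> gexp) \<Rightarrow> gexp" where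
  "leaf_exp (V i) s = s i"
| "leaf_exp Lf s = One"
| "leaf_exp (Nd p q) s = Mul (cj gX (leaf_exp p s)) (cj gY (leaf_exp q s))"

definition sgens :: "gexp set" where
  "sgens = {gA, gB, cj gX gA, cj gX gB, cj gY gA, cj gY gB}"

definition tok :: "tm \<Rightarrow> gexp" where "tok p = cj (tree_exp p (\<lambda>_. One)) gT"

definition commutes :: "gexp \<Rightarrow> gexp \<Rightarrow> gexp \<times> gexp" where
  "commutes u v = (Mul u v, Mul v u)"

text \<open>The equation between tokens treats the instance with one for every variable. The last
  family intertwines, variable by variable and generator by generator, the subgroups by which the
  other instances arise from it.\<close>

definition rule_eqs :: "nat \<Rightarrow> tm \<Rightarrow> tm \<Rightarrow> (gexp \<times> gexp) set" where
  "rule_eqs i l r = {commutes gK (gR i), (Mul (gR i) (tok l), Mul (tok r) (gR i))} \<union>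
     (\<Union>v\<in>vars l. \<Union>s\<in>sgens. {(Mul (gR i) (leaf_exp l ((\<lambda>_. One)(v := s))), Mul (leaf_exp r ((\<lambda>_. One)(v := s))) (gR i))})"

text \<open>The equations found in \<open>half_half\<close> make the subgroup generated by \<open>sgens\<close> invariant under
  conjugation by \<open>X\<close> and \<open>Y\<close>.\<close>

definition tree_eqs :: "(gexp \<times> gexp) set" where
  "tree_eqs = (\<Union>s\<in>{gA, gB}.
     {(cj gX (cj gX s), cj (Inv gA) (cj gX s)), (cj gY (cj gY s), cj gA (cj gY s)),
      (cj gY (cj gX s), cj gB (cj gX (cj gX s))), (cj gX (cj gY s), cj gB (cj gY (cj gY s)))})
     \<union> (\<Union>s\<in>sgens. \<Union>s'\<in>sgens. {commutes (cj gX s) (cj gY s')})"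

definition system :: "(gexp \<times> gexp) set" where
  "system = tree_eqs \<union> (\<Union>i<length rules. rule_eqs i (fst (rules ! i)) (snd (rules ! i)))
     \<union> {commutes gK (tok accept)}"

definition diseq :: "gexp \<times> gexp" where
  "diseq = commutes gK (tok reject)"

lemma holds_commutes:
  "holds G a (commutes u v) \<longleftrightarrow> geval G a u \<otimes>\<^bsub>G\<^esub> geval G a v = geval G a v \<otimes>\<^bsub>G\<^esub> geval G a u"
  by (simp add: holds_def commutes_def)

lemma geval_cj [simp]:
  "geval G a (cj u v) = geval G a u \<otimes>\<^bsub>G\<^esub> geval G a v \<otimes>\<^bsub>G\<^esub> inv\<^bsub>G\<^esub> geval G a u"
  by (simp add: cj_def)

section \<open>Intertwining relations\<close>

lemma (in group) intertwine_inv: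
  assumes "r \<in> carrier G" "x \<in> carrier G" "y \<in> carrier G" "r \<otimes> x = y \<otimes> r"
  shows "r \<otimes> inv x = inv y \<otimes> r"
proof -
  have "inv y \<otimes> r = inv y \<otimes> (r \<otimes> x) \<otimes> inv x" using assms(1-3) by (simp add: m_assoc)
  also have "\<dots> = r \<otimes> inv x" using assms by (simp add: m_assoc[symmetric])
  finally show ?thesis by simp
qed

lemma (in group) intertwine_mult:
  assumes "r \<in> carrier G" "x \<in> carrier G" "y \<in> carrier G" "x' \<in> carrier G" "y' \<in> carrier G"
    "r \<otimes> x = y \<otimes> r" "r \<otimes> x' = y' \<otimes> r"
  shows "r \<otimes> (x \<otimes> x') = (y \<otimes> y') \<otimes> r"
proof -
  have "r \<otimes> (x \<otimes> x') = y \<otimes> (r \<otimes> x')" using assms(1-6) by (simp flip: m_assoc)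
  then show ?thesis using assms by (simp add: m_assoc)
qed

text \<open>The arguments \<open>x\<close> with \<open>r * f x = g x * r\<close> are closed under
  the group operations. Since \<open>f\<close> and \<open>g\<close> are multiplicative on the
  generated subgroup only, their values at one and at inverses of generators are first derived from
  that.\<close>

lemma (in group) intertwine_generate:
  assumes S: "S \<subseteq> carrier G" and r: "r \<in> carrier G"
    and f: "\<And>x. x \<in> generate G S \<Longrightarrow> f x \<in> carrier G"
      "\<And>x y. x \<in> generate G S \<Longrightarrow> y \<in> generate G S \<Longrightarrow> f (x \<otimes> y) = f x \<otimes> f y"
    and g: "\<And>x. x \<in> generate G S \<Longrightarrow> g x \<in> carrier G"
      "\<And>x y. x \<in> generate G S \<Longrightarrow> y \<in> generate G S \<Longrightarrow> g (x \<otimes> y) = g x \<otimes> g y"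
    and eq: "\<And>s. s \<in> S \<Longrightarrow> r \<otimes> f s = g s \<otimes> r"
    and x: "x \<in> generate G S"
  shows "r \<otimes> f x = g x \<otimes> r"
proof -
  have hom_one: "h \<one> = \<one>" "x \<in> S \<Longrightarrow> h (inv x) = inv (h x)"
    if h: "\<And>x. x \<in> generate G S \<Longrightarrow> h x \<in> carrier G"
      "\<And>x y. x \<in> generate G S \<Longrightarrow> y \<in> generate G S \<Longrightarrow> h (x \<otimes> y) = h x \<otimes> h y" for h x
  proof -
    have 1: "\<one> \<in> generate G S" by (rule generate.one)
    have "h \<one> \<otimes> h \<one> = h \<one>" using h(2)[OF 1 1] by simp
    then show h1: "h \<one> = \<one>" using h(1)[OF 1] by (simp add: r_cancel_one')
    show "h (inv x) = inv (h x)" if x: "x \<in> S"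
    proof -
      have "h (inv x) \<otimes> h x = \<one>"
        using h(2)[OF generate.inv[OF x] generate.incl[OF x]] x S h1 by (auto simp: l_inv)
      then show ?thesis
        using h(1)[OF generate.inv[OF x]] h(1)[OF generate.incl[OF x]] by (simp add: inv_equality)
    qed
  qed
  show ?thesis using x
  proof (induction x rule: generate.induct)
    case one
    then show ?case using hom_one(1)[OF f] hom_one(1)[OF g] r by simp
  next
    case (incl h)
    then show ?case by (rule eq)
  next
    case (inv h)
    then show ?case
      using hom_one(2)[OF f, of h] hom_one(2)[OF g, of h]
        intertwine_inv[OF r f(1) g(1) eq[OF inv], OF generate.incl generate.incl] by simp
  next
    case (eng h1 h2)
    then show ?case using intertwine_mult[OF r, of "f h1" "g h1" "f h2" "g h2"] f g by simp
  qed
qed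

section \<open>Consequences of the equations in an arbitrary solution\<close>

locale system_group = group Q for Q (structure) +
  fixes a :: "nat \<Rightarrow> 'a"
  assumes a_closed [simp]: "a i \<in> carrier Q"
    and sys: "e \<in> system \<Longrightarrow> holds Q a e"
begin

abbreviation "E \<equiv> geval Q a"
definition "D = generate Q (E ` sgens)"
definition "shift0 x = a 2 \<otimes> x \<otimes> inv a 2"
definition "shift1 x = a 3 \<otimes> x \<otimes> inv a 3"

lemma E_closed [simp]: "E u \<in> carrier Q"
  by (rule geval_closed) simp

lemma sgens_closed: "E ` sgens \<subseteq> carrier Q"
  by auto

lemma D_subgroup: "subgroup D Q"
  unfolding D_def by (rule generate_is_subgroup[OF sgens_closed])

lemma D_closed: "x \<in> D \<Longrightarrow> x \<in> carrier Q"
  using subgroup.mem_carrier[OF D_subgroup] .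

lemma sgens_D: "s \<in> sgens \<Longrightarrow> E s \<in> D"
  unfolding D_def by (intro generate.incl imageI)

lemma conj_mult:
  "\<lbrakk>c \<in> carrier Q; x \<in> carrier Q; y \<in> carrier Q\<rbrakk> \<Longrightarrow>
   c \<otimes> (x \<otimes> y) \<otimes> inv c = (c \<otimes> x \<otimes> inv c) \<otimes> (c \<otimes> y \<otimes> inv c)"
  by (simp add: m_assoc inv_solve_left)

lemma shift_mult:
  "x \<in> carrier Q \<Longrightarrow> y \<in> carrier Q \<Longrightarrow> shift0 (x \<otimes> y) = shift0 x \<otimes> shift0 y"
  "x \<in> carrier Q \<Longrightarrow> y \<in> carrier Q \<Longrightarrow> shift1 (x \<otimes> y) = shift1 x \<otimes> shift1 y"
  by (simp_all add: shift0_def shift1_def conj_mult)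

lemma shift_carrier [simp]:
  "x \<in> carrier Q \<Longrightarrow> shift0 x \<in> carrier Q" "x \<in> carrier Q \<Longrightarrow> shift1 x \<in> carrier Q"
  by (simp_all add: shift0_def shift1_def)

lemma shift_inv:
  "x \<in> carrier Q \<Longrightarrow> shift0 (inv x) = inv (shift0 x)"
  "x \<in> carrier Q \<Longrightarrow> shift1 (inv x) = inv (shift1 x)"
  by (simp_all add: shift0_def shift1_def inv_mult_group m_assoc)

lemma E_cj: "E (cj gX u) = shift0 (E u)" "E (cj gY u) = shift1 (E u)"
  by (simp_all add: shift0_def shift1_def)

lemma sys_eq: "(u, v) \<in> system \<Longrightarrow> E u = E v"
  using sys by (fastforce simp: holds_def)

lemma shift_shift:
  assumes "s \<in> {gA, gB}"
  shows "shift0 (shift0 (E s)) \<in> D" "shift1 (shift1 (E s)) \<in> D"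
    "shift1 (shift0 (E s)) \<in> D" "shift0 (shift1 (E s)) \<in> D"
proof -
  have g: "E gA \<in> D" "E gB \<in> D" "shift0 (E s) \<in> D" "shift1 (E s) \<in> D"
    using assms sgens_D[of gA] sgens_D[of gB] sgens_D[of "cj gX s"] sgens_D[of "cj gY s"]
    by (auto simp: sgens_def E_cj simp del: geval_cj)
  have c: "c \<otimes> x \<otimes> inv c \<in> D" if "c \<in> D" "x \<in> D" for c x
    using that D_subgroup by (auto simp: subgroup_def)
  have i: "inv c \<in> D" if "c \<in> D" for c
    using that D_subgroup by (auto simp: subgroup_def)
  have eqs: "(cj gX (cj gX s), cj (Inv gA) (cj gX s)) \<in> system" "(cj gY (cj gY s), cj gA (cj gY s)) \<in> system"
      "(cj gY (cj gX s), cj gB (cj gX (cj gX s))) \<in> system" "(cj gX (cj gY s), cj gB (cj gY (cj gY s))) \<in> system"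
    using assms by (auto simp: system_def tree_eqs_def)
  have "shift0 (shift0 (E s)) = inv (E gA) \<otimes> shift0 (E s) \<otimes> inv (inv (E gA))"
    using sys_eq[OF eqs(1)] unfolding E_cj geval_cj[of Q a "Inv gA"] geval.simps .
  then show 1: "shift0 (shift0 (E s)) \<in> D" using c[OF i] g by metis
  have "shift1 (shift1 (E s)) = E gA \<otimes> shift1 (E s) \<otimes> inv (E gA)"
    using sys_eq[OF eqs(2)] unfolding E_cj geval_cj[of Q a gA] .
  then show 2: "shift1 (shift1 (E s)) \<in> D" using c g by metis
  have "shift1 (shift0 (E s)) = E gB \<otimes> shift0 (shift0 (E s)) \<otimes> inv (E gB)"
    using sys_eq[OF eqs(3)] unfolding E_cj geval_cj[of Q a gB] .
  then show "shift1 (shift0 (E s)) \<in> D" using c g 1 by metis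
  have "shift0 (shift1 (E s)) = E gB \<otimes> shift1 (shift1 (E s)) \<otimes> inv (E gB)"
    using sys_eq[OF eqs(4)] unfolding E_cj geval_cj[of Q a gB] .
  then show "shift0 (shift1 (E s)) \<in> D" using c g 2 by metis
qed

lemma shift_sgens:
  assumes "s \<in> sgens"
  shows "shift0 (E s) \<in> D" "shift1 (E s) \<in> D"
proof -
  have b: "shift0 (E s) \<in> D" "shift1 (E s) \<in> D" if "s \<in> {gA, gB}" for s
    using that sgens_D[of "cj gX s"] sgens_D[of "cj gY s"] by (auto simp: sgens_def E_cj simp del: geval_cj)
  consider "s \<in> {gA, gB}" | s' where "s' \<in> {gA, gB}" "s = cj gX s'" | s' where "s' \<in> {gA, gB}" "s = cj gY s'"
    using assms by (auto simp: sgens_def)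
  then show "shift0 (E s) \<in> D" "shift1 (E s) \<in> D"
    by (cases; simp only: E_cj b shift_shift)+
qed

lemma shift_D: "x \<in> D \<Longrightarrow> shift0 x \<in> D" "x \<in> D \<Longrightarrow> shift1 x \<in> D"
proof -
  have *: "x \<in> D \<Longrightarrow> f x \<in> D"
    if f: "\<And>s. s \<in> sgens \<Longrightarrow> f (E s) \<in> D" "\<And>x y. x \<in> carrier Q \<Longrightarrow> y \<in> carrier Q \<Longrightarrow> f (x \<otimes> y) = f x \<otimes> f y"
      "\<And>x. x \<in> carrier Q \<Longrightarrow> f (inv x) = inv (f x)" "f \<one> = \<one>" for f x
    unfolding D_def
  proof (induction x rule: generate.induct)
    case one
    then show ?case using f(4) generate.one by simp
  next
    case (incl h)
    then show ?case using f(1) by (auto simp: D_def)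
  next
    case (inv h)
    then obtain s where "s \<in> sgens" "h = E s" by auto
    then show ?case using f(1)[of s] f(3) D_subgroup by (simp add: subgroup_def flip: D_def)
  next
    case (eng h1 h2)
    then have "h1 \<in> carrier Q" "h2 \<in> carrier Q" using D_closed by (auto simp: D_def)
    then show ?case using eng f(2) generate.eng by simp
  qed
  show "x \<in> D \<Longrightarrow> shift0 x \<in> D"
    by (rule *) (simp_all add: shift_sgens shift_mult shift_inv, simp add: shift0_def)
  show "x \<in> D \<Longrightarrow> shift1 x \<in> D"
    by (rule *) (simp_all add: shift_sgens shift_mult shift_inv, simp add: shift1_def)
qed

text \<open>Commuting is intertwining with \<open>f = g\<close>, so the generators can be replaced
  by arbitrary elements of \<open>D\<close> one argument at a time.\<close>

lemma shift_commute:
  assumes "x \<in> D" "y \<in> D"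
  shows "shift0 x \<otimes> shift1 y = shift1 y \<otimes> shift0 x"
proof -
  have D: "generate Q (E ` sgens) = D" by (simp add: D_def)
  have ss: "shift0 (E s) \<otimes> shift1 (E s') = shift1 (E s') \<otimes> shift0 (E s)" if "s \<in> sgens" "s' \<in> sgens" for s s'
  proof -
    have "commutes (cj gX s) (cj gY s') \<in> system" using that by (auto simp: system_def tree_eqs_def)
    from sys[OF this] show ?thesis unfolding holds_commutes E_cj .
  qed
  have 1: "shift1 (E s') \<otimes> shift0 x = shift0 x \<otimes> shift1 (E s')" if "s' \<in> sgens" for s'
    by (rule intertwine_generate[OF sgens_closed, where x = x])
      (use that assms ss in \<open>auto simp: D D_closed shift_mult\<close>)
  show ?thesis
    by (rule intertwine_generate[OF sgens_closed, where x = y])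
      (use assms 1 in \<open>auto simp: D D_closed shift_mult\<close>)
qed

abbreviation "QD \<equiv> Q\<lparr>carrier := D\<rparr>"

text \<open>The pair structure lives on \<open>D\<close>: this is where the images of the two
  conjugations are known to commute.\<close>

sublocale P: pair_group QD shift0 shift1 "a 0"
proof (intro pair_group.intro pair_group_axioms.intro)
  show "group QD" using D_subgroup is_group by (rule subgroup.subgroup_is_group)
  show "shift0 \<in> hom QD QD" "shift1 \<in> hom QD QD"
    by (auto simp: hom_def shift_D shift_mult D_closed)
  show "a 0 \<in> carrier QD" using sgens_D[of gA] by (simp add: sgens_def)
qed (auto simp: shift_commute)

lemma E_tree_exp: "E (tree_exp p s) = P.tree_val p (\<lambda>i. E (s i))"
  by (induction p) (simp_all only: tree_exp.simps geval.simps E_cj P.tree_val.simps, simp_all)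

lemma E_leaf_exp: "E (leaf_exp p s) = P.leaf_val p (\<lambda>i. E (s i))"
  by (induction p) (simp_all only: leaf_exp.simps geval.simps E_cj P.leaf_val.simps, simp_all)

definition "token x = x \<otimes> a 4 \<otimes> inv x"

lemma E_tok: "E (tok p) = token (P.tree_val p (\<lambda>_. \<one>))"
  by (simp add: tok_def token_def E_tree_exp)

lemma token_mult: "x \<in> carrier Q \<Longrightarrow> y \<in> carrier Q \<Longrightarrow> token (x \<otimes> y) = x \<otimes> token y \<otimes> inv x"
  by (simp add: token_def inv_mult_group m_assoc)

lemma token_closed [simp]: "x \<in> carrier Q \<Longrightarrow> token x \<in> carrier Q"
  by (simp add: token_def)

text \<open>The equations cover a generator in a single variable. Generation gives any element of
  \<open>D\<close> in a single variable (\<open>sing\<close>), and a substitution is the pointwise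
  product of its single-variable parts, multiplied up along \<open>cut\<close>.\<close>

lemma rule_leaf_val:
  assumes i: "i < length rules" "rules ! i = (l, r)" and s: "\<And>j. s j \<in> D"
  shows "a (6 + i) \<otimes> P.leaf_val l s = P.leaf_val r s \<otimes> a (6 + i)"
proof -
  have lr: "(l, r) \<in> set rules" using i nth_mem by metis
  have P: "P.leaf_val p t \<in> carrier Q" if "\<And>j. t j \<in> D" for p t
    using P.leaf_val_closed[of t p] that D_closed by simp
  have D1: "\<one> \<in> D" using D_subgroup by (simp add: subgroup_def)
  define sing where "sing v x = (\<lambda>_. \<one>)(v := x)" for v :: nat and x
  have sD: "sing v x j \<in> D" if "x \<in> D" for v x j using that D1 by (simp add: sing_def)
  have sing_mult: "P.leaf_val p (sing v (x \<otimes> y)) = P.leaf_val p (sing v x) \<otimes> P.leaf_val p (sing v y)" if "x \<in> D" "y \<in> D" for p v x y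
  proof -
    have "sing v (x \<otimes> y) = (\<lambda>j. sing v x j \<otimes> sing v y j)" by (auto simp: sing_def)
    then show ?thesis using P.leaf_val_mult[of "sing v x" "sing v y" p] that sD by simp
  qed
  have gen: "a (6 + i) \<otimes> P.leaf_val l (sing v (E g)) = P.leaf_val r (sing v (E g)) \<otimes> a (6 + i)"
    if "v \<in> vars l" "g \<in> sgens" for v g
  proof -
    have "(Mul (gR i) (leaf_exp l ((\<lambda>_. One)(v := g))), Mul (leaf_exp r ((\<lambda>_. One)(v := g))) (gR i)) \<in> system"
      using that i by (force simp: system_def rule_eqs_def)
    from sys_eq[OF this] show ?thesis
      unfolding geval.simps E_leaf_exp by (simp add: sing_def fun_upd_def if_distrib cong: if_cong)
  qed
  have one: "a (6 + i) \<otimes> P.leaf_val l (sing v x) = P.leaf_val r (sing v x) \<otimes> a (6 + i)" if "v \<in> vars l" "x \<in> D" for v x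
    by (rule intertwine_generate[OF sgens_closed, where x = x])
      (use that gen in \<open>auto simp: D_def[symmetric] P sD sing_mult\<close>)
  define cut where "cut W = (\<lambda>j. if j \<in> W then s j else \<one>)" for W
  have cD: "cut W j \<in> D" for W j using s D1 by (simp add: cut_def)
  have "a (6 + i) \<otimes> P.leaf_val l (cut W) = P.leaf_val r (cut W) \<otimes> a (6 + i)" if "finite W" "W \<subseteq> vars l" for W
    using that
  proof (induction W rule: finite_induct)
    case empty
    have "cut {} = sing 0 \<one>" by (auto simp: cut_def sing_def)
    moreover have "P.leaf_val p (cut {}) = \<one>" for p
      using P.h0.hom_one P.h1.hom_one by (induction p) (simp_all add: cut_def)
    ultimately show ?case by simp
  next
    case (insert v W)
    have c: "cut (insert v W) = (\<lambda>j. sing v (s v) j \<otimes> cut W j)"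
    proof
      fix j
      show "cut (insert v W) j = sing v (s v) j \<otimes> cut W j"
        using insert.hyps D_closed[OF s] by (simp add: cut_def sing_def)
    qed
    have "P.leaf_val p (cut (insert v W)) = P.leaf_val p (sing v (s v)) \<otimes> P.leaf_val p (cut W)" for p
      unfolding c using P.leaf_val_mult[of "sing v (s v)" "cut W" p] sD[OF s] cD by simp
    then show ?case
      using intertwine_mult[OF a_closed P[OF sD[OF s]] P[OF sD[OF s]] P[OF cD] P[OF cD] one[of v "s v"] insert.IH]
        insert.prems s by simp
  qed
  moreover have "finite (vars l)" by (induction l) auto
  ultimately have "a (6 + i) \<otimes> P.leaf_val l (cut (vars l)) = P.leaf_val r (cut (vars l)) \<otimes> a (6 + i)" by blast
  moreover have "P.leaf_val l (cut (vars l)) = P.leaf_val l s" "P.leaf_val r (cut (vars l)) = P.leaf_val r s"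
    using rules_vars[OF lr] by (auto simp: cut_def intro!: P.leaf_val_cong)
  ultimately show ?thesis by simp
qed

definition "fixed x \<longleftrightarrow> a 5 \<otimes> token x = token x \<otimes> a 5"

text \<open>The rule's unknown carries one token of the left pattern to the right pattern and
  intertwines the leaf values by which all other tokens are conjugate to it; hence it carries every
  instance. As it commutes with \<open>a 5\<close>, commuting with \<open>a 5\<close> is carried
  along.\<close>

lemma fixed_rule:
  assumes lr: "(l, r) \<in> set rules" and s: "\<And>j. s j \<in> D"
  shows "fixed (P.tree_val l s) \<longleftrightarrow> fixed (P.tree_val r s)"
proof -
  obtain i where i: "i < length rules" "rules ! i = (l, r)" using lr by (auto simp: in_set_conv_nth)
  let ?R = "a (6 + i)"
  have P: "P.tree_val p t \<in> carrier Q" "P.leaf_val p t \<in> carrier Q" if "\<And>j. t j \<in> D" for p t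
    using P.tree_val_closed[of t p] P.leaf_val_closed[of t p] that D_closed by simp_all
  have D1: "\<one> \<in> D" using D_subgroup by (simp add: subgroup_def)
  have e: "commutes gK (gR i) \<in> system" "(Mul (gR i) (tok l), Mul (tok r) (gR i)) \<in> system"
    using i by (force simp: system_def rule_eqs_def)+
  have k: "a 5 \<otimes> ?R = ?R \<otimes> a 5" using sys[OF e(1)] by (simp add: holds_commutes)
  have "?R \<otimes> token (P.tree_val l (\<lambda>_. \<one>)) = token (P.tree_val r (\<lambda>_. \<one>)) \<otimes> ?R"
    using sys_eq[OF e(2)] by (simp add: E_tok)
  moreover note dv = rule_leaf_val[OF i s]
  moreover have "?R \<otimes> inv P.leaf_val l s = inv P.leaf_val r s \<otimes> ?R"
    by (rule intertwine_inv[OF a_closed P(2)[OF s] P(2)[OF s] dv])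
  ultimately have "?R \<otimes> (P.leaf_val l s \<otimes> token (P.tree_val l (\<lambda>_. \<one>)) \<otimes> inv P.leaf_val l s)
      = (P.leaf_val r s \<otimes> token (P.tree_val r (\<lambda>_. \<one>)) \<otimes> inv P.leaf_val r s) \<otimes> ?R"
    by (intro intertwine_mult) (simp_all add: P s D1)
  moreover have "token (P.tree_val p s) = P.leaf_val p s \<otimes> token (P.tree_val p (\<lambda>_. \<one>)) \<otimes> inv P.leaf_val p s" for p
    using P.tree_val_leaf_val[of s p] s by (simp add: token_mult P D1)
  ultimately have t: "?R \<otimes> token (P.tree_val l s) = token (P.tree_val r s) \<otimes> ?R" by simp
  have c: "token (P.tree_val l s) \<in> carrier Q" "token (P.tree_val r s) \<in> carrier Q" by (simp_all add: P s)
  let ?u = "token (P.tree_val l s)" and ?v = "token (P.tree_val r s)"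
  have "?R \<otimes> (a 5 \<otimes> ?u) = (a 5 \<otimes> ?v) \<otimes> ?R"
    by (rule intertwine_mult) (use c k t in simp_all)
  moreover have "?R \<otimes> (?u \<otimes> a 5) = (?v \<otimes> a 5) \<otimes> ?R"
    by (rule intertwine_mult) (use c k t in simp_all)
  ultimately show ?thesis
    unfolding fixed_def using c by (metis Units_eq Units_l_cancel a_closed m_closed right_cancel)
qed

abbreviation "val t \<equiv> P.tree_val t (\<lambda>_. \<one>)"

lemma fixed_rew: "rew t u \<Longrightarrow> fixed (val t) \<longleftrightarrow> fixed (val u)"
proof (induction rule: rew.induct)
  case (rew l r s)
  have "P.tree_val (s i) (\<lambda>_. \<one>) \<in> D" for i
    using P.tree_val_closed[of "\<lambda>_. \<one>" "s i"] D_subgroup by (simp add: subgroup_def)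
  then show ?case using fixed_rule[OF rew] by (simp add: P.tree_val_subst)
qed

lemma fixed_rews: "rews t u \<Longrightarrow> fixed (val t) \<longleftrightarrow> fixed (val u)"
  by (induction rule: rtranclp_induct) (auto simp: fixed_rew)

theorem not_decidable:
  assumes "\<not> holds Q a diseq" "\<And>n. computes f [n] (if fixed (val (start n)) then 1 else 0)"
  shows False
proof -
  have acc: "fixed (val accept)"
    using sys[of "commutes gK (tok accept)"] by (simp add: system_def holds_commutes E_tok fixed_def)
  have rej: "\<not> fixed (val reject)"
    using assms(1) by (simp add: diseq_def holds_commutes E_tok fixed_def)
  obtain n where n: "\<And>y. computes f [n] y \<Longrightarrow> rews (start n) (ret (num y) Lf)"
    using universal[of f] by blast
  show False
  proof (cases "fixed (val (start n))")
    case True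
    then have "rews (start n) reject" using n[of 1] assms(2)[of n] by (simp add: reject_def)
    then show False using True rej fixed_rews by blast
  next
    case False
    then have "rews (start n) accept" using n[of 0] assms(2)[of n] by (simp add: accept_def)
    then show False using False acc fixed_rews by blast
  qed
qed

end

section \<open>A model of the equations\<close>

definition sym_group :: "('x \<Rightarrow> 'x) monoid" where
  "sym_group = \<lparr>carrier = {f. bij f}, mult = (\<circ>), one = id\<rparr>"

lemma sym_group_simps [simp]:
  "f \<in> carrier sym_group \<longleftrightarrow> bij f" "f \<otimes>\<^bsub>sym_group\<^esub> g = f \<circ> g" "\<one>\<^bsub>sym_group\<^esub> = id"
  by (simp_all add: sym_group_def)

lemma group_sym_group: "group sym_group"
proof (rule groupI)
  fix f :: "'a \<Rightarrow> 'a" assume "f \<in> carrier sym_group"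
  then show "\<exists>g\<in>carrier sym_group. g \<otimes>\<^bsub>sym_group\<^esub> f = \<one>\<^bsub>sym_group\<^esub>"
    by (intro bexI[of _ "inv_into UNIV f"]) (auto simp: bij_imp_bij_inv bij_is_inj)
qed (auto simp: bij_comp o_assoc)

interpretation Sym: group "sym_group :: ('x \<Rightarrow> 'x) monoid" by (rule group_sym_group)

lemma comp_transpose:
  assumes "inj f"
  shows "f \<circ> Transposition.transpose x y = Transposition.transpose (f x) (f y) \<circ> f"
  using assms by (auto simp: fun_eq_iff Transposition.transpose_def inj_eq)

lemma sym_conj:
  assumes "bij f" "f \<circ> g = h \<circ> f"
  shows "f \<otimes>\<^bsub>sym_group\<^esub> g \<otimes>\<^bsub>sym_group\<^esub> inv\<^bsub>sym_group\<^esub> f = h"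
proof -
  have "f \<circ> inv\<^bsub>sym_group\<^esub> f = id" using Sym.r_inv[of f] assms(1) by simp
  then have "(h \<circ> f) \<circ> inv\<^bsub>sym_group\<^esub> f = h" by (simp only: comp_assoc comp_id)
  then show ?thesis using assms(2) by simp
qed

text \<open>A configuration together with the sheet on which it lies. The first set of the sheet
  says which configurations count as accepted there; the true acceptance set is only one of the
  possibilities.\<close>

type_synonym sheeted = "nat_perm \<times> (nat_perm set \<times> nat_perm set)"

definition accepted :: "nat_perm set" where "accepted = {g. Perm.acc g}"

definition inside :: "sheeted \<Rightarrow> bool" where "inside c \<longleftrightarrow> fst c \<in> fst (snd c)"

definition lift :: "(sheeted \<Rightarrow> sheeted) \<Rightarrow> sheeted \<times> nat \<Rightarrow> sheeted \<times> nat" where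
  "lift f = map_prod f id"

lemma bij_lift: "bij f \<Longrightarrow> bij (lift f)"
  unfolding lift_def using bij_betw_map_prod[of f UNIV UNIV id UNIV UNIV] by simp

lemma lift_comp: "lift f \<circ> lift g = lift (f \<circ> g)"
  by (auto simp: lift_def)

definition translate :: "nat_perm \<Rightarrow> sheeted \<times> nat \<Rightarrow> sheeted \<times> nat" where
  "translate g = lift (act perm_group g)"

lemma translate_mult: "translate (g \<otimes>\<^bsub>perm_group\<^esub> h) = translate g \<circ> translate h"
  by (auto simp: translate_def lift_def act_def Perm.m_assoc)

lemma translate_one: "translate \<one>\<^bsub>perm_group\<^esub> = id"
  by (auto simp: translate_def lift_def act_def)

lemma bij_translate: "bij (translate g)"
proof (rule o_bij)
  show "translate (inv\<^bsub>perm_group\<^esub> g) \<circ> translate g = id" "translate g \<circ> translate (inv\<^bsub>perm_group\<^esub> g) = id"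
    by (simp_all flip: translate_mult translate_one)
qed

interpretation translate: group_hom perm_group sym_group translate
  by (intro group_hom.intro group_hom_axioms.intro group_perm_group group_sym_group)
    (simp add: hom_def bij_translate translate_mult)

lemma ex_shift:
  "\<exists>x. bij x \<and> (\<forall>g. x \<circ> act perm_group g = act perm_group (half b g) \<circ> (x :: sheeted \<Rightarrow> sheeted))"
proof -
  have "half b \<in> hom perm_group perm_group" using Perm.h0.homh Perm.h1.homh by (cases b) auto
  moreover have "inj (half b)"
  proof (rule injI)
    fix x y assume eq: "half b x = half b y"
    have "app x n = app y n" for n
    proof -
      have "app (half b x) (2 * n + of_bool b) = app (half b y) (2 * n + of_bool b)" using eq by simp
      then show ?thesis by (cases b) auto
    qed
    then show "x = y" by (rule nat_perm_eqI)
  qed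
  ultimately show ?thesis
    \<comment> \<open>With empty \<open>T\<close> the colour condition holds trivially; what is
      wanted here is the equivariance.\<close>
    using extend_partial_isomorphism[of perm_group perm_group "\<lambda>g. g" "half b" "\<one>\<^bsub>perm_group\<^esub>" "{}" "\<one>\<^bsub>perm_group\<^esub>"]
    by (auto simp: group_perm_group infinite_nat_perm hom_def fun_eq_iff)
qed

lemma ex_rule:
  assumes lr: "(l, r) \<in> set rules"
  shows "\<exists>x. bij x \<and> (\<forall>s. (\<forall>v. v \<notin> vars l \<longrightarrow> s v = \<one>\<^bsub>perm_group\<^esub>) \<longrightarrow> x \<circ> act perm_group (Perm.leaf_val l s) = act perm_group (Perm.leaf_val r s) \<circ> x) \<and>
     x (Perm.tree_val l (\<lambda>_. \<one>\<^bsub>perm_group\<^esub>), (accepted, {})) = (Perm.tree_val r (\<lambda>_. \<one>\<^bsub>perm_group\<^esub>), (accepted, {})) \<and>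
     (\<forall>c. inside (x c) \<longleftrightarrow> inside c)"
proof -
  \<comment> \<open>The power of \<open>perm_group\<close> with one factor for each variable. Being
    one outside \<open>vars l\<close> is what makes \<open>leaf_val\<close> injective on it.\<close>
  define K where "K = \<lparr>carrier = {s. \<forall>v. v \<notin> vars l \<longrightarrow> s v = \<one>\<^bsub>perm_group\<^esub>},
     mult = (\<lambda>s t i. s i \<otimes>\<^bsub>perm_group\<^esub> t i), one = (\<lambda>_ :: nat. \<one>\<^bsub>perm_group\<^esub>)\<rparr>"
  have K: "group K"
  proof (rule groupI)
    fix s assume "s \<in> carrier K"
    then show "\<exists>t\<in>carrier K. t \<otimes>\<^bsub>K\<^esub> s = \<one>\<^bsub>K\<^esub>"
      by (intro bexI[of _ "\<lambda>i. inv\<^bsub>perm_group\<^esub> s i"]) (auto simp: K_def)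
  qed (auto simp: K_def Perm.m_assoc)
  have hom: "Perm.leaf_val p \<in> hom K perm_group" for p
    by (simp add: hom_def K_def Perm.leaf_val_mult)
  have inj: "inj_on (Perm.leaf_val p) (carrier K)" if "vars p = vars l" for p
  proof (rule inj_onI)
    fix s t assume st: "s \<in> carrier K" "t \<in> carrier K" "Perm.leaf_val p s = Perm.leaf_val p t"
    show "s = t"
    proof
      fix i
      show "s i = t i"
        using st that Perm.leaf_val_inj[OF st(3), of i] by (cases "i \<in> vars l") (auto simp: K_def)
    qed
  qed
  have vr: "vars r = vars l" by (rule rules_vars[OF lr])
  \<comment> \<open>The two base points have the same colouring exactly because acceptance is
    invariant under the rule.\<close>
  have T: "Perm.leaf_val l k \<otimes>\<^bsub>perm_group\<^esub> Perm.tree_val l (\<lambda>_. \<one>\<^bsub>perm_group\<^esub>) \<in> accepted \<longleftrightarrow> Perm.leaf_val r k \<otimes>\<^bsub>perm_group\<^esub> Perm.tree_val r (\<lambda>_. \<one>\<^bsub>perm_group\<^esub>) \<in> accepted" for k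
    using Perm.acc_rule_iff[OF lr, of k] Perm.tree_val_leaf_val[of k l] Perm.tree_val_leaf_val[of k r] by (simp add: accepted_def)
  show ?thesis
    using extend_partial_isomorphism[OF group_perm_group carrier_perm_group infinite_nat_perm K hom hom inj[OF refl] inj[OF vr] T]
    unfolding inside_def fun_eq_iff comp_def K_def by simp
qed

definition shifter :: "bool \<Rightarrow> sheeted \<Rightarrow> sheeted" where
  "shifter b = (SOME x. bij x \<and> (\<forall>g. x \<circ> act perm_group g = act perm_group (half b g) \<circ> x))"

lemma shifter: "bij (shifter b)" "shifter b \<circ> act perm_group g = act perm_group (half b g) \<circ> shifter b"
  using someI_ex[OF ex_shift[of b]] unfolding shifter_def by blast+

definition is_ruler :: "tm \<Rightarrow> tm \<Rightarrow> (sheeted \<Rightarrow> sheeted) \<Rightarrow> bool" where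
  "is_ruler l r x \<longleftrightarrow> bij x \<and>
     (\<forall>s. (\<forall>v. v \<notin> vars l \<longrightarrow> s v = \<one>\<^bsub>perm_group\<^esub>) \<longrightarrow> x \<circ> act perm_group (Perm.leaf_val l s) = act perm_group (Perm.leaf_val r s) \<circ> x) \<and>
     x (Perm.tree_val l (\<lambda>_. \<one>\<^bsub>perm_group\<^esub>), (accepted, {})) = (Perm.tree_val r (\<lambda>_. \<one>\<^bsub>perm_group\<^esub>), (accepted, {})) \<and>
     (\<forall>c. inside (x c) \<longleftrightarrow> inside c)"

definition ruler :: "nat \<Rightarrow> sheeted \<Rightarrow> sheeted" where
  "ruler i = (if i < length rules then SOME x. is_ruler (fst (rules ! i)) (snd (rules ! i)) x else id)"

lemma ruler: "i < length rules \<Longrightarrow> is_ruler (fst (rules ! i)) (snd (rules ! i)) (ruler i)"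
proof -
  assume i: "i < length rules"
  then have "(fst (rules ! i), snd (rules ! i)) \<in> set rules" by simp
  from ex_rule[OF this] have "\<exists>x. is_ruler (fst (rules ! i)) (snd (rules ! i)) x"
    unfolding is_ruler_def .
  from someI_ex[OF this] show ?thesis using i by (simp add: ruler_def)
qed

lemma bij_ruler: "bij (ruler i)"
  using ruler[of i] by (cases "i < length rules") (auto simp: is_ruler_def ruler_def)

text \<open>The token exchanges levels 0 and 1 over one point, \<open>detect\<close> exchanges
  levels 1 and 2 over all points that are not \<open>inside\<close>. Where both act they share level
  1, so they do not commute.\<close>

definition swap_at :: "nat_perm \<Rightarrow> sheeted \<times> nat \<Rightarrow> sheeted \<times> nat" where
  "swap_at g = Transposition.transpose ((g, (accepted, {})), 0) ((g, (accepted, {})), 1)"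

definition detect :: "sheeted \<times> nat \<Rightarrow> sheeted \<times> nat" where
  "detect x = (if inside (fst x) then x else (fst x, Transposition.transpose 1 2 (snd x)))"

lemma bij_detect: "bij detect"
proof -
  have "detect \<circ> detect = id" by (auto simp: detect_def)
  then show ?thesis using o_bij by blast
qed

definition model :: "nat \<Rightarrow> sheeted \<times> nat \<Rightarrow> sheeted \<times> nat" where
  "model i = (if i = 0 then translate rot else if i = 1 then translate flip
     else if i = 2 then lift (shifter False) else if i = 3 then lift (shifter True)
     else if i = 4 then swap_at \<one>\<^bsub>perm_group\<^esub> else if i = 5 then detect else lift (ruler (i - 6)))"

lemma model_simps [simp]:
  "model 0 = translate rot" "model (Suc 0) = translate flip" "model 2 = lift (shifter False)"
  "model 3 = lift (shifter True)" "model 4 = swap_at \<one>\<^bsub>perm_group\<^esub>" "model 5 = detect"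
  "model (6 + i) = lift (ruler i)"
  by (simp_all add: model_def)

lemma bij_model: "bij (model i)"
  by (simp add: model_def bij_translate bij_lift shifter bij_ruler bij_detect swap_at_def bij_swap)

lemma model_closed: "model i \<in> carrier sym_group"
  using bij_model by simp

abbreviation "model_eval \<equiv> geval sym_group model"

lemma shift_translate: "lift (shifter b) \<circ> translate g = translate (half b g) \<circ> lift (shifter b)"
  by (simp add: translate_def lift_comp shifter(2))

lemma model_eval_shift:
  assumes "model_eval u = translate g"
  shows "model_eval (cj gX u) = translate (half False g)" "model_eval (cj gY u) = translate (half True g)"
  unfolding geval_cj assms geval.simps model_simps
  by (rule sym_conj[OF bij_lift[OF shifter(1)] shift_translate])+

lemma model_eval_cj:
  "model_eval c = translate x \<Longrightarrow> model_eval u = translate g \<Longrightarrow> model_eval (cj c u) = translate (x \<otimes>\<^bsub>perm_group\<^esub> g \<otimes>\<^bsub>perm_group\<^esub> inv\<^bsub>perm_group\<^esub> x)"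
  by (simp only: geval_cj translate.hom_mult translate.hom_inv carrier_perm_group UNIV_I Perm.m_closed Perm.inv_closed)

lemma model_eval_tree_exp: "(\<And>i. model_eval (s i) = translate (s' i)) \<Longrightarrow> model_eval (tree_exp p s) = translate (Perm.tree_val p s')"
  by (induction p) (simp_all add: model_eval_shift translate_mult translate_one del: geval_cj)

lemma model_eval_leaf_exp: "(\<And>i. model_eval (s i) = translate (s' i)) \<Longrightarrow> model_eval (leaf_exp p s) = translate (Perm.leaf_val p s')"
  by (induction p) (simp_all add: model_eval_shift translate_mult translate_one del: geval_cj)

lemma model_eval_tok: "model_eval (tok p) = swap_at (Perm.tree_val p (\<lambda>_. \<one>\<^bsub>perm_group\<^esub>))"
proof -
  have "model_eval (tree_exp p (\<lambda>_. One)) = translate (Perm.tree_val p (\<lambda>_. \<one>\<^bsub>perm_group\<^esub>))"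
    by (rule model_eval_tree_exp) (simp add: translate_one)
  moreover have "translate g \<circ> swap_at \<one>\<^bsub>perm_group\<^esub> = swap_at g \<circ> translate g" for g
    unfolding swap_at_def comp_transpose[OF bij_is_inj[OF bij_translate]]
    by (simp add: translate_def lift_def act_def)
  ultimately show ?thesis
    unfolding tok_def geval_cj geval.simps model_simps by (simp only: sym_conj[OF bij_translate])
qed

lemma model_eval_sgens: "s \<in> sgens \<Longrightarrow> \<exists>g. model_eval s = translate g"
  using model_eval_shift[of gA rot] model_eval_shift[of gB flip] by (auto simp: sgens_def simp del: geval_cj)

lemma model_tree_eqs:
  assumes "e \<in> tree_eqs"
  shows "holds sym_group model e"
proof -
  have "holds sym_group model (cj gX (cj gX s), cj (Inv gA) (cj gX s))"
    "holds sym_group model (cj gY (cj gY s), cj gA (cj gY s))"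
    "holds sym_group model (cj gY (cj gX s), cj gB (cj gX (cj gX s)))"
    "holds sym_group model (cj gX (cj gY s), cj gB (cj gY (cj gY s)))"
    if s: "model_eval s = translate g" for s g
  proof -
    have inv: "model_eval (Inv gA) = translate (inv\<^bsub>perm_group\<^esub> rot)" by simp
    have A: "model_eval gA = translate rot" "model_eval gB = translate flip" by simp_all
    note sh = model_eval_shift[OF s] and sh2 = model_eval_shift[OF model_eval_shift(1)[OF s]] model_eval_shift[OF model_eval_shift(2)[OF s]]
    show "holds sym_group model (cj gX (cj gX s), cj (Inv gA) (cj gX s))"
      unfolding holds_def fst_conv snd_conv sh2 model_eval_cj[OF inv sh(1)] half_half(1) by simp
    show "holds sym_group model (cj gY (cj gY s), cj gA (cj gY s))"
      unfolding holds_def fst_conv snd_conv sh2 model_eval_cj[OF A(1) sh(2)] half_half(2) ..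
    show "holds sym_group model (cj gY (cj gX s), cj gB (cj gX (cj gX s)))"
      unfolding holds_def fst_conv snd_conv sh2 model_eval_cj[OF A(2) sh2(1)] half_half(3) inv_flip ..
    show "holds sym_group model (cj gX (cj gY s), cj gB (cj gY (cj gY s)))"
      unfolding holds_def fst_conv snd_conv sh2 model_eval_cj[OF A(2) sh2(4)] half_half(4) inv_flip ..
  qed
  moreover have "holds sym_group model (commutes (cj gX s) (cj gY s'))" if ss: "s \<in> sgens" "s' \<in> sgens" for s s'
  proof -
    obtain g h where gh: "model_eval s = translate g" "model_eval s' = translate h"
      using model_eval_sgens[OF ss(1)] model_eval_sgens[OF ss(2)] by blast
    have "half False g \<otimes>\<^bsub>perm_group\<^esub> half True h = half True h \<otimes>\<^bsub>perm_group\<^esub> half False g"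
      by (rule Perm.comm) simp_all
    from arg_cong[OF this, of translate] show ?thesis
      unfolding holds_commutes model_eval_shift(1)[OF gh(1)] model_eval_shift(2)[OF gh(2)]
      by (simp only: translate_mult sym_group_simps)
  qed
  moreover have "model_eval gA = translate rot" "model_eval gB = translate flip" by simp_all
  ultimately show ?thesis
    using assms unfolding tree_eqs_def by blast
qed

lemma detect_lift: "(\<And>c. inside (f c) \<longleftrightarrow> inside c) \<Longrightarrow> detect \<circ> lift f = lift f \<circ> detect"
  by (auto simp: fun_eq_iff detect_def lift_def)

lemma model_rule_eqs:
  assumes i: "i < length rules" "rules ! i = (l, r)" and e: "e \<in> rule_eqs i l r"
  shows "holds sym_group model e"
proof -
  have R: "is_ruler l r (ruler i)" using ruler[OF i(1)] i(2) by simp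
  have "holds sym_group model (commutes gK (gR i))"
  proof -
    have "detect \<circ> lift (ruler i) = lift (ruler i) \<circ> detect"
      by (rule detect_lift) (use R in \<open>unfold is_ruler_def, blast\<close>)
    then show ?thesis by (simp add: holds_commutes)
  qed
  moreover have "holds sym_group model (Mul (gR i) (tok l), Mul (tok r) (gR i))"
  proof -
    have "lift (ruler i) \<circ> swap_at (Perm.tree_val l (\<lambda>_. \<one>\<^bsub>perm_group\<^esub>)) = swap_at (Perm.tree_val r (\<lambda>_. \<one>\<^bsub>perm_group\<^esub>)) \<circ> lift (ruler i)"
      unfolding swap_at_def comp_transpose[OF bij_is_inj[OF bij_lift[OF bij_ruler]]]
      using R by (simp add: is_ruler_def lift_def)
    then show ?thesis by (simp add: holds_def model_eval_tok)
  qed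
  moreover have "holds sym_group model (Mul (gR i) (leaf_exp l ((\<lambda>_. One)(v := s))), Mul (leaf_exp r ((\<lambda>_. One)(v := s))) (gR i))"
    if vs: "v \<in> vars l" "s \<in> sgens" for v s
  proof -
    obtain g where g: "model_eval s = translate g" using model_eval_sgens[OF vs(2)] by blast
    have "model_eval (leaf_exp p ((\<lambda>_. One)(v := s))) = translate (Perm.leaf_val p ((\<lambda>_. \<one>\<^bsub>perm_group\<^esub>)(v := g)))" for p
      by (rule model_eval_leaf_exp) (simp add: g translate_one)
    moreover have "ruler i \<circ> act perm_group (Perm.leaf_val l ((\<lambda>_. \<one>\<^bsub>perm_group\<^esub>)(v := g)))
        = act perm_group (Perm.leaf_val r ((\<lambda>_. \<one>\<^bsub>perm_group\<^esub>)(v := g))) \<circ> ruler i"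
    proof -
      have "\<forall>w. w \<notin> vars l \<longrightarrow> ((\<lambda>_. \<one>\<^bsub>perm_group\<^esub>)(v := g)) w = \<one>\<^bsub>perm_group\<^esub>" using vs by auto
      then show ?thesis using R unfolding is_ruler_def by blast
    qed
    ultimately show ?thesis by (simp add: holds_def translate_def lift_comp)
  qed
  ultimately show ?thesis using e unfolding rule_eqs_def by blast
qed

lemma detect_swap_at: "detect \<circ> swap_at g = swap_at g \<circ> detect \<longleftrightarrow> Perm.acc g"
proof
  assume "Perm.acc g"
  then have "detect ((g, (accepted, {})), j) = ((g, (accepted, {})), j)" for j
    by (simp add: detect_def inside_def accepted_def)
  then show "detect \<circ> swap_at g = swap_at g \<circ> detect"
    unfolding swap_at_def comp_transpose[OF bij_is_inj[OF bij_detect]] by simp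
next
  assume eq: "detect \<circ> swap_at g = swap_at g \<circ> detect"
  show "Perm.acc g"
  proof (rule ccontr)
    assume "\<not> Perm.acc g"
    then have out: "\<not> inside (g, (accepted, {}))" by (simp add: inside_def accepted_def)
    have "(detect \<circ> swap_at g) ((g, (accepted, {})), 0) = ((g, (accepted, {})), 2)"
      using out by (simp add: swap_at_def detect_def)
    moreover have "(swap_at g \<circ> detect) ((g, (accepted, {})), 0) = ((g, (accepted, {})), 1)"
      using out by (simp add: swap_at_def detect_def)
    ultimately show False using eq by simp
  qed
qed

theorem model_system: "e \<in> system \<Longrightarrow> holds sym_group model e"
  unfolding system_def
proof (elim UnE)
  assume "e \<in> (\<Union>i<length rules. rule_eqs i (fst (rules ! i)) (snd (rules ! i)))"
  then obtain i where i: "i < length rules" "e \<in> rule_eqs i (fst (rules ! i)) (snd (rules ! i))" by blast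
  show ?thesis by (rule model_rule_eqs[OF i(1) _ i(2)]) simp
next
  assume "e \<in> {commutes gK (tok accept)}"
  then show ?thesis by (simp add: holds_commutes model_eval_tok detect_swap_at Perm.acc_accept)
qed (rule model_tree_eqs)

theorem model_diseq: "\<not> holds sym_group model diseq"
  using Perm.not_acc_reject by (simp add: diseq_def holds_commutes model_eval_tok detect_swap_at)

section \<open>Computable functions\<close>

text \<open>Values on lists of other lengths are left open, so \<open>xs ! i\<close> may be written
  for \<open>i < k\<close> without a default.\<close>

definition computable :: "nat \<Rightarrow> (nat list \<Rightarrow> nat) \<Rightarrow> bool" where
  "computable k g \<longleftrightarrow> (\<exists>f. \<forall>xs. length xs = k \<longrightarrow> computes f xs (g xs))"

lemma computable_cong: "(\<And>xs. length xs = k \<Longrightarrow> g xs = h xs) \<Longrightarrow> computable k g \<longleftrightarrow> computable k h"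
  by (simp add: computable_def)

lemma computable_const: "computable k (\<lambda>_. c)"
proof (induction c)
  case 0
  show ?case unfolding computable_def using computes.Zero by blast
next
  case (Suc c)
  then obtain f where "\<And>xs. length xs = k \<Longrightarrow> computes f xs c" by (auto simp: computable_def)
  then have "computes (Comp Succ [f]) xs (Suc c)" if "length xs = k" for xs
    using that by (intro computes.Comp[of xs _ "[c]"]) (auto intro: computes.Succ)
  then show ?case unfolding computable_def by blast
qed

lemma computable_nth: "i < k \<Longrightarrow> computable k (\<lambda>xs. xs ! i)"
  unfolding computable_def using computes.Proj by metis

lemma computable_comp:
  assumes "computable (length gs) h" "\<And>g. g \<in> set gs \<Longrightarrow> computable k g"
  shows "computable k (\<lambda>xs. h (map (\<lambda>g. g xs) gs))"
proof -
  obtain f where f: "\<And>ys. length ys = length gs \<Longrightarrow> computes f ys (h ys)"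
    using assms(1) by (auto simp: computable_def)
  have "\<exists>fs. \<forall>xs. length xs = k \<longrightarrow> list_all2 (\<lambda>g y. computes g xs y) fs (map (\<lambda>g. g xs) gs)"
    using assms(2)
  proof (induction gs)
    case (Cons g gs)
    then obtain fs where fs: "\<And>xs. length xs = k \<Longrightarrow> list_all2 (\<lambda>g y. computes g xs y) fs (map (\<lambda>g. g xs) gs)"
      by auto
    obtain f where f: "\<And>xs. length xs = k \<Longrightarrow> computes f xs (g xs)"
      using Cons.prems[of g] by (auto simp: computable_def)
    then show ?case using fs by (intro exI[of _ "f # fs"]) simp
  qed auto
  then obtain fs where "\<And>xs. length xs = k \<Longrightarrow> list_all2 (\<lambda>g y. computes g xs y) fs (map (\<lambda>g. g xs) gs)"
    by blast
  then have "computes (Comp f fs) xs (h (map (\<lambda>g. g xs) gs))" if "length xs = k" for xs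
    using that f by (intro computes.Comp) auto
  then show ?thesis unfolding computable_def by blast
qed

lemma computable_comp1:
  assumes "computable 1 (\<lambda>xs. h (xs ! 0))" "computable k a"
  shows "computable k (\<lambda>xs. h (a xs))"
  using computable_comp[of "[a]" "\<lambda>xs. h (xs ! 0)" k] assms by simp

lemma computable_comp2:
  assumes "computable 2 (\<lambda>xs. h (xs ! 0) (xs ! 1))" "computable k a" "computable k b"
  shows "computable k (\<lambda>xs. h (a xs) (b xs))"
  using computable_comp[of "[a, b]" "\<lambda>xs. h (xs ! 0) (xs ! 1)" k] assms by (auto simp: numeral_2_eq_2)

lemma computable_comp3:
  assumes "computable 3 (\<lambda>xs. h (xs ! 0) (xs ! 1) (xs ! 2))" "computable k a" "computable k b" "computable k c"
  shows "computable k (\<lambda>xs. h (a xs) (b xs) (c xs))"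
  using computable_comp[of "[a, b, c]" "\<lambda>xs. h (xs ! 0) (xs ! 1) (xs ! 2)" k] assms
  by (auto simp: numeral_3_eq_3 numeral_2_eq_2)

lemma computable_drop:
  assumes "computable k g"
  shows "computable (j + k) (\<lambda>xs. g (drop j xs))"
proof -
  have "computable (j + k) (\<lambda>xs. g (map (\<lambda>g. g xs) (map (\<lambda>i xs. xs ! (j + i)) [0..<k])))"
    by (rule computable_comp) (use assms in \<open>auto intro: computable_nth\<close>)
  moreover have "map (\<lambda>g. g xs) (map (\<lambda>i xs. xs ! (j + i)) [0..<k]) = drop j xs"
    if "length xs = j + k" for xs :: "nat list"
    using that by (intro nth_equalityI) auto
  ultimately show ?thesis by (simp cong: computable_cong)
qed

text \<open>The recursion depth is itself computed from the parameters, whereas \<open>Prec\<close>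
  expects it as an extra first argument; composition with \<open>c\<close> and all projections
  bridges the gap.\<close>

lemma computable_rec:
  assumes c: "computable k c" and b: "computable k b" and s: "computable (Suc (Suc k)) s"
  shows "computable k (\<lambda>xs. rec_nat (b xs) (\<lambda>n y. s (n # y # xs)) (c xs))"
proof -
  obtain fb fs where fb: "\<And>xs. length xs = k \<Longrightarrow> computes fb xs (b xs)"
    and fs: "\<And>xs. length xs = Suc (Suc k) \<Longrightarrow> computes fs xs (s xs)"
    using b s by (auto simp: computable_def)
  let ?R = "\<lambda>xs n. rec_nat (b xs) (\<lambda>n y. s (n # y # xs)) n"
  have "computes (Prec fb fs) (n # xs) (?R xs n)" if "length xs = k" for n xs
    using that
  proof (induction n)
    case (Suc n)
    then show ?case using fs[of "n # ?R xs n # xs"] by (auto intro: computes.Prec_Suc)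
  qed (auto intro: computes.Prec_0 fb)
  then have "computable (Suc k) (\<lambda>xs. ?R (tl xs) (hd xs))"
    unfolding computable_def by (intro exI[of _ "Prec fb fs"]) (auto simp: length_Suc_conv)
  moreover have "computable k g" if "g \<in> set (c # map (\<lambda>i xs. xs ! i) [0..<k])" for g
    using that c by (auto intro: computable_nth)
  ultimately have "computable k (\<lambda>xs. ?R (map (\<lambda>g. g xs) (map (\<lambda>i xs. xs ! i) [0..<k])) (c xs))"
    using computable_comp[of "c # map (\<lambda>i xs. xs ! i) [0..<k]" "\<lambda>xs. ?R (tl xs) (hd xs)" k] by simp
  moreover have "map (\<lambda>g. g xs) (map (\<lambda>i xs. xs ! i) [0..<k]) = xs" if "length xs = k" for xs :: "nat list"
    using that by (intro nth_equalityI) auto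
  ultimately show ?thesis by (simp cong: computable_cong)
qed

lemma computable_least:
  assumes g: "computable (Suc k) g" and ex: "\<And>xs. length xs = k \<Longrightarrow> \<exists>n. g (n # xs) = 0"
  shows "computable k (\<lambda>xs. LEAST n. g (n # xs) = 0)"
proof -
  obtain f where f: "\<And>xs. length xs = Suc k \<Longrightarrow> computes f xs (g xs)"
    using g by (auto simp: computable_def)
  have "computes (Mn f) xs (LEAST n. g (n # xs) = 0)" if xs: "length xs = k" for xs
  proof (rule computes.Mn)
    have "g ((LEAST n. g (n # xs) = 0) # xs) = 0" by (rule LeastI_ex[OF ex[OF xs]])
    then show "computes f ((LEAST n. g (n # xs) = 0) # xs) 0"
      using f[of "(LEAST n. g (n # xs) = 0) # xs"] xs by simp
    fix i assume "i < (LEAST n. g (n # xs) = 0)"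
    then have "g (i # xs) \<noteq> 0" by (rule not_less_Least)
    then show "\<exists>y. computes f (i # xs) (Suc y)"
      using f[of "i # xs"] xs by (cases "g (i # xs)") auto
  qed
  then show ?thesis unfolding computable_def by blast
qed

lemma computable_Suc:
  assumes "computable k a"
  shows "computable k (\<lambda>xs. Suc (a xs))"
proof (rule computable_comp1[OF _ assms])
  have "computes Succ xs (Suc (xs ! 0))" if "length xs = 1" for xs
    using that by (auto simp: length_Suc_conv intro: computes.Succ)
  then show "computable 1 (\<lambda>xs. Suc (xs ! 0))" unfolding computable_def by blast
qed

lemma computable_add:
  assumes "computable k a" "computable k b"
  shows "computable k (\<lambda>xs. a xs + b xs)"
proof -
  have "computable k (\<lambda>xs. rec_nat (b xs) (\<lambda>n y. Suc ((n # y # xs) ! 1)) (a xs))"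
    by (intro computable_rec assms computable_Suc computable_nth) simp
  moreover have "rec_nat (b xs) (\<lambda>n y. Suc ((n # y # xs) ! 1)) n = n + b xs" for xs n
    by (induction n) auto
  ultimately show ?thesis by simp
qed

lemma computable_pred:
  assumes "computable k a"
  shows "computable k (\<lambda>xs. a xs - 1)"
proof -
  have "computable k (\<lambda>xs. rec_nat 0 (\<lambda>n y. (n # y # xs) ! 0) (a xs))"
    by (intro computable_rec assms computable_const computable_nth) simp
  moreover have "rec_nat 0 (\<lambda>n y. (n # y # xs) ! 0) n = n - 1" for xs n
    by (cases n) auto
  ultimately show ?thesis by simp
qed

lemma computable_diff:
  assumes "computable k a" "computable k b"
  shows "computable k (\<lambda>xs. a xs - b xs)"
proof -
  have "computable k (\<lambda>xs. rec_nat (a xs) (\<lambda>n y. (n # y # xs) ! 1 - 1) (b xs))"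
    by (intro computable_rec assms computable_pred computable_nth) simp
  moreover have "rec_nat (a xs) (\<lambda>n y. (n # y # xs) ! 1 - 1) n = a xs - n" for xs n
    by (induction n) auto
  ultimately show ?thesis by simp
qed

lemma computable_if:
  assumes "computable k c" "computable k a" "computable k b"
  shows "computable k (\<lambda>xs. if c xs = 0 then a xs else b xs)"
proof -
  have "computable k (\<lambda>xs. rec_nat (a xs) (\<lambda>n y. b (drop 2 (n # y # xs))) (c xs))"
    by (intro computable_rec assms) (use computable_drop[OF assms(3), of 2] in simp)
  moreover have "rec_nat (a xs) (\<lambda>n y. b (drop 2 (n # y # xs))) n = (if n = 0 then a xs else b xs)" for xs n
    by (cases n) auto
  ultimately show ?thesis by simp
qed

lemma computable_if_eq:
  assumes "computable k c" "computable k d" "computable k a" "computable k b"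
  shows "computable k (\<lambda>xs. if c xs = d xs then a xs else b xs)"
proof -
  have "computable k (\<lambda>xs. if (c xs - d xs) + (d xs - c xs) = 0 then a xs else b xs)"
    by (intro computable_if computable_add computable_diff assms)
  moreover have "(c - d) + (d - c) = 0 \<longleftrightarrow> c = d" for c d :: nat by auto
  ultimately show ?thesis by simp
qed

section \<open>Pairing and list codes\<close>

lemma computable_triangle:
  assumes "computable k a"
  shows "computable k (\<lambda>xs. triangle (a xs))"
proof -
  have "computable k (\<lambda>xs. rec_nat 0 (\<lambda>n y. (n # y # xs) ! 1 + Suc ((n # y # xs) ! 0)) (a xs))"
    by (intro computable_rec assms computable_add computable_Suc computable_const computable_nth) simp_all
  moreover have "rec_nat 0 (\<lambda>n y. (n # y # xs) ! 1 + Suc ((n # y # xs) ! 0)) n = triangle n" for xs n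
    by (induction n) auto
  ultimately show ?thesis by simp
qed

lemma computable_prod_encode:
  assumes "computable k a" "computable k b"
  shows "computable k (\<lambda>xs. prod_encode (a xs, b xs))"
  unfolding prod_encode_def by (simp, intro computable_add computable_triangle assms)

text \<open>As \<open>prod_encode (m, n) = triangle (m + n) + m\<close>, this finds the sum
  \<open>m + n\<close>. The truncated difference expresses \<open>x < triangle (Suc s)\<close> as a
  zero, the form required for minimization.\<close>

definition diagonal :: "nat \<Rightarrow> nat" where
  "diagonal x = (LEAST s. Suc x - triangle (Suc s) = 0)"

lemma diagonal_prod_encode: "diagonal (prod_encode (m, n)) = m + n"
  unfolding diagonal_def
proof (rule Least_equality)
  show "Suc (prod_encode (m, n)) - triangle (Suc (m + n)) = 0" by (simp add: prod_encode_def)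
next
  fix s assume s: "Suc (prod_encode (m, n)) - triangle (Suc s) = 0"
  have mono: "triangle i \<le> triangle j" if "i \<le> j" for i j
    using that by (induction j) (auto simp: le_Suc_eq)
  show "m + n \<le> s"
  proof (rule ccontr)
    assume "\<not> m + n \<le> s"
    then have "triangle (Suc s) \<le> triangle (m + n)" by (intro mono) simp
    then show False using s by (simp add: prod_encode_def)
  qed
qed

lemma prod_decode_diagonal:
  "fst (prod_decode x) = x - triangle (diagonal x)"
  "snd (prod_decode x) = diagonal x - (x - triangle (diagonal x))"
proof -
  obtain m n where "prod_decode x = (m, n)" by fastforce
  then have x: "x = prod_encode (m, n)" by (metis prod_decode_inverse)
  have "x - triangle (diagonal x) = m"
    unfolding x diagonal_prod_encode by (simp add: prod_encode_def)
  then show "fst (prod_decode x) = x - triangle (diagonal x)"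
    "snd (prod_decode x) = diagonal x - (x - triangle (diagonal x))"
    using x diagonal_prod_encode by simp_all
qed

lemma computable_diagonal:
  assumes "computable k a"
  shows "computable k (\<lambda>xs. diagonal (a xs))"
proof (rule computable_comp1[OF _ assms])
  have "\<exists>n. Suc ((n # xs) ! 1) - triangle (Suc ((n # xs) ! 0)) = 0" for xs
    by (rule exI[of _ "xs ! 0"]) simp
  then have "computable 1 (\<lambda>xs. LEAST n. Suc ((n # xs) ! 1) - triangle (Suc ((n # xs) ! 0)) = 0)"
    by (intro computable_least computable_diff computable_Suc computable_triangle computable_nth) simp_all
  then show "computable 1 (\<lambda>xs. diagonal (xs ! 0))" by (simp add: diagonal_def)
qed

definition head_code :: "nat \<Rightarrow> nat" where "head_code z = fst (prod_decode (z - 1))"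
definition tail_code :: "nat \<Rightarrow> nat" where "tail_code z = snd (prod_decode (z - 1))"

lemma head_tail_code [simp]:
  "head_code (list_encode (x # xs)) = x" "tail_code (list_encode (x # xs)) = list_encode xs"
  "head_code 0 = 0" "tail_code 0 = 0"
proof -
  have "prod_decode 0 = (0, 0)" using prod_encode_inverse[of "(0, 0)"] by (simp add: prod_encode_def)
  then show "head_code 0 = 0" "tail_code 0 = 0" by (simp_all add: head_code_def tail_code_def)
qed (simp_all add: head_code_def tail_code_def)

lemma computable_head_code: "computable k a \<Longrightarrow> computable k (\<lambda>xs. head_code (a xs))"
  unfolding head_code_def prod_decode_diagonal
  by (intro computable_diff computable_triangle computable_diagonal computable_pred computable_const)

lemma computable_tail_code: "computable k a \<Longrightarrow> computable k (\<lambda>xs. tail_code (a xs))"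
  unfolding tail_code_def prod_decode_diagonal
  by (intro computable_diff computable_triangle computable_diagonal computable_pred computable_const)

text \<open>The empty word must be tested first: \<open>head_code 0\<close> is 0, which is also the
  code of the letter \<open>(0, False)\<close>.\<close>

definition cancel_code :: "letter \<Rightarrow> nat \<Rightarrow> nat" where
  "cancel_code x z = (if z = 0 then Suc (prod_encode (encode_letter x, 0))
     else if head_code z = encode_letter (inv_letter x) then tail_code z
     else Suc (prod_encode (encode_letter x, z)))"

lemma encode_letter_eq_iff: "encode_letter x = encode_letter y \<longleftrightarrow> x = y"
  using injD[OF inj_encode_fword, of "[x]" "[y]"] by (auto simp: encode_fword_def)

lemma encode_cancel_Cons: "encode_fword (cancel_Cons x w) = cancel_code x (encode_fword w)"
proof (cases w)
  case (Cons y v)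
  then have w: "encode_fword w = list_encode (encode_letter y # map encode_letter v)"
    by (simp add: encode_fword_def)
  then have "encode_fword w \<noteq> 0" by simp
  then show ?thesis
    unfolding cancel_code_def w head_tail_code encode_letter_eq_iff
    by (simp add: Cons encode_fword_def)
qed (simp add: encode_fword_def cancel_code_def)

lemma computable_cancel_code: "computable k a \<Longrightarrow> computable k (\<lambda>xs. cancel_code x (a xs))"
  unfolding cancel_code_def
  by (intro computable_if computable_if_eq computable_Suc computable_prod_encode computable_head_code
      computable_tail_code computable_const)

section \<open>Deciding membership along computable sequences of words\<close>

text \<open>Multiplication from the left modifies the head of a list code, so it is computable, and it can be
  iterated to multiply by an \<open>n\<close>-th power.\<close>

definition mult_computable :: "nat \<Rightarrow> (nat \<Rightarrow> fword) \<Rightarrow> bool" where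
  "mult_computable m g \<longleftrightarrow> (\<exists>\<phi>. computable 2 (\<lambda>xs. \<phi> (xs ! 0) (xs ! 1)) \<and>
     (\<forall>n. \<forall>w \<in> carrier (free_group m). \<phi> n (encode_fword w) = encode_fword (g n \<otimes>\<^bsub>free_group m\<^esub> w)))"

text \<open>Carrying the inverse sequence along makes the notion closed under inverses as well as
  products and powers.\<close>

definition tracked :: "nat \<Rightarrow> (nat \<Rightarrow> fword) \<Rightarrow> bool" where
  "tracked m g \<longleftrightarrow> (\<forall>n. g n \<in> carrier (free_group m)) \<and> mult_computable m g \<and>
     mult_computable m (\<lambda>n. inv\<^bsub>free_group m\<^esub> g n)"

lemma mult_computableI:
  assumes "computable 2 (\<lambda>xs. \<phi> (xs ! 0) (xs ! 1))"
    "\<And>n w. w \<in> carrier (free_group m) \<Longrightarrow> \<phi> n (encode_fword w) = encode_fword (g n \<otimes>\<^bsub>free_group m\<^esub> w)"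
  shows "mult_computable m g"
  using assms unfolding mult_computable_def by blast

lemma (in group) inv_cancel [simp]:
  assumes "x \<in> carrier G" "y \<in> carrier G"
  shows "inv x \<otimes> (x \<otimes> y) = y" "x \<otimes> (inv x \<otimes> y) = y"
  using assms by (simp_all flip: m_assoc)

lemma one_free_group: "\<one>\<^bsub>free_group m\<^esub> = []"
  by (simp add: free_group_def)

context
  fixes m :: nat
begin

interpretation F: group "free_group m" by (rule group_free_group)

abbreviation (input) "F \<equiv> free_group m"

lemma mult_computable_one: "mult_computable m (\<lambda>_. \<one>\<^bsub>F\<^esub>)"
  by (rule mult_computableI[of "\<lambda>n z. z"]) (simp_all add: computable_nth)

lemma mult_computable_letter: "fst x < m \<Longrightarrow> mult_computable m (\<lambda>_. [x])"
  by (rule mult_computableI[of "\<lambda>n z. cancel_code x z"])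
    (simp_all add: computable_cancel_code computable_nth encode_cancel_Cons free_group_def)

lemma mult_computable_mult:
  assumes "mult_computable m g" "mult_computable m h"
    "\<And>n. g n \<in> carrier F" "\<And>n. h n \<in> carrier F"
  shows "mult_computable m (\<lambda>n. g n \<otimes>\<^bsub>F\<^esub> h n)"
proof -
  obtain \<phi> \<psi> where
    \<phi>: "computable 2 (\<lambda>xs. \<phi> (xs ! 0) (xs ! 1))" "\<And>n w. w \<in> carrier F \<Longrightarrow> \<phi> n (encode_fword w) = encode_fword (g n \<otimes>\<^bsub>F\<^esub> w)"
    and \<psi>: "computable 2 (\<lambda>xs. \<psi> (xs ! 0) (xs ! 1))" "\<And>n w. w \<in> carrier F \<Longrightarrow> \<psi> n (encode_fword w) = encode_fword (h n \<otimes>\<^bsub>F\<^esub> w)"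
    using assms(1,2) unfolding mult_computable_def by blast
  show ?thesis
  proof (rule mult_computableI[of "\<lambda>n z. \<phi> n (\<psi> n z)"])
    show "computable 2 (\<lambda>xs. \<phi> (xs ! 0) (\<psi> (xs ! 0) (xs ! 1)))"
      by (intro computable_comp2[OF \<phi>(1)] \<psi>(1) computable_nth) simp
  qed (use assms in \<open>simp add: \<phi>(2) \<psi>(2) F.m_assoc\<close>)
qed

lemma mult_computable_pow:
  assumes "mult_computable m g" "\<And>n. g n \<in> carrier F"
  shows "mult_computable m (\<lambda>n. g n [^]\<^bsub>F\<^esub> n)"
proof -
  obtain \<phi> where
    \<phi>: "computable 2 (\<lambda>xs. \<phi> (xs ! 0) (xs ! 1))" "\<And>n w. w \<in> carrier F \<Longrightarrow> \<phi> n (encode_fword w) = encode_fword (g n \<otimes>\<^bsub>F\<^esub> w)"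
    using assms(1) unfolding mult_computable_def by blast
  have "encode_fword (g n [^]\<^bsub>F\<^esub> j \<otimes>\<^bsub>F\<^esub> w) = rec_nat (encode_fword w) (\<lambda>_. \<phi> n) j" if "w \<in> carrier F" for n j w
  proof (induction j)
    case (Suc j)
    have "g n [^]\<^bsub>F\<^esub> Suc j \<otimes>\<^bsub>F\<^esub> w = g n \<otimes>\<^bsub>F\<^esub> (g n [^]\<^bsub>F\<^esub> j \<otimes>\<^bsub>F\<^esub> w)"
      unfolding F.nat_pow_Suc2[OF assms(2)] using assms(2) that by (simp add: F.m_assoc)
    then show ?case using Suc assms(2) that \<phi>(2)[of "g n [^]\<^bsub>F\<^esub> j \<otimes>\<^bsub>F\<^esub> w" n] by simp
  qed (use that in simp)
  moreover have "computable 2 (\<lambda>xs. rec_nat (xs ! 1) (\<lambda>j y. \<phi> ((j # y # xs) ! 2) ((j # y # xs) ! 1)) (xs ! 0))"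
    by (intro computable_rec computable_nth computable_comp2[OF \<phi>(1)]) simp_all
  ultimately show ?thesis
    by (intro mult_computableI[of "\<lambda>n z. rec_nat z (\<lambda>_. \<phi> n) n"]) simp_all
qed

lemma tracked_closed: "tracked m g \<Longrightarrow> g n \<in> carrier F"
  by (simp add: tracked_def)

lemma tracked_inv: "tracked m g \<Longrightarrow> tracked m (\<lambda>n. inv\<^bsub>F\<^esub> g n)"
  by (simp add: tracked_def)

lemma tracked_mult: "tracked m g \<Longrightarrow> tracked m h \<Longrightarrow> tracked m (\<lambda>n. g n \<otimes>\<^bsub>F\<^esub> h n)"
  by (simp add: tracked_def F.inv_mult_group mult_computable_mult)

lemma tracked_pow: "tracked m g \<Longrightarrow> tracked m (\<lambda>n. g n [^]\<^bsub>F\<^esub> n)"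
  by (simp add: tracked_def mult_computable_pow flip: F.nat_pow_inv)

lemma inv_letter_word: "fst x < m \<Longrightarrow> inv\<^bsub>F\<^esub> [x] = [inv_letter x]"
  by (rule F.inv_equality) (simp_all add: free_group_def)

lemma Cons_mult: "x # w \<in> carrier F \<Longrightarrow> x # w = [x] \<otimes>\<^bsub>F\<^esub> w \<and> [x] \<in> carrier F \<and> w \<in> carrier F \<and> fst x < m"
  by (auto simp: free_group_def cancel_Cons_reduced dest: reduced_ConsD)

lemma tracked_const: "w \<in> carrier F \<Longrightarrow> tracked m (\<lambda>_. w)"
proof (induction w)
  case Nil
  show ?case
    unfolding one_free_group[of m, symmetric] by (simp add: tracked_def mult_computable_one)
next
  case (Cons x w)
  note x = Cons_mult[OF Cons.prems]
  have "tracked m (\<lambda>_. [x])"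
    using x by (simp add: tracked_def inv_letter_word mult_computable_letter)
  then have "tracked m (\<lambda>_. [x] \<otimes>\<^bsub>F\<^esub> w)" using Cons.IH x by (intro tracked_mult) auto
  then show ?case using x by simp
qed

lemma computable_tracked:
  assumes "tracked m g" "computable k a" "computable k b"
  shows "\<exists>\<phi>. computable k (\<lambda>xs. \<phi> (a xs) (b xs)) \<and>
    (\<forall>n. \<forall>w \<in> carrier F. \<phi> n (encode_fword w) = encode_fword (g n \<otimes>\<^bsub>F\<^esub> w))"
  using assms computable_comp2[OF _ assms(2,3)] unfolding tracked_def mult_computable_def by blast

lemma computable_encode_tracked:
  assumes "tracked m g" "computable k a"
  shows "computable k (\<lambda>xs. encode_fword (g (a xs)))"
proof -
  obtain \<phi> where "computable k (\<lambda>xs. \<phi> (a xs) (encode_fword \<one>\<^bsub>F\<^esub>))"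
    "\<And>n w. w \<in> carrier F \<Longrightarrow> \<phi> n (encode_fword w) = encode_fword (g n \<otimes>\<^bsub>F\<^esub> w)"
    using computable_tracked[OF assms computable_const, of "encode_fword \<one>\<^bsub>F\<^esub>"] by blast
  then show ?thesis using tracked_closed[OF assms(1)] by simp
qed

text \<open>Membership is decided along one sequence. This is all that the diagonal argument uses,
  and recursive as well as isolated \<open>N\<close> provide it for every tracked sequence.\<close>

definition decides :: "fword set \<Rightarrow> (nat \<Rightarrow> fword) \<Rightarrow> bool" where
  "decides N g \<longleftrightarrow> (\<exists>f. \<forall>n. computes f [n] (if g n \<in> N then 1 else 0))"

lemma decidesI:
  assumes "computable 1 (\<lambda>xs. if g (xs ! 0) \<in> N then 1 else 0)"
  shows "decides N g"
proof -
  obtain f where f: "\<And>xs. length xs = 1 \<Longrightarrow> computes f xs (if g (xs ! 0) \<in> N then 1 else 0)"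
    using assms unfolding computable_def by blast
  have "computes f [n] (if g n \<in> N then 1 else 0)" for n using f[of "[n]"] by simp
  then show ?thesis unfolding decides_def by blast
qed

lemma decides_recursive:
  assumes "recursive_set (encode_fword ` N)" "tracked m g"
  shows "decides N g"
proof (rule decidesI)
  obtain f where f: "\<And>n. computes f [n] (if n \<in> encode_fword ` N then 1 else 0)"
    using assms(1) unfolding recursive_set_def by blast
  have "computes f xs (if xs ! 0 \<in> encode_fword ` N then 1 else 0)" if "length xs = 1" for xs
    using that f by (cases xs) auto
  then have "computable 1 (\<lambda>xs. if xs ! 0 \<in> encode_fword ` N then 1 else 0)"
    unfolding computable_def by blast
  from computable_comp1[OF this computable_encode_tracked[OF assms(2) computable_nth[of 0 1]]]
  have "computable 1 (\<lambda>xs. if encode_fword (g (xs ! 0)) \<in> encode_fword ` N then 1 else 0)" by simp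
  then show "computable 1 (\<lambda>xs. if g (xs ! 0) \<in> N then 1 else 0)"
    by (simp add: inj_image_mem_iff[OF inj_encode_fword])
qed

section \<open>Sequences of left multiplications\<close>

definition lookup :: "(nat \<Rightarrow> fword) list \<Rightarrow> nat \<Rightarrow> nat \<Rightarrow> fword" where
  "lookup ops d = (if d < length ops then ops ! d else (\<lambda>_. \<one>\<^bsub>F\<^esub>))"

lemma lookup_closed: "(\<And>g. g \<in> set ops \<Longrightarrow> tracked m g) \<Longrightarrow> lookup ops d n \<in> carrier F"
  using tracked_closed by (auto simp: lookup_def)

lemma computable_lookup:
  assumes "\<And>g. g \<in> set ops \<Longrightarrow> tracked m g"
  shows "\<exists>\<phi>. computable 3 (\<lambda>xs. \<phi> (xs ! 0) (xs ! 1) (xs ! 2)) \<and>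
    (\<forall>d n. \<forall>w \<in> carrier F. \<phi> d n (encode_fword w) = encode_fword (lookup ops d n \<otimes>\<^bsub>F\<^esub> w))"
  using assms
proof (induction ops)
  case Nil
  show ?case
    by (rule exI[of _ "\<lambda>d n z. z"]) (simp add: lookup_def computable_nth)
next
  case (Cons g ops)
  obtain \<phi> where \<phi>: "computable 3 (\<lambda>xs. \<phi> (xs ! 0) (xs ! 1) (xs ! 2))"
    "\<And>d n w. w \<in> carrier F \<Longrightarrow> \<phi> d n (encode_fword w) = encode_fword (lookup ops d n \<otimes>\<^bsub>F\<^esub> w)"
    using Cons by auto
  have n: "computable 3 (\<lambda>xs. xs ! 1)" "computable 3 (\<lambda>xs. xs ! 2)" "computable 3 (\<lambda>xs. xs ! 0)"
    by (simp_all add: computable_nth)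
  obtain \<psi> where \<psi>: "computable 3 (\<lambda>xs. \<psi> (xs ! 1) (xs ! 2))"
    "\<And>n w. w \<in> carrier F \<Longrightarrow> \<psi> n (encode_fword w) = encode_fword (g n \<otimes>\<^bsub>F\<^esub> w)"
    using computable_tracked[OF _ n(1,2), of g] Cons.prems by auto
  have "computable 3 (\<lambda>xs. if xs ! 0 = 0 then \<psi> (xs ! 1) (xs ! 2) else \<phi> (xs ! 0 - 1) (xs ! 1) (xs ! 2))"
    by (intro computable_if \<psi> computable_comp3[OF \<phi>(1)] computable_pred n)
  moreover have "lookup (g # ops) d = (if d = 0 then g else lookup ops (d - 1))" for d
    by (cases d) (auto simp: lookup_def)
  ultimately show ?case
    by (intro exI[of _ "\<lambda>d n z. if d = 0 then \<psi> n z else \<phi> (d - 1) n z"]) (simp add: \<phi>(2) \<psi>(2))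
qed

text \<open>A number \<open>c\<close> is a certificate: it codes the list of operations to perform. Digits beyond the end
  of the list are \<open>0\<close>; therefore \<open>common_ops\<close> below starts with the identity.\<close>

primrec walk :: "(nat \<Rightarrow> fword) list \<Rightarrow> nat \<Rightarrow> (nat \<Rightarrow> nat) \<Rightarrow> nat \<Rightarrow> fword" where
  "walk ops n \<delta> 0 = \<one>\<^bsub>F\<^esub>"
| "walk ops n \<delta> (Suc i) = lookup ops (\<delta> i) n \<otimes>\<^bsub>F\<^esub> walk ops n \<delta> i"

definition digit :: "nat \<Rightarrow> nat \<Rightarrow> nat" where
  "digit c i = head_code ((tail_code ^^ i) c)"

lemma digit_list_encode: "digit (list_encode ds) i = (if i < length ds then ds ! i else 0)"
proof (induction i arbitrary: ds)
  case 0
  show ?case by (cases ds) (simp_all add: digit_def del: list_encode.simps(2))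
next
  case (Suc i)
  have "tail_code (list_encode ds) = list_encode (tl ds)" by (cases ds) (simp_all del: list_encode.simps(2))
  then have "digit (list_encode ds) (Suc i) = digit (list_encode (tl ds)) i"
    by (simp add: digit_def funpow_swap1)
  then show ?case unfolding Suc by (cases ds) simp_all
qed

lemma computable_digit:
  assumes "computable k a" "computable k b"
  shows "computable k (\<lambda>xs. digit (a xs) (b xs))"
proof -
  have "computable k (\<lambda>xs. rec_nat (a xs) (\<lambda>i y. tail_code ((i # y # xs) ! 1)) (b xs))"
    by (intro computable_rec computable_tail_code computable_nth assms) simp
  moreover have "rec_nat c (\<lambda>i y. tail_code ((i # y # xs) ! 1)) i = (tail_code ^^ i) c" for c i xs
    by (induction i) auto
  ultimately show ?thesis unfolding digit_def by (intro computable_head_code) simp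
qed

lemma walk_closed: "(\<And>g. g \<in> set ops \<Longrightarrow> tracked m g) \<Longrightarrow> walk ops n \<delta> i \<in> carrier F"
  by (induction i) (simp_all add: lookup_closed)

lemma computable_walk:
  assumes ops: "\<And>g. g \<in> set ops \<Longrightarrow> tracked m g" and s: "tracked m s"
  shows "computable 2 (\<lambda>xs. encode_fword (walk ops (xs ! 1) (digit (xs ! 0)) (xs ! 0) \<otimes>\<^bsub>F\<^esub> s (xs ! 1)))"
proof -
  obtain \<phi> where \<phi>: "computable 3 (\<lambda>xs. \<phi> (xs ! 0) (xs ! 1) (xs ! 2))"
    "\<And>d n w. w \<in> carrier F \<Longrightarrow> \<phi> d n (encode_fword w) = encode_fword (lookup ops d n \<otimes>\<^bsub>F\<^esub> w)"
    using computable_lookup[of ops] ops by auto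
  have "computable 2 (\<lambda>xs. rec_nat (encode_fword (s (xs ! 1)))
     (\<lambda>i y. \<phi> (digit ((i # y # xs) ! 2) ((i # y # xs) ! 0)) ((i # y # xs) ! 3) ((i # y # xs) ! 1)) (xs ! 0))"
    by (intro computable_rec computable_encode_tracked[OF s] computable_comp3[OF \<phi>(1)] computable_digit
        computable_nth) simp_all
  moreover have "rec_nat (encode_fword (s n)) (\<lambda>i y. \<phi> (digit c i) n y) j
      = encode_fword (walk ops n (digit c) j \<otimes>\<^bsub>F\<^esub> s n)" for n c j
    by (induction j) (simp_all add: \<phi>(2) tracked_closed[OF s] walk_closed ops lookup_closed F.m_assoc)
  ultimately show ?thesis by (simp add: eval_nat_numeral)
qed

text \<open>Letters act on both components and relators only on the first one, so a pair \<open>(p, q)\<close> with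
  \<open>p * u = q\<close> witnesses that \<open>u\<close> is in the normal closure of \<open>R\<close>. Working with pairs replaces the
  conjugation of words by multiplications from the left.\<close>

inductive_set moves :: "fword set \<Rightarrow> (fword \<times> fword) set" for R where
  one: "(\<one>\<^bsub>F\<^esub>, \<one>\<^bsub>F\<^esub>) \<in> moves R"
| letter: "(p, q) \<in> moves R \<Longrightarrow> fst x < m \<Longrightarrow> ([x] \<otimes>\<^bsub>F\<^esub> p, [x] \<otimes>\<^bsub>F\<^esub> q) \<in> moves R"
| relator: "(p, q) \<in> moves R \<Longrightarrow> r \<in> R \<Longrightarrow> (r \<otimes>\<^bsub>F\<^esub> p, q) \<in> moves R"

definition normal_closure :: "fword set \<Rightarrow> fword set" where
  "normal_closure R = generate F {x \<otimes>\<^bsub>F\<^esub> r \<otimes>\<^bsub>F\<^esub> inv\<^bsub>F\<^esub> x | x r. x \<in> carrier F \<and> r \<in> R}"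

lemma normal_closure_normal:
  assumes "R \<subseteq> carrier F"
  shows "normal_closure R \<lhd> F"
  unfolding normal_closure_def
proof (rule F.normal_generateI)
  fix h g assume "h \<in> {x \<otimes>\<^bsub>F\<^esub> r \<otimes>\<^bsub>F\<^esub> inv\<^bsub>F\<^esub> x | x r. x \<in> carrier F \<and> r \<in> R}" "g \<in> carrier F"
  then obtain x r where "h = x \<otimes>\<^bsub>F\<^esub> r \<otimes>\<^bsub>F\<^esub> inv\<^bsub>F\<^esub> x" "x \<in> carrier F" "r \<in> R" "g \<in> carrier F" by blast
  then have "g \<otimes>\<^bsub>F\<^esub> h \<otimes>\<^bsub>F\<^esub> inv\<^bsub>F\<^esub> g = (g \<otimes>\<^bsub>F\<^esub> x) \<otimes>\<^bsub>F\<^esub> r \<otimes>\<^bsub>F\<^esub> inv\<^bsub>F\<^esub> (g \<otimes>\<^bsub>F\<^esub> x)" "g \<otimes>\<^bsub>F\<^esub> x \<in> carrier F"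
    using assms by (auto simp: F.inv_mult_group F.m_assoc subset_iff)
  with \<open>r \<in> R\<close> show "g \<otimes>\<^bsub>F\<^esub> h \<otimes>\<^bsub>F\<^esub> inv\<^bsub>F\<^esub> g \<in> {x \<otimes>\<^bsub>F\<^esub> r \<otimes>\<^bsub>F\<^esub> inv\<^bsub>F\<^esub> x | x r. x \<in> carrier F \<and> r \<in> R}" by blast
qed (use assms in auto)

lemma normal_closure_incl:
  assumes "r \<in> R" "R \<subseteq> carrier F"
  shows "r \<in> normal_closure R"
  unfolding normal_closure_def
proof (rule generate.incl)
  have "r = \<one>\<^bsub>F\<^esub> \<otimes>\<^bsub>F\<^esub> r \<otimes>\<^bsub>F\<^esub> inv\<^bsub>F\<^esub> \<one>\<^bsub>F\<^esub>" using assms by auto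
  then show "r \<in> {x \<otimes>\<^bsub>F\<^esub> r \<otimes>\<^bsub>F\<^esub> inv\<^bsub>F\<^esub> x | x r. x \<in> carrier F \<and> r \<in> R}" using assms(1) by blast
qed

lemma normal_closure_least:
  assumes "N \<lhd> F" "R \<subseteq> N"
  shows "normal_closure R \<subseteq> N"
  unfolding normal_closure_def
proof (rule F.generate_subgroup_incl)
  show "subgroup N F" by (rule normal_imp_subgroup[OF assms(1)])
  show "{x \<otimes>\<^bsub>F\<^esub> r \<otimes>\<^bsub>F\<^esub> inv\<^bsub>F\<^esub> x | x r. x \<in> carrier F \<and> r \<in> R} \<subseteq> N"
    using normal.inv_op_closed2[OF assms(1)] assms(2) by blast
qed

lemma moves_closed:
  assumes "(p, q) \<in> moves R" "R \<subseteq> carrier F"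
  shows "p \<in> carrier F \<and> q \<in> carrier F"
  using assms(1)
proof induction
  case (letter p q x)
  then have "[x] \<in> carrier F" by (simp add: free_group_def)
  then show ?case using letter by simp
qed (use assms(2) in auto)

lemma moves_mult:
  assumes "(p, q) \<in> moves R" "(p', q') \<in> moves R" "R \<subseteq> carrier F"
  shows "(p \<otimes>\<^bsub>F\<^esub> p', q \<otimes>\<^bsub>F\<^esub> q') \<in> moves R"
  using assms(1)
proof induction
  case one
  then show ?case using assms moves_closed[OF assms(2,3)] by simp
next
  case (letter p q x)
  have "[x] \<in> carrier F" using letter by (simp add: free_group_def)
  then show ?case
    using moves.letter[OF letter.IH letter.hyps(2)] moves_closed[OF letter.hyps(1) assms(3)] moves_closed[OF assms(2,3)]
    by (simp add: F.m_assoc)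
next
  case (relator p q r)
  then have "r \<in> carrier F" using assms(3) by auto
  then show ?case
    using moves.relator[OF relator.IH relator.hyps(2)] moves_closed[OF relator.hyps(1) assms(3)] moves_closed[OF assms(2,3)]
    by (simp add: F.m_assoc)
qed

lemma moves_diag: "x \<in> carrier F \<Longrightarrow> (x, x) \<in> moves R"
proof (induction x)
  case Nil
  show ?case using moves.one by (simp add: one_free_group)
next
  case (Cons a x)
  then show ?case using Cons_mult[OF Cons.prems] moves.letter[of x x R a] by simp
qed

text \<open>In \<open>inv q * p\<close> a common letter cancels, and a relator contributes its
  conjugate by \<open>q\<close>.\<close>

lemma moves_sound:
  assumes "N \<lhd> F" "R \<subseteq> N" "(p, q) \<in> moves R"
  shows "inv\<^bsub>F\<^esub> q \<otimes>\<^bsub>F\<^esub> p \<in> N"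
proof -
  have R: "R \<subseteq> carrier F"
    using assms(2) subgroup.subset[OF normal_imp_subgroup[OF assms(1)]] by blast
  have N: "subgroup N F" by (rule normal_imp_subgroup[OF assms(1)])
  show ?thesis
    using assms(3)
  proof induction
    case one
    then show ?case using N by (simp add: subgroup.one_closed)
  next
    case (letter p q x)
    have "[x] \<in> carrier F" using letter by (simp add: free_group_def)
    moreover have "p \<in> carrier F" "q \<in> carrier F" using moves_closed[OF letter.hyps(1) R] by auto
    ultimately have "inv\<^bsub>F\<^esub> ([x] \<otimes>\<^bsub>F\<^esub> q) \<otimes>\<^bsub>F\<^esub> ([x] \<otimes>\<^bsub>F\<^esub> p) = inv\<^bsub>F\<^esub> q \<otimes>\<^bsub>F\<^esub> p"
      by (simp add: F.inv_mult_group F.m_assoc)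
    then show ?case using letter by simp
  next
    case (relator p q r)
    have c: "r \<in> carrier F" "p \<in> carrier F" "q \<in> carrier F"
      using moves_closed[OF relator.hyps(1) R] relator.hyps R by auto
    then have "inv\<^bsub>F\<^esub> q \<otimes>\<^bsub>F\<^esub> (r \<otimes>\<^bsub>F\<^esub> p) = (inv\<^bsub>F\<^esub> q \<otimes>\<^bsub>F\<^esub> r \<otimes>\<^bsub>F\<^esub> q) \<otimes>\<^bsub>F\<^esub> (inv\<^bsub>F\<^esub> q \<otimes>\<^bsub>F\<^esub> p)"
      by (simp add: F.m_assoc)
    moreover have "inv\<^bsub>F\<^esub> q \<otimes>\<^bsub>F\<^esub> r \<otimes>\<^bsub>F\<^esub> q \<in> N"
      using normal.inv_op_closed1[OF assms(1) c(3)] relator.hyps(2) assms(2) by blast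
    ultimately show ?case using relator.IH N by (simp add: subgroup.m_closed)
  qed
qed

lemma normal_closure_iff_moves:
  assumes R: "R \<subseteq> carrier F" "\<And>r. r \<in> R \<Longrightarrow> inv\<^bsub>F\<^esub> r \<in> R" and u: "u \<in> carrier F"
  shows "u \<in> normal_closure R \<longleftrightarrow> (\<exists>(p, q) \<in> moves R. p \<otimes>\<^bsub>F\<^esub> u = q)"
proof
  assume "\<exists>(p, q) \<in> moves R. p \<otimes>\<^bsub>F\<^esub> u = q"
  then obtain p q where pq: "(p, q) \<in> moves R" "p \<otimes>\<^bsub>F\<^esub> u = q" by blast
  have c: "p \<in> carrier F" "q \<in> carrier F" using moves_closed[OF pq(1) R(1)] by auto
  have n: "normal_closure R \<lhd> F" by (rule normal_closure_normal[OF R(1)])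
  have "inv\<^bsub>F\<^esub> q \<otimes>\<^bsub>F\<^esub> p \<in> normal_closure R"
    using moves_sound[OF n _ pq(1)] normal_closure_incl R(1) by blast
  then have "inv\<^bsub>F\<^esub> (inv\<^bsub>F\<^esub> q \<otimes>\<^bsub>F\<^esub> p) \<in> normal_closure R"
    using subgroup.m_inv_closed[OF normal_imp_subgroup[OF n]] by blast
  moreover have "inv\<^bsub>F\<^esub> (inv\<^bsub>F\<^esub> q \<otimes>\<^bsub>F\<^esub> p) = u"
    using c(1) u unfolding pq(2)[symmetric] by (simp add: F.inv_mult_group)
  ultimately show "u \<in> normal_closure R" by simp
next
  have conj: "\<exists>(p, q) \<in> moves R. p \<otimes>\<^bsub>F\<^esub> (x \<otimes>\<^bsub>F\<^esub> r \<otimes>\<^bsub>F\<^esub> inv\<^bsub>F\<^esub> x) = q" if x: "x \<in> carrier F" and r: "r \<in> R" for x r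
  proof -
    have "(inv\<^bsub>F\<^esub> r, \<one>\<^bsub>F\<^esub>) \<in> moves R"
      using moves.relator[OF moves.one R(2)[OF r]] r R(1) by (simp add: subset_iff)
    \<comment> \<open>Since \<open>x\<close> and its inverse act on both components, the relator
      ends up conjugated in the first, and the second collapses to one.\<close>
    then have "(x \<otimes>\<^bsub>F\<^esub> inv\<^bsub>F\<^esub> r \<otimes>\<^bsub>F\<^esub> inv\<^bsub>F\<^esub> x, x \<otimes>\<^bsub>F\<^esub> \<one>\<^bsub>F\<^esub> \<otimes>\<^bsub>F\<^esub> inv\<^bsub>F\<^esub> x) \<in> moves R"
      using x by (intro moves_mult R(1) moves_diag) auto
    moreover have "(x \<otimes>\<^bsub>F\<^esub> inv\<^bsub>F\<^esub> r \<otimes>\<^bsub>F\<^esub> inv\<^bsub>F\<^esub> x) \<otimes>\<^bsub>F\<^esub> (x \<otimes>\<^bsub>F\<^esub> r \<otimes>\<^bsub>F\<^esub> inv\<^bsub>F\<^esub> x) = x \<otimes>\<^bsub>F\<^esub> \<one>\<^bsub>F\<^esub> \<otimes>\<^bsub>F\<^esub> inv\<^bsub>F\<^esub> x"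
    proof -
      have rc: "r \<in> carrier F" using r R(1) by auto
      have "(x \<otimes>\<^bsub>F\<^esub> inv\<^bsub>F\<^esub> r \<otimes>\<^bsub>F\<^esub> inv\<^bsub>F\<^esub> x) = inv\<^bsub>F\<^esub> (x \<otimes>\<^bsub>F\<^esub> r \<otimes>\<^bsub>F\<^esub> inv\<^bsub>F\<^esub> x)"
        using x rc by (simp add: F.inv_mult_group F.m_assoc)
      then show ?thesis using x rc by simp
    qed
    ultimately show ?thesis by blast
  qed
  assume "u \<in> normal_closure R"
  then show "\<exists>(p, q) \<in> moves R. p \<otimes>\<^bsub>F\<^esub> u = q"
    unfolding normal_closure_def
  proof induction
    case one
    then show ?case by (intro bexI[OF _ moves.one]) simp
  next
    case (incl h)
    then show ?case using conj by blast
  next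
    case (inv h)
    then obtain x r where h: "h = x \<otimes>\<^bsub>F\<^esub> r \<otimes>\<^bsub>F\<^esub> inv\<^bsub>F\<^esub> x" "x \<in> carrier F" "r \<in> R" by blast
    then have "inv\<^bsub>F\<^esub> h = x \<otimes>\<^bsub>F\<^esub> inv\<^bsub>F\<^esub> r \<otimes>\<^bsub>F\<^esub> inv\<^bsub>F\<^esub> x"
      using R(1) by (auto simp: F.inv_mult_group F.m_assoc subset_iff)
    then show ?case using conj[OF h(2) R(2)[OF h(3)]] by simp
  next
    case (eng u v)
    have uv: "u \<in> carrier F" "v \<in> carrier F"
      using eng.hyps F.generate_in_carrier[of "{x \<otimes>\<^bsub>F\<^esub> r \<otimes>\<^bsub>F\<^esub> inv\<^bsub>F\<^esub> x | x r. x \<in> carrier F \<and> r \<in> R}"] R(1) by auto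
    obtain p q where pq: "(p, q) \<in> moves R" "p \<otimes>\<^bsub>F\<^esub> u = q" using eng.IH(1) by blast
    obtain p' q' where pq': "(p', q') \<in> moves R" "p' \<otimes>\<^bsub>F\<^esub> v = q'" using eng.IH(2) by blast
    have c: "p \<in> carrier F" "q \<in> carrier F" "p' \<in> carrier F" "q' \<in> carrier F"
      using moves_closed[OF pq(1) R(1)] moves_closed[OF pq'(1) R(1)] by auto
    \<comment> \<open>The diagonal pair of \<open>inv q\<close> turns \<open>p\<close> into
      \<open>inv q * p\<close>, which is \<open>inv u\<close>; multiplied by \<open>u * v\<close> it
      leaves \<open>v\<close>, ready for the second derivation.\<close>
    have "(p' \<otimes>\<^bsub>F\<^esub> (inv\<^bsub>F\<^esub> q \<otimes>\<^bsub>F\<^esub> p), q' \<otimes>\<^bsub>F\<^esub> (inv\<^bsub>F\<^esub> q \<otimes>\<^bsub>F\<^esub> q)) \<in> moves R"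
      using c by (intro moves_mult R(1) moves_diag pq pq') auto
    moreover have "inv\<^bsub>F\<^esub> q \<otimes>\<^bsub>F\<^esub> p = inv\<^bsub>F\<^esub> u"
      using c(1) uv unfolding pq(2)[symmetric] by (simp add: F.inv_mult_group F.m_assoc)
    then have "p' \<otimes>\<^bsub>F\<^esub> (inv\<^bsub>F\<^esub> q \<otimes>\<^bsub>F\<^esub> p) \<otimes>\<^bsub>F\<^esub> (u \<otimes>\<^bsub>F\<^esub> v) = q' \<otimes>\<^bsub>F\<^esub> (inv\<^bsub>F\<^esub> q \<otimes>\<^bsub>F\<^esub> q)"
      using c uv pq'(2) by (simp add: F.m_assoc)
    ultimately show ?case by blast
  qed
qed

section \<open>Certificates for membership in a normal closure\<close>

definition letters :: "fword list" where
  "letters = map (\<lambda>i. [(i, True)]) [0..<m] @ map (\<lambda>i. [(i, False)]) [0..<m]"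

lemma set_letters: "set letters = {w. \<exists>x. w = [x] \<and> fst x < m}"
proof (rule Set.set_eqI)
  fix w :: fword
  show "w \<in> set letters \<longleftrightarrow> w \<in> {w. \<exists>x. w = [x] \<and> fst x < m}"
  proof
    assume "w \<in> {w. \<exists>x. w = [x] \<and> fst x < m}"
    then obtain i b where "w = [(i, b)]" "i < m" by auto
    then show "w \<in> set letters" by (cases b) (simp_all add: letters_def)
  next
    assume "w \<in> set letters"
    then have "(\<exists>i<m. w = [(i, True)]) \<or> (\<exists>i<m. w = [(i, False)])" unfolding letters_def by auto
    then show "w \<in> {w. \<exists>x. w = [x] \<and> fst x < m}" by fastforce
  qed
qed

definition common_ops :: "(nat \<Rightarrow> fword) list" where
  "common_ops = (\<lambda>_. \<one>\<^bsub>F\<^esub>) # map (\<lambda>w _. w) letters"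

lemma common_ops_cases:
  assumes "g \<in> set common_ops"
  shows "g = (\<lambda>_. \<one>\<^bsub>F\<^esub>) \<or> (\<exists>x. fst x < m \<and> g = (\<lambda>_. [x]))"
proof -
  from assms have "g = (\<lambda>_. \<one>\<^bsub>F\<^esub>) \<or> (\<exists>w \<in> set letters. g = (\<lambda>_. w))"
    by (simp add: common_ops_def image_iff)
  then show ?thesis unfolding set_letters by blast
qed

lemma tracked_common_ops:
  assumes "g \<in> set common_ops"
  shows "tracked m g"
  using common_ops_cases[OF assms]
proof
  assume "\<exists>x. fst x < m \<and> g = (\<lambda>_. [x])"
  then obtain x where "fst x < m" "g = (\<lambda>_. [x])" by blast
  then show ?thesis by (simp add: tracked_const free_group_def)
qed (simp add: tracked_const)

text \<open>The same digit read in both lists performs the two components of one move: the lists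
  share the letters, and the index of a relator lies beyond the end of the shorter list, where
  \<open>lookup\<close> gives the identity.\<close>

lemma lookup_common:
  "(\<exists>x. fst x < m \<and> lookup common_ops d n = [x] \<and> lookup (common_ops @ rs) d n = [x]) \<or>
   (lookup common_ops d n = \<one>\<^bsub>F\<^esub> \<and> (lookup (common_ops @ rs) d n = \<one>\<^bsub>F\<^esub> \<or> (\<exists>r \<in> set rs. lookup (common_ops @ rs) d n = r n)))"
proof (cases "d < length common_ops")
  case True
  then have "common_ops ! d \<in> set common_ops" by simp
  moreover have "lookup common_ops d = common_ops ! d" "lookup (common_ops @ rs) d = common_ops ! d"
    using True by (simp_all add: lookup_def nth_append)
  ultimately show ?thesis using common_ops_cases[of "common_ops ! d"] by auto
next
  case False
  then show ?thesis by (auto simp: lookup_def nth_append)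
qed

lemma walk_moves:
  assumes rs: "\<And>r. r \<in> set rs \<Longrightarrow> tracked m r"
  shows "(walk (common_ops @ rs) n \<delta> i, walk common_ops n \<delta> i) \<in> moves ((\<lambda>r. r n) ` set rs)"
proof (induction i)
  case 0
  show ?case by (simp add: moves.one)
next
  case (Suc i)
  have c: "walk (common_ops @ rs) n \<delta> i \<in> carrier F" "walk common_ops n \<delta> i \<in> carrier F"
    using rs tracked_common_ops by (auto intro!: walk_closed)
  let ?W = "lookup (common_ops @ rs) (\<delta> i) n" and ?H = "lookup common_ops (\<delta> i) n"
  consider x where "fst x < m" "?H = [x]" "?W = [x]" | "?H = \<one>\<^bsub>F\<^esub>" "?W = \<one>\<^bsub>F\<^esub>"
    | r where "r \<in> set rs" "?H = \<one>\<^bsub>F\<^esub>" "?W = r n"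
    using lookup_common[of "\<delta> i" n rs] by blast
  then show ?case
  proof cases
    case 1
    then show ?thesis using moves.letter[OF Suc] by simp
  next
    case 2
    then show ?thesis using Suc c by simp
  next
    case 3
    then show ?thesis using moves.relator[OF Suc, of "r n"] c by simp
  qed
qed

lemma walk_cong: "(\<And>j. j < i \<Longrightarrow> \<delta> j = \<delta>' j) \<Longrightarrow> walk ops n \<delta> i = walk ops n \<delta>' i"
  by (induction i) auto

lemma moves_walk:
  assumes rs: "\<And>r. r \<in> set rs \<Longrightarrow> tracked m r" and pq: "(p, q) \<in> moves ((\<lambda>r. r n) ` set rs)"
  shows "\<exists>ds. walk (common_ops @ rs) n ((!) ds) (length ds) = p \<and> walk common_ops n ((!) ds) (length ds) = q"
proof -
  have ext: "walk ops n ((!) (ds @ [d])) (length (ds @ [d])) = lookup ops d n \<otimes>\<^bsub>F\<^esub> walk ops n ((!) ds) (length ds)"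
    for ops ds d
    using walk_cong[of "length ds" "(!) (ds @ [d])" "(!) ds" ops n] by (simp add: nth_append)
  show ?thesis
    using pq
  proof induction
    case one
    then show ?case by (intro exI[of _ "[]"]) simp
  next
    case (letter p q x)
    obtain ds where ds: "walk (common_ops @ rs) n ((!) ds) (length ds) = p" "walk common_ops n ((!) ds) (length ds) = q"
      using letter.IH by blast
    have "[x] \<in> set letters" unfolding set_letters using letter by blast
    then have "(\<lambda>_. [x]) \<in> set common_ops" by (simp add: common_ops_def)
    then obtain d where d: "d < length common_ops" "common_ops ! d = (\<lambda>_. [x])" by (auto simp: in_set_conv_nth)
    have lk: "lookup (common_ops @ rs) d n = [x]" "lookup common_ops d n = [x]"
      using d by (simp_all add: lookup_def nth_append)
    show ?case by (intro exI[of _ "ds @ [d]"]) (simp only: ext ds lk)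
  next
    case (relator p q r)
    obtain ds where ds: "walk (common_ops @ rs) n ((!) ds) (length ds) = p" "walk common_ops n ((!) ds) (length ds) = q"
      using relator.IH by blast
    have q: "q \<in> carrier F" using ds(2) walk_closed[of common_ops] tracked_common_ops by blast
    obtain j where j: "j < length rs" "r = (rs ! j) n" using relator.hyps(2) by (auto simp: in_set_conv_nth)
    let ?d = "length common_ops + j"
    have lk: "lookup (common_ops @ rs) ?d n = r" "lookup common_ops ?d n = \<one>\<^bsub>F\<^esub>"
      using j by (simp_all add: lookup_def nth_append)
    show ?case by (intro exI[of _ "ds @ [?d]"]) (simp only: ext ds lk F.l_one[OF q])
  qed
qed

lemma length_le_list_encode: "length ds \<le> list_encode ds"
proof (induction ds)
  case (Cons d ds)
  then show ?case using le_prod_encode_2[of "list_encode ds" d] by simp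
qed simp

text \<open>The number \<open>c\<close> is at once the list of operations and the number of steps. A
  list is no longer than its code, and the surplus steps read digit 0, the identity.\<close>

lemma normal_closure_iff_walk:
  assumes rs: "\<And>r. r \<in> set rs \<Longrightarrow> tracked m r" and inv: "\<And>r. r \<in> set rs \<Longrightarrow> (\<lambda>n. inv\<^bsub>F\<^esub> r n) \<in> set rs"
    and u: "u \<in> carrier F"
  shows "u \<in> normal_closure ((\<lambda>r. r n) ` set rs) \<longleftrightarrow>
    (\<exists>c. walk (common_ops @ rs) n (digit c) c \<otimes>\<^bsub>F\<^esub> u = walk common_ops n (digit c) c)"
proof -
  let ?R = "((\<lambda>r. r n) ` set rs)"
  have R: "?R \<subseteq> carrier F" "\<And>r. r \<in> ?R \<Longrightarrow> inv\<^bsub>F\<^esub> r \<in> ?R"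
    using rs tracked_closed inv by auto
  have "u \<in> normal_closure ?R \<longleftrightarrow> (\<exists>(p, q) \<in> moves ?R. p \<otimes>\<^bsub>F\<^esub> u = q)"
    by (rule normal_closure_iff_moves[OF R u])
  also have "\<dots> \<longleftrightarrow> (\<exists>c. walk (common_ops @ rs) n (digit c) c \<otimes>\<^bsub>F\<^esub> u = walk common_ops n (digit c) c)"
  proof
    assume "\<exists>(p, q) \<in> moves ?R. p \<otimes>\<^bsub>F\<^esub> u = q"
    then obtain p q where pq: "(p, q) \<in> moves ?R" "p \<otimes>\<^bsub>F\<^esub> u = q" by blast
    obtain ds where ds: "walk (common_ops @ rs) n ((!) ds) (length ds) = p" "walk common_ops n ((!) ds) (length ds) = q"
      using moves_walk[OF rs pq(1)] by blast
    let ?c = "list_encode ds"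
    have "walk ops n (digit ?c) (length ds + j) = walk ops n ((!) ds) (length ds)"
      if ops: "\<And>g. g \<in> set ops \<Longrightarrow> tracked m g" "ops \<noteq> []" "hd ops = (\<lambda>_. \<one>\<^bsub>F\<^esub>)" for ops j
    proof (induction j)
      case 0
      show ?case
        unfolding add_0_right by (rule walk_cong) (simp add: digit_list_encode)
    next
      case (Suc j)
      have "lookup ops 0 n = \<one>\<^bsub>F\<^esub>" using ops by (cases ops) (auto simp: lookup_def)
      then show ?case using Suc walk_closed[OF ops(1)] by (simp add: digit_list_encode)
    qed
    from this[of _ "?c - length ds"]
    have "walk ops n (digit ?c) ?c = walk ops n ((!) ds) (length ds)"
      if "\<And>g. g \<in> set ops \<Longrightarrow> tracked m g" "ops \<noteq> []" "hd ops = (\<lambda>_. \<one>\<^bsub>F\<^esub>)" for ops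
      using that length_le_list_encode[of ds] by simp
    from this[of "common_ops @ rs"] this[of common_ops]
    have "walk (common_ops @ rs) n (digit ?c) ?c = p" "walk common_ops n (digit ?c) ?c = q"
      using ds rs tracked_common_ops by (auto simp: common_ops_def)
    then show "\<exists>c. walk (common_ops @ rs) n (digit c) c \<otimes>\<^bsub>F\<^esub> u = walk common_ops n (digit c) c"
      using pq(2) by (intro exI[of _ ?c]) simp
  next
    assume "\<exists>c. walk (common_ops @ rs) n (digit c) c \<otimes>\<^bsub>F\<^esub> u = walk common_ops n (digit c) c"
    then show "\<exists>(p, q) \<in> moves ?R. p \<otimes>\<^bsub>F\<^esub> u = q"
      using walk_moves[OF rs] by fast
  qed
  finally show ?thesis .
qed

text \<open>The relators may vary with \<open>n\<close>; this permits the word in question to be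
  adjoined as a relator itself.\<close>

lemma normal_closure_semidecidable:
  assumes rs: "\<And>r. r \<in> set rs \<Longrightarrow> tracked m r" and inv: "\<And>r. r \<in> set rs \<Longrightarrow> (\<lambda>n. inv\<^bsub>F\<^esub> r n) \<in> set rs"
    and u: "tracked m u"
  shows "\<exists>D. computable 2 (\<lambda>xs. D (xs ! 0) (xs ! 1)) \<and> (\<forall>n. u n \<in> normal_closure ((\<lambda>r. r n) ` set rs) \<longleftrightarrow> (\<exists>c. D c n = 0))"
proof -
  have one: "tracked m (\<lambda>_. \<one>\<^bsub>F\<^esub>)" by (intro tracked_const) simp
  let ?W = "\<lambda>c n. encode_fword (walk (common_ops @ rs) n (digit c) c \<otimes>\<^bsub>F\<^esub> u n)"
  let ?H = "\<lambda>c n. encode_fword (walk common_ops n (digit c) c \<otimes>\<^bsub>F\<^esub> \<one>\<^bsub>F\<^esub>)"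
  have "computable 2 (\<lambda>xs. if ?W (xs ! 0) (xs ! 1) = ?H (xs ! 0) (xs ! 1) then 0 else 1)"
    using rs tracked_common_ops
    by (intro computable_if_eq computable_walk[OF _ u] computable_walk[OF _ one] computable_const) auto
  moreover have "u n \<in> normal_closure ((\<lambda>r. r n) ` set rs) \<longleftrightarrow> (\<exists>c. (if ?W c n = ?H c n then 0 else 1) = (0 :: nat))" for n
    using normal_closure_iff_walk[OF rs inv tracked_closed[OF u], of n] walk_closed[of common_ops n] tracked_common_ops
    by (simp add: inj_eq[OF inj_encode_fword])
  ultimately show ?thesis
    by (intro exI[of _ "\<lambda>c n. if ?W c n = ?H c n then 0 else 1"] conjI allI)
qed

lemma semidecidable_list:
  assumes "\<And>P. P \<in> set Ps \<Longrightarrow> \<exists>D. computable 2 (\<lambda>xs. D (xs ! 0) (xs ! 1)) \<and> (\<forall>n. P n \<longleftrightarrow> (\<exists>c. D c n = 0))"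
  shows "\<exists>D. computable 2 (\<lambda>xs. D (xs ! 0) (xs ! 1)) \<and> (\<forall>n :: nat. (\<exists>P \<in> set Ps. P n) \<longleftrightarrow> (\<exists>c :: nat. D c n = (0 :: nat)))"
  using assms
proof (induction Ps)
  case Nil
  show ?case by (rule exI[of _ "\<lambda>_ _. 1"]) (simp add: computable_const)
next
  case (Cons P Ps)
  obtain D where D: "computable 2 (\<lambda>xs. D (xs ! 0) (xs ! 1))" "\<And>n. (\<exists>P \<in> set Ps. P n) \<longleftrightarrow> (\<exists>c. D c n = 0)"
    using Cons by auto
  obtain D' where D': "computable 2 (\<lambda>xs. D' (xs ! 0) (xs ! 1))" "\<And>n. P n \<longleftrightarrow> (\<exists>c. D' c n = 0)"
    using Cons.prems[of P] by auto
  let ?D = "\<lambda>c n. if D' c n = 0 then 0 else D c n"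
  have "computable 2 (\<lambda>xs. ?D (xs ! 0) (xs ! 1))"
    by (intro computable_if D D' computable_const)
  moreover have "(\<exists>P \<in> set (P # Ps). P n) \<longleftrightarrow> (\<exists>c. ?D c n = 0)" for n
  proof -
    have "(\<exists>P \<in> set (P # Ps). P n) \<longleftrightarrow> P n \<or> (\<exists>P \<in> set Ps. P n)" by simp
    also have "\<dots> \<longleftrightarrow> (\<exists>c. D' c n = 0 \<or> D c n = 0)" unfolding D(2) D'(2) by blast
    also have "\<dots> \<longleftrightarrow> (\<exists>c. ?D c n = 0)"
    proof -
      have "?D c n = 0 \<longleftrightarrow> D' c n = 0 \<or> D c n = 0" for c by simp
      then show ?thesis by (simp only:)
    qed
    finally show ?thesis .
  qed
  ultimately show ?case by (intro exI[of _ ?D] conjI allI)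
qed

text \<open>A search for a certificate of either kind always ends, and evaluating \<open>D\<close>
  at the number found tells which kind it is.\<close>

lemma decides_if_semidecidable:
  assumes "computable 2 (\<lambda>xs. D (xs ! 0) (xs ! 1))" "\<And>n. g n \<in> N \<longleftrightarrow> (\<exists>c. D c n = 0)"
    and "computable 2 (\<lambda>xs. D' (xs ! 0) (xs ! 1))" "\<And>n. g n \<notin> N \<longleftrightarrow> (\<exists>c. D' c n = 0)"
  shows "decides N g"
proof (rule decidesI)
  let ?E = "\<lambda>c n. if D c n = 0 then 0 else D' c n"
  let ?c = "\<lambda>n. LEAST c. ?E c n = 0"
  have ex: "\<exists>c. ?E c n = 0" for n
  proof (cases "\<exists>c. D c n = 0")
    case False
    then obtain c where "D' c n = 0" using assms(2)[of n] assms(4)[of n] by blast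
    then show ?thesis by (intro exI[of _ c]) simp
  next
    case True
    then obtain c where "D c n = 0" by blast
    then show ?thesis by (intro exI[of _ c]) simp
  qed
  have "computable 2 (\<lambda>xs. ?E (xs ! 0) (xs ! 1))"
    by (intro computable_if assms computable_const)
  then have "computable 1 (\<lambda>xs. LEAST c. ?E ((c # xs) ! 0) ((c # xs) ! 1) = 0)"
    using ex by (intro computable_least) (simp_all only: numeral_2_eq_2 One_nat_def nth_Cons_0 nth_Cons_Suc)
  then have "computable 1 (\<lambda>xs. ?c (xs ! 0))"
    by (simp only: One_nat_def nth_Cons_0 nth_Cons_Suc)
  from computable_comp2[OF assms(1) this computable_nth[of 0 1]]
  have "computable 1 (\<lambda>xs. D (?c (xs ! 0)) (xs ! 0))" by simp
  then have "computable 1 (\<lambda>xs. if D (?c (xs ! 0)) (xs ! 0) = 0 then 1 else 0)"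
    by (intro computable_if computable_const)
  moreover have "D (?c n) n = 0 \<longleftrightarrow> g n \<in> N" for n
  proof
    assume "g n \<in> N"
    have "D' (?c n) n \<noteq> 0"
    proof
      assume "D' (?c n) n = 0"
      then have "g n \<notin> N" by (intro iffD2[OF assms(4)] exI)
      with \<open>g n \<in> N\<close> show False by contradiction
    qed
    moreover have "?E (?c n) n = 0" by (rule LeastI_ex[OF ex])
    ultimately show "D (?c n) n = 0" by presburger
  qed (use assms(2) in blast)
  ultimately show "computable 1 (\<lambda>xs. if g (xs ! 0) \<in> N then 1 else 0)" by simp
qed

theorem decides_isolated:
  assumes N: "N \<lhd> F" and iso: "openin (marked_groups m) {N}" and g: "tracked m g"
  shows "decides N g"
proof -
  obtain Z where Z: "finite Z" "Z \<subseteq> carrier F" "\<And>N'. N' \<lhd> F \<Longrightarrow> N' \<inter> Z = N \<inter> Z \<Longrightarrow> N' = N"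
    using openin_marked_groupsD[OF iso] by auto
  obtain rl where rl: "set rl = N \<inter> Z" using Z(1) by (metis finite_list finite_Int)
  obtain pl where pl: "set pl = Z - N" using Z(1) by (metis finite_list finite_Diff)
  have Nsub: "subgroup N F" by (rule normal_imp_subgroup[OF N])
  define rs where "rs = map (\<lambda>w _ :: nat. w) (rl @ map (\<lambda>w. inv\<^bsub>F\<^esub> w) rl)"
  define rs' where "rs' = rs @ [g, \<lambda>n. inv\<^bsub>F\<^esub> g n]"
  have rs: "tracked m r" if "r \<in> set rs" for r
    using that rl Z(2) by (auto simp: rs_def intro!: tracked_const)
  have rs': "tracked m r" if "r \<in> set rs'" for r
    using that rs g tracked_inv[OF g] by (auto simp: rs'_def)
  have inv: "(\<lambda>n. inv\<^bsub>F\<^esub> r n) \<in> set rs" if r: "r \<in> set rs" for r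
  proof -
    obtain w where "w \<in> set rl" "r = (\<lambda>_. w) \<or> r = (\<lambda>_. inv\<^bsub>F\<^esub> w)"
      using r unfolding rs_def set_map set_append by blast
    moreover have "w \<in> carrier F" using \<open>w \<in> set rl\<close> rl Z(2) by auto
    ultimately show ?thesis by (auto simp: rs_def)
  qed
  have inv': "(\<lambda>n. inv\<^bsub>F\<^esub> r n) \<in> set rs'" if "r \<in> set rs'" for r
    using that inv tracked_closed[OF g] by (auto simp: rs'_def)
  let ?R = "\<lambda>rs n. ((\<lambda>r. r n) ` set rs)"
  have RN: "?R rs n \<subseteq> N" for n
    using rl subgroup.m_inv_closed[OF Nsub] by (auto simp: rs_def)
  have Rc: "?R rs n \<subseteq> carrier F" "?R rs' n \<subseteq> carrier F" for n
    using rs rs' tracked_closed by auto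
  have RZ: "N \<inter> Z \<subseteq> ?R rs n" "N \<inter> Z \<subseteq> ?R rs' n" for n
    using rl by (auto simp: rs_def rs'_def)
  \<comment> \<open>The closure of the relators in \<open>Z\<close> lies in \<open>N\<close> and
    contains \<open>N \<inter> Z\<close>, so it meets \<open>Z\<close> in the same words as
    \<open>N\<close>, and isolation identifies the two.\<close>
  have "normal_closure (?R rs n) = N" for n
  proof (rule Z(3)[OF normal_closure_normal[OF Rc(1)]])
    show "normal_closure (?R rs n) \<inter> Z = N \<inter> Z"
      using normal_closure_least[OF N RN] RZ(1)[of n] normal_closure_incl[OF _ Rc(1)[of n]] by blast
  qed
  then obtain D where D: "computable 2 (\<lambda>xs. D (xs ! 0) (xs ! 1))" "\<And>n. g n \<in> N \<longleftrightarrow> (\<exists>c. D c n = 0)"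
    using normal_closure_semidecidable[OF rs inv g] by auto
  have sd: "\<exists>D. computable 2 (\<lambda>xs. D (xs ! 0) (xs ! 1)) \<and> (\<forall>n. P n \<longleftrightarrow> (\<exists>c. D c n = 0))"
    if P: "P \<in> set (map (\<lambda>w n. w \<in> normal_closure (?R rs' n)) pl)" for P
  proof -
    obtain w where w: "w \<in> set pl" "P = (\<lambda>n. w \<in> normal_closure (?R rs' n))"
      using P unfolding set_map by blast
    then have "tracked m (\<lambda>_. w)" using pl Z(2) by (intro tracked_const) auto
    from normal_closure_semidecidable[OF rs' inv' this] show ?thesis unfolding w(2) .
  qed
  let ?Ps = "map (\<lambda>w n. w \<in> normal_closure (?R rs' n)) pl"
  have "\<exists>D. computable 2 (\<lambda>xs. D (xs ! 0) (xs ! 1)) \<and> (\<forall>n. (\<exists>P \<in> set ?Ps. P n) \<longleftrightarrow> (\<exists>c. D c n = 0))"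
    by (rule semidecidable_list) (rule sd)
  then obtain D' where D'': "computable 2 (\<lambda>xs. D' (xs ! 0) (xs ! 1)) \<and>
    (\<forall>n. (\<exists>P \<in> set ?Ps. P n) \<longleftrightarrow> (\<exists>c. D' c n = 0))"
    by (rule exE)
  note D' = conjunct1[OF D''] spec[OF conjunct2[OF D'']]
  have D'2: "(\<exists>w \<in> Z - N. w \<in> normal_closure (?R rs' n)) \<longleftrightarrow> (\<exists>c. D' c n = 0)" for n
    unfolding D'(2)[symmetric] pl[symmetric] by simp
  \<comment> \<open>If adjoining \<open>g n\<close> killed no word of \<open>Z - N\<close>, the
    closure would meet \<open>Z\<close> as \<open>N\<close> does and so equal \<open>N\<close>,
    although it contains \<open>g n\<close>.\<close>
  have "g n \<notin> N \<longleftrightarrow> (\<exists>w \<in> Z - N. w \<in> normal_closure (?R rs' n))" for n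
  proof
    assume gn: "g n \<notin> N"
    have "g n \<in> normal_closure (?R rs' n)" by (rule normal_closure_incl[OF _ Rc(2)]) (auto simp: rs'_def)
    then have "normal_closure (?R rs' n) \<inter> Z \<noteq> N \<inter> Z" using gn Z(3)[OF normal_closure_normal[OF Rc(2)[of n]]] by auto
    moreover have "N \<inter> Z \<subseteq> normal_closure (?R rs' n)" using RZ(2)[of n] normal_closure_incl[OF _ Rc(2)[of n]] by blast
    ultimately show "\<exists>w \<in> Z - N. w \<in> normal_closure (?R rs' n)" by blast
  next
    assume ex: "\<exists>w \<in> Z - N. w \<in> normal_closure (?R rs' n)"
    show "g n \<notin> N"
    proof
      assume "g n \<in> N"
      then have "?R rs' n \<subseteq> N"
        using RN[of n] subgroup.m_inv_closed[OF Nsub] by (auto simp: rs'_def)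
      then show False using ex normal_closure_least[OF N] by blast
    qed
  qed
  then show ?thesis
    by (intro decides_if_semidecidable[OF D D'(1)]) (simp only: D'2)
qed

end

section \<open>The main theorem\<close>

lemma geval_cong: "(\<And>i. i \<in> gens e \<Longrightarrow> a i = b i) \<Longrightarrow> geval G a e = geval G b e"
  by (induction e) auto

lemma finite_vars: "finite (vars t)"
  by (induction t) auto

lemma finite_system: "finite system"
  by (simp add: system_def tree_eqs_def rule_eqs_def sgens_def finite_vars)

lemma gens_cj: "gens (cj u v) = gens u \<union> gens v"
  by (auto simp: cj_def)

lemma gens_tree_exp: "gens (tree_exp p s) \<subseteq> {..<6} \<union> (\<Union>i. gens (s i))"
  by (induction p) (auto simp: gens_cj)

lemma gens_leaf_exp: "gens (leaf_exp p s) \<subseteq> {..<6} \<union> (\<Union>i. gens (s i))"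
  by (induction p) (auto simp: gens_cj)

lemma gens_tok: "gens (tok p) \<subseteq> {..<6}"
  using gens_tree_exp[of p "\<lambda>_. One"] by (auto simp: tok_def gens_cj)

lemma gens_sgens: "s \<in> sgens \<Longrightarrow> gens s \<subseteq> {..<6}"
  by (auto simp: sgens_def gens_cj)

abbreviation "gen_count \<equiv> 6 + length rules"

lemma gens_commutes: "gens (fst (commutes u v)) \<union> gens (snd (commutes u v)) = gens u \<union> gens v"
  by (auto simp: commutes_def)

lemma gens_rule_eqs:
  assumes "i < length rules" "e \<in> rule_eqs i l r"
  shows "gens (fst e) \<union> gens (snd e) \<subseteq> {..<gen_count}"
proof -
  have d: "gens (leaf_exp p ((\<lambda>_. One)(v := s))) \<subseteq> {..<6}" if "s \<in> sgens" for p v s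
  proof -
    have "gens (((\<lambda>_. One)(v := s)) i) \<subseteq> {..<6}" for i
      using gens_sgens[OF that] by (cases "i = v") auto
    then show ?thesis using gens_leaf_exp[of p "(\<lambda>_. One)(v := s)"] by blast
  qed
  have 6: "{..<6} \<subseteq> {..<gen_count}" by auto
  consider "e = commutes gK (gR i)" | "e = (Mul (gR i) (tok l), Mul (tok r) (gR i))"
    | v s where "s \<in> sgens" "e = (Mul (gR i) (leaf_exp l ((\<lambda>_. One)(v := s))), Mul (leaf_exp r ((\<lambda>_. One)(v := s))) (gR i))"
    using assms(2) unfolding rule_eqs_def by blast
  then show ?thesis
  proof cases
    case 1
    then show ?thesis using assms(1) by (simp add: gens_commutes)
  next
    case 2
    then show ?thesis using assms(1) gens_tok[of l] gens_tok[of r] 6 by auto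
  next
    case (3 v s)
    then show ?thesis using assms(1) d[of s l v] d[of s r v] 6 by auto
  qed
qed

lemma gens_system:
  assumes "e \<in> insert diseq system"
  shows "gens (fst e) \<union> gens (snd e) \<subseteq> {..<gen_count}"
proof -
  have 6: "{..<6} \<subseteq> {..<gen_count}" by auto
  consider "e \<in> tree_eqs" | i where "i < length rules" "e \<in> rule_eqs i (fst (rules ! i)) (snd (rules ! i))"
    | t where "e = commutes gK (tok t)"
    using assms unfolding system_def diseq_def by blast
  then show ?thesis
  proof cases
    case 1
    then consider s where "s \<in> {gA, gB}" "e \<in> {(cj gX (cj gX s), cj (Inv gA) (cj gX s)),
        (cj gY (cj gY s), cj gA (cj gY s)), (cj gY (cj gX s), cj gB (cj gX (cj gX s))),
        (cj gX (cj gY s), cj gB (cj gY (cj gY s)))}"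
      | s s' where "s \<in> sgens" "s' \<in> sgens" "e = commutes (cj gX s) (cj gY s')"
      unfolding tree_eqs_def by blast
    then have "gens (fst e) \<union> gens (snd e) \<subseteq> {..<6}"
    proof cases
      case (1 s)
      then show ?thesis by (auto simp: gens_cj)
    next
      case (2 s s')
      then show ?thesis using gens_sgens[of s] gens_sgens[of s'] by (simp add: gens_commutes gens_cj)
    qed
    then show ?thesis using 6 by (rule order_trans)
  next
    case (2 i)
    then show ?thesis by (rule gens_rule_eqs)
  next
    case (3 t)
    then show ?thesis using gens_tok[of t] 6 by (auto simp: gens_commutes)
  qed
qed

text \<open>A product of two \<open>n\<close>-th powers, hence a computable sequence of words.\<close>

lemma (in group) geval_tree_exp_num:
  assumes "\<And>i. a i \<in> carrier G"
  shows "geval G a (tree_exp (num n) s) = a 2 [^] n \<otimes> (inv a 2 \<otimes> a 0) [^] n"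
proof (induction n)
  case (Suc n)
  have "geval G a (tree_exp (num (Suc n)) s) = a 2 \<otimes> (a 2 [^] n \<otimes> (inv a 2 \<otimes> a 0) [^] n) \<otimes> (inv a 2 \<otimes> a 0)"
    using Suc assms by (simp add: m_assoc)
  also have "\<dots> = (a 2 \<otimes> a 2 [^] n) \<otimes> ((inv a 2 \<otimes> a 0) [^] n \<otimes> (inv a 2 \<otimes> a 0))"
    using assms by (simp add: m_assoc)
  finally show ?case
    unfolding nat_pow_Suc nat_pow_Suc2[OF assms(1)[of 2], symmetric]
    using assms by (simp add: nat_pow_Suc2[symmetric])
qed simp

lemma tracked_geval:
  assumes "\<And>i. b i \<in> carrier (free_group m)"
  shows "tracked m (\<lambda>_. geval (free_group m) b e)"
  by (intro tracked_const group.geval_closed group_free_group assms)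

lemma tracked_cj:
  assumes "\<And>i. b i \<in> carrier (free_group m)" "tracked m (\<lambda>n. geval (free_group m) b (e n))"
    "tracked m (\<lambda>n. geval (free_group m) b (c n))"
  shows "tracked m (\<lambda>n. geval (free_group m) b (cj (c n) (e n)))"
  unfolding geval_cj by (intro tracked_mult tracked_inv assms)

lemma tracked_Nd:
  assumes "\<And>i. b i \<in> carrier (free_group m)" "tracked m (\<lambda>n. geval (free_group m) b (tree_exp (p n) s))"
    "tracked m (\<lambda>n. geval (free_group m) b (tree_exp (q n) s))"
  shows "tracked m (\<lambda>n. geval (free_group m) b (tree_exp (Nd (p n) (q n)) s))"
  unfolding tree_exp.simps geval.simps(3) by (intro tracked_mult tracked_cj tracked_geval assms)

lemma tracked_num:
  assumes "\<And>i. b i \<in> carrier (free_group m)"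
  shows "tracked m (\<lambda>n. geval (free_group m) b (tree_exp (num n) s))"
  unfolding group.geval_tree_exp_num[OF group_free_group assms]
  by (intro tracked_mult tracked_pow tracked_inv tracked_const assms)

text \<open>\<open>M\<close> may present the quotient on other generators than the unknowns. The
  unknowns are therefore lifted to words \<open>b i\<close> in the free group of that presentation,
  and the sequence to be decided is built from these words.\<close>

lemma no_decider:
  assumes N: "N \<lhd> free_group gen_count"
    and sys: "\<And>e. e \<in> system \<Longrightarrow> holds (free_group gen_count Mod N) (\<lambda>i. N #>\<^bsub>free_group gen_count\<^esub> fgen i) e"
    and dis: "\<not> holds (free_group gen_count Mod N) (\<lambda>i. N #>\<^bsub>free_group gen_count\<^esub> fgen i) diseq"
    and M: "M \<lhd> free_group m" "free_group m Mod M \<cong> free_group gen_count Mod N"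
    and dec: "\<And>g. tracked m g \<Longrightarrow> decides M g"
  shows False
proof -
  let ?F = "free_group m" and ?Q = "free_group gen_count Mod N" and ?P = "free_group m Mod M"
  let ?a = "\<lambda>i. N #>\<^bsub>free_group gen_count\<^esub> fgen i"
  interpret F: group ?F by (rule group_free_group)
  interpret Q: group ?Q by (rule normal.factorgroup_is_group[OF N])
  interpret P: group ?P by (rule normal.factorgroup_is_group[OF M(1)])
  interpret q: group_hom ?F ?P "\<lambda>x. M #>\<^bsub>?F\<^esub> x" by (rule normal_group_hom[OF M(1)])
  interpret qN: group_hom "free_group gen_count" ?Q "\<lambda>x. N #>\<^bsub>free_group gen_count\<^esub> x" by (rule normal_group_hom[OF N])
  obtain \<psi> where \<psi>: "\<psi> \<in> iso ?Q ?P"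
    using P.iso_sym[OF M(2)] unfolding is_iso_def by blast
  interpret \<psi>: group_hom ?Q ?P \<psi>
    using \<psi> by (intro group_hom.intro group_hom_axioms.intro Q.is_group P.is_group) (simp add: iso_def)
  have a: "?a i \<in> carrier ?Q" if "i < gen_count" for i using that by (intro qN.hom_closed) simp
  have "\<exists>x\<in>carrier ?F. M #>\<^bsub>?F\<^esub> x = \<psi> (?a i)" if "i < gen_count" for i
    using \<psi>.hom_closed[OF a[OF that]] by (auto simp: FactGroup_def RCOSETS_def)
  then obtain b0 where b0: "\<And>i. i < gen_count \<Longrightarrow> b0 i \<in> carrier ?F" "\<And>i. i < gen_count \<Longrightarrow> M #>\<^bsub>?F\<^esub> b0 i = \<psi> (?a i)"
    by metis
  \<comment> \<open>\<open>system_group\<close> interprets every index, so the indices beyond the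
    unknowns get the value one.\<close>
  define b where "b i = (if i < gen_count then b0 i else \<one>\<^bsub>?F\<^esub>)" for i
  have b: "b i \<in> carrier ?F" for i using b0 by (simp add: b_def)
  define c where "c i = M #>\<^bsub>?F\<^esub> b i" for i
  have c: "c i \<in> carrier ?P" for i unfolding c_def by (intro q.hom_closed b)
  have ev: "geval ?P c u = \<psi> (geval ?Q ?a u)" if "gens u \<subseteq> {..<gen_count}" for u
  proof -
    have "\<psi> (geval ?Q ?a u) = geval ?P (\<lambda>i. \<psi> (?a i)) u"
      using that a by (intro \<psi>.geval_hom) blast
    also have "\<dots> = geval ?P c u"
      using that b0 by (intro geval_cong) (auto simp: c_def b_def)
    finally show ?thesis by simp
  qed
  have cl: "geval ?Q ?a u \<in> carrier ?Q" if "gens u \<subseteq> {..<gen_count}" for u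
    using that a by (intro Q.geval_closed) blast
  have inj: "inj_on \<psi> (carrier ?Q)" using \<psi> by (auto simp: iso_def bij_betw_def)
  have hl: "holds ?P c e \<longleftrightarrow> holds ?Q ?a e" if "e \<in> insert diseq system" for e
    using gens_system[OF that] unfolding holds_def by (simp add: ev cl inj_on_eq_iff[OF inj])
  interpret S: system_group ?P c
    by unfold_locales (use c hl sys in auto)
  define g where "g n = geval ?F b (Mul (Mul gK (tok (start n))) (Inv (Mul (tok (start n)) gK)))" for n
  have fixed: "S.fixed (S.val (start n)) \<longleftrightarrow> g n \<in> M" for n
  proof -
    let ?u = "Mul gK (tok (start n))" and ?v = "Mul (tok (start n)) gK"
    have "S.fixed (S.val (start n)) \<longleftrightarrow> geval ?P c ?u = geval ?P c ?v"
      unfolding S.fixed_def geval.simps S.E_tok ..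
    also have "\<dots> \<longleftrightarrow> M #>\<^bsub>?F\<^esub> geval ?F b ?u = M #>\<^bsub>?F\<^esub> geval ?F b ?v"
      unfolding c_def by (simp only: q.geval_hom[OF b])
    also have "\<dots> \<longleftrightarrow> geval ?F b ?u \<otimes>\<^bsub>?F\<^esub> inv\<^bsub>?F\<^esub> geval ?F b ?v \<in> M"
      by (intro rcos_eq_iff[OF M(1)] F.geval_closed b)
    also have "\<dots> \<longleftrightarrow> g n \<in> M" by (simp add: g_def)
    finally show ?thesis .
  qed
  \<comment> \<open>Only the two numerals in \<open>start n\<close> depend on \<open>n\<close>, and
    each is a product of two powers.\<close>
  have "tracked m (\<lambda>n. geval ?F b (tree_exp (start n) (\<lambda>_. One)))"
    unfolding start_def by (intro tracked_Nd tracked_num tracked_geval b)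
  then have t: "tracked m (\<lambda>n. geval ?F b (tok (start n)))"
    unfolding tok_def by (intro tracked_cj tracked_geval b)
  have "tracked m g"
    unfolding g_def geval.simps(3,4) by (intro tracked_mult tracked_inv t tracked_geval b)
  from dec[OF this] obtain f where f: "\<And>n. computes f [n] (if g n \<in> M then 1 else 0)"
    unfolding decides_def by blast
  have "computes f [n] (if S.fixed (S.val (start n)) then 1 else 0)" for n
    unfolding fixed by (rule f)
  moreover have "\<not> holds ?P c diseq" using hl[of diseq] dis by simp
  ultimately show False by (intro S.not_decidable)
qed

theorem proposition6:
  shows "\<not> dense_class solvable_word_problem \<and> \<not> dense_class isolated_group"
proof
  show "\<not> dense_class solvable_word_problem"
  proof (rule not_dense_class_if_system[OF finite_system gens_system _ group_sym_group model_closed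
        model_system model_diseq], assumption, simp, assumption, rule notI)
    fix N assume N: "N \<lhd> free_group gen_count"
      "\<And>e. e \<in> system \<Longrightarrow> holds (free_group gen_count Mod N) (\<lambda>i. N #>\<^bsub>free_group gen_count\<^esub> fgen i) e"
      "\<not> holds (free_group gen_count Mod N) (\<lambda>i. N #>\<^bsub>free_group gen_count\<^esub> fgen i) diseq"
      "solvable_word_problem (free_group gen_count Mod N)"
    then obtain m M where "M \<lhd> free_group m" "free_group m Mod M \<cong> free_group gen_count Mod N"
      "recursive_set (encode_fword ` M)" by (auto simp: solvable_word_problem_def)
    then show False using no_decider[OF N(1-3)] decides_recursive by blast
  qed
  show "\<not> dense_class isolated_group"
  proof (rule not_dense_class_if_system[OF finite_system gens_system _ group_sym_group model_closed
        model_system model_diseq], assumption, simp, assumption, rule notI)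
    fix N assume N: "N \<lhd> free_group gen_count"
      "\<And>e. e \<in> system \<Longrightarrow> holds (free_group gen_count Mod N) (\<lambda>i. N #>\<^bsub>free_group gen_count\<^esub> fgen i) e"
      "\<not> holds (free_group gen_count Mod N) (\<lambda>i. N #>\<^bsub>free_group gen_count\<^esub> fgen i) diseq"
      "isolated_group (free_group gen_count Mod N)"
    then obtain m M where "M \<lhd> free_group m" "free_group m Mod M \<cong> free_group gen_count Mod N"
      "openin (marked_groups m) {M}" by (auto simp: isolated_group_def)
    then show False using no_decider[OF N(1-3)] decides_isolated by blast
  qed
qed

end
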